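(* Let $\Psi\in\mathcal{S}_+^{m\times m}$ and let $\Sigma=\Sigma^\top\in\mathbb{R}^{n\times n}$ be positive definite. Suppose that there exists $H\in\mathbb{R}^{m\times n}$ with $\Sigma-A\Sigma A^\top=BH+H^\top B^\top$. Consider the problem $$\text{minimize } d_{RER}(\Phi,\Psi)\ \text{ over }\ \left\{\Phi\in\mathcal{S}_+^{m\times m}:\ \int G\Phi G^*=\Sigma\right\}.$$ Without loss of generality let $\Sigma=I$: if $\Sigma\neq I$, replacing $G$ by $\Sigma^{-1/2}G$ and $(A,B)$ by $(\Sigma^{-1/2}A\Sigma^{1/2},\Sigma^{-1/2}B)$ gives an equivalent problem with $\Sigma=I$. Then: 1. There exists a unique $\Lambda^\circ\in\mathcal{L}_+^\Gamma$ minimizing $J_\Psi$ over $\mathcal{L}_+^\Gamma$. It annihilates the directional derivative of $J_\Psi$ in every direction $\delta\Lambda$ in the space of real symmetric $n\times n$ matrices; equivalently, $$I=\int G_1(I+G_1^*\Lambda^\circ G_1)^{-1}G_1^*=\int G\Phi^\circ G^*,\qquad \Phi^\circ:=\left[\Psi^{-1}+G^*\Lambda^\circ G\right]^{-1}.$$ 2. The spectral density $\Phi^\circ=\left[\Psi^{-1}+G^*\Lambda^\circ G\right]^{-1}$ is the unique solution of the minimization problem. 3. The McMillan degree of the solution satisfies $\deg[\Phi^\circ]\le\deg[\Psi]+2n$.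
   Context: $\mathbb{T}$ is the unit circle; $\int$ denotes integration over $\mathbb{T}$ with respect to normalized Lebesgue measure; $^*$ denotes conjugate transpose on $\mathbb{T}$; ${\rm j}$ is the imaginary unit. $\mathcal{S}_+^{m\times m}$ is the family of bounded and coercive spectral densities on $\mathbb{T}$ of $\mathbb{R}^m$-valued stationary processes (coercive: $\Phi\ge\alpha I_m$ a.e. for some $\alpha>0$). $G(z)=(zI-A)^{-1}B$, where $A\in\mathbb{R}^{n\times n}$ has all eigenvalues in the open unit disc, $B\in\mathbb{R}^{n\times m}$ has full rank, $n\ge m$, and $(A,B)$ is reachable (so $G$ has McMillan degree $n$). The relative-entropy-rate pseudo-distance is $$d_{RER}(\Phi,\Psi):=\frac{1}{4\pi}\int_{-\pi}^{\pi}\left\{\log\det\left(\Phi^{-1}(e^{{\rm j}\vartheta})\Psi(e^{{\rm j}\vartheta})\right)+\operatorname{tr}\left[\Psi^{-1}(e^{{\rm j}\vartheta})\left(\Phi(e^{{\rm j}\vartheta})-\Psi(e^{{\rm j}\vartheta})\right)\right]\right\}d\vartheta.$$ $W_\Psi$ is the stable, minimum phase spectral factor of $\Psi$ ($\Psi=W_\Psi W_\Psi^*$), and $G_1:=GW_\Psi$. $\Gamma(\Phi):=\int G\Phi G^*$ is the linear map from the real linear span of the continuous spectral densities on $\mathbb{T}$ of $\mathbb{R}^m$-valued processes to the real symmetric $n\times n$ matrices. With $\Sigma=I$, $$\mathcal{L}_+^\Gamma:=\{\Lambda\in\mathrm{Range}(\Gamma):\ I+G_1^*\Lambda G_1>0\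 \text{a.e. on }\mathbb{T}\},\qquad J_\Psi(\Lambda):=\int\left[\operatorname{tr}\Lambda-\log\det(I+G_1^*\Lambda G_1)\right].$$ $\deg[\cdot]$ denotes the McMillan degree.
   Formalization: Ψ is additionally assumed to agree a.e. with a Lipschitz function on the unit circle (true for every rational Ψ in S_+); for merely bounded, coercive Ψ the claim fails, e.g. m=n=1, A=0, B=Σ=1, Ψ=1/(1+10√|θ|), where no Λ satisfies the stationarity condition. *)

theory Defs
  imports "HOL-Analysis.Analysis" "HOL-Computational_Algebra.Polynomial"
begin

section \<open>Complex matrices\<close>

definition cmat :: "real^'n^'k \<Rightarrow> complex^'n^'k" where
  "cmat M = (\<chi> i j. complex_of_real (M $ i $ j))"

definition conj_mat :: "complex^'n^'k \<Rightarrow> complex^'n^'k" where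
  "conj_mat M = (\<chi> i j. cnj (M $ i $ j))"

definition adj :: "complex^'n^'k \<Rightarrow> complex^'k^'n" where
  "adj M = transpose (conj_mat M)"

text \<open>The inner product on \<^typ>\<open>complex^'n\<close> is the real one, so \<open>x \<bullet> (M *v x)\<close> is the real part of
  the Hermitian form \<open>x\<^sup>* M x\<close>, which is already real when \<open>M\<close> is Hermitian.\<close>

definition pos_semidef :: "complex^'n^'n \<Rightarrow> bool" where
  "pos_semidef M \<longleftrightarrow> adj M = M \<and> (\<forall>x. 0 \<le> x \<bullet> (M *v x))"

definition pos_def :: "complex^'n^'n \<Rightarrow> bool" where
  "pos_def M \<longleftrightarrow> adj M = M \<and> (\<forall>x. x \<noteq> 0 \<longrightarrow> 0 < x \<bullet> (M *v x))"

definition sym_pos_def :: "real^'n^'n \<Rightarrow> bool" where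
  "sym_pos_def M \<longleftrightarrow> transpose M = M \<and> (\<forall>x. x \<noteq> 0 \<longrightarrow> 0 < x \<bullet> (M *v x))"

definition matrix_sqrt :: "real^'n^'n \<Rightarrow> real^'n^'n" where
  "matrix_sqrt M = (THE S. sym_pos_def S \<and> S ** S = M)"


section \<open>The unit circle and spectral densities\<close>

definition circle :: "complex measure" where
  "circle = distr (uniform_measure lborel {-pi..pi}) (restrict_space borel (sphere 0 1)) cis"

text \<open>The symmetry under conjugation expresses that the process is real valued.\<close>

definition spectral_density :: "(complex \<Rightarrow> complex^'m^'m) \<Rightarrow> bool" where
  "spectral_density \<Phi> \<longleftrightarrow>
     integrable circle \<Phi> \<and>
     (AE z in circle. pos_semidef (\<Phi> z)) \<and>
     (AE z in circle. \<Phi> (cnj z) = conj_mat (\<Phi> z))"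

definition S_plus :: "(complex \<Rightarrow> complex^'m^'m) set" where
  "S_plus = {\<Phi>. spectral_density \<Phi> \<and>
     (\<exists>K. AE z in circle. norm (\<Phi> z) \<le> K) \<and>
     (\<exists>\<alpha>>0. AE z in circle. pos_semidef (\<Phi> z - \<alpha> *\<^sub>R mat 1))}"

text \<open>Every bounded rational density satisfies the following regularity condition. Boundedness and
  coercivity of \<open>\<Psi>\<close> alone, even together with continuity, are not enough for the dual problem to have a
  stationary point. Take \<open>m = n = 1\<close>, \<open>A = 0\<close>, \<open>B = \<Sigma> = 1\<close> and
  \<open>\<Psi>(cis \<theta>) = 1 / (1 + 10 sqrt \<bar>\<theta>\<bar>)\<close>. The optimality condition is that \<open>1 / (\<Psi>\<^sup>-\<^sup>1 + \<lambda>)\<close> has mean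
  \<open>1\<close>, but \<open>\<Psi>\<^sup>-\<^sup>1 + \<lambda> > 0\<close> a.e. forces \<open>\<lambda> \<ge> -1\<close>, and then the mean is at most
  \<open>1 / (5 sqrt pi) < 1\<close>. A Lipschitz condition makes \<open>(\<Psi>\<^sup>-\<^sup>1 + G\<^sup>* \<Lambda> G)\<^sup>-\<^sup>1\<close> non-integrable when \<open>\<Lambda>\<close> is
  on the boundary, so that the dual minimizer is an interior point.\<close>

definition lipschitz_density :: "(complex \<Rightarrow> complex^'m^'m) \<Rightarrow> bool" where
  "lipschitz_density \<Psi> \<longleftrightarrow>
     (\<exists>F C. C-lipschitz_on (sphere 0 1) F \<and> (AE z in circle. \<Psi> z = F z))"

text \<open>Outside the unit disc \<open>V\<close> and its inverse are analytic and bounded (hence also analytic at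
  infinity), i.e. both are in \<open>H\<^sup>\<infinity>\<close>; \<open>W\<close> is the radial boundary value of \<open>V\<close>. For a bounded and
  coercive density this is the same as \<open>V\<close> being an outer function in \<open>H\<^sup>2\<close>. Such a factor is
  unique up to a constant unitary factor on the right.\<close>

definition stable_min_phase_factor ::
    "(complex \<Rightarrow> complex^'m^'m) \<Rightarrow> (complex \<Rightarrow> complex^'m^'m) \<Rightarrow> bool" where
  "stable_min_phase_factor W \<Psi> \<longleftrightarrow>
     W \<in> borel_measurable circle \<and>
     (AE z in circle. \<Psi> z = W z ** adj (W z)) \<and>
     (\<exists>V K.
        (\<forall>i j. (\<lambda>z. V z $ i $ j) holomorphic_on {z. 1 < norm z}) \<and>
        (\<forall>z. 1 < norm z \<longrightarrow>
           invertible (V z) \<and> norm (V z) \<le> K \<and> norm (matrix_inv (V z)) \<le> K) \<and>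
        (AE z in circle. ((\<lambda>r. V (complex_of_real r * z)) \<longlongrightarrow> W z) (at_right 1)))"


section \<open>The filter bank\<close>

definition stable_matrix :: "real^'n^'n \<Rightarrow> bool" where
  "stable_matrix A \<longleftrightarrow> (\<forall>c v. v \<noteq> 0 \<and> cmat A *v v = c *s v \<longrightarrow> norm c < 1)"

definition reachable :: "real^'n^'n \<Rightarrow> real^'m^'n \<Rightarrow> bool" where
  "reachable A B \<longleftrightarrow> span (\<Union>k<CARD('n). columns (((\<lambda>M. A ** M) ^^ k) B)) = UNIV"

definition transfer_fun :: "real^'n^'n \<Rightarrow> real^'m^'n \<Rightarrow> complex \<Rightarrow> complex^'m^'n" where
  "transfer_fun A B z = matrix_inv (mat z - cmat A) ** cmat B"

definition Gamma_op ::
    "real^'n^'n \<Rightarrow> real^'m^'n \<Rightarrow> (complex \<Rightarrow> complex^'m^'m) \<Rightarrow> complex^'n^'n" where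
  "Gamma_op A B \<Phi> = (LINT z|circle. transfer_fun A B z ** \<Phi> z ** adj (transfer_fun A B z))"

definition cont_density_span :: "(complex \<Rightarrow> complex^'m^'m) set" where
  "cont_density_span = {\<Phi>. \<exists>(k::nat) c F.
     (\<forall>i<k. continuous_on (sphere 0 1) (F i) \<and> spectral_density (F i)) \<and>
     \<Phi> = (\<lambda>z. \<Sum>i<k. (c i :: real) *\<^sub>R F i z)}"

definition range_Gamma :: "real^'n^'n \<Rightarrow> real^'m^'n \<Rightarrow> (real^'n^'n) set" where
  "range_Gamma A B = {L. \<exists>\<Phi>\<in>cont_density_span. cmat L = Gamma_op A B \<Phi>}"


section \<open>The primal problem\<close>

definition d_RER :: "(complex \<Rightarrow> complex^'m^'m) \<Rightarrow> (complex \<Rightarrow> complex^'m^'m) \<Rightarrow> real" where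
  "d_RER \<Phi> \<Psi> = 1 / (4 * pi) * (LBINT \<theta>:{-pi..pi}.
     ln (Re (det (matrix_inv (\<Phi> (cis \<theta>)) ** \<Psi> (cis \<theta>)))) +
     Re (trace (matrix_inv (\<Psi> (cis \<theta>)) ** (\<Phi> (cis \<theta>) - \<Psi> (cis \<theta>)))))"

definition feasible ::
    "real^'n^'n \<Rightarrow> real^'m^'n \<Rightarrow> real^'n^'n \<Rightarrow> (complex \<Rightarrow> complex^'m^'m) set" where
  "feasible A B \<Sigma> = {\<Phi> \<in> S_plus. Gamma_op A B \<Phi> = cmat \<Sigma>}"


section \<open>The dual problem for \<open>\<Sigma> = I\<close>\<close>

definition G1 ::
    "real^'n^'n \<Rightarrow> real^'m^'n \<Rightarrow> (complex \<Rightarrow> complex^'m^'m) \<Rightarrow> complex \<Rightarrow> complex^'m^'n" where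
  "G1 A B W z = transfer_fun A B z ** W z"

definition dual_density ::
    "real^'n^'n \<Rightarrow> real^'m^'n \<Rightarrow> (complex \<Rightarrow> complex^'m^'m) \<Rightarrow> real^'n^'n \<Rightarrow> complex \<Rightarrow> complex^'m^'m"
  where
  "dual_density A B W L z = mat 1 + adj (G1 A B W z) ** cmat L ** G1 A B W z"

definition L_plus ::
    "real^'n^'n \<Rightarrow> real^'m^'n \<Rightarrow> (complex \<Rightarrow> complex^'m^'m) \<Rightarrow> (real^'n^'n) set" where
  "L_plus A B W = {L \<in> range_Gamma A B. AE z in circle. pos_def (dual_density A B W L z)}"

text \<open>On \<open>L_plus\<close> the integrand is bounded below, because \<open>G1\<close> is essentially bounded; it may fail
  to be integrable at the boundary, and then its integral is infinite. The Bochner integral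
  would be \<open>0\<close> there.\<close>

definition J_fun ::
    "real^'n^'n \<Rightarrow> real^'m^'n \<Rightarrow> (complex \<Rightarrow> complex^'m^'m) \<Rightarrow> real^'n^'n \<Rightarrow> ereal" where
  "J_fun A B W L =
     (let f = (\<lambda>z. trace L - ln (Re (det (dual_density A B W L z))))
      in if integrable circle f then ereal (LINT z|circle. f z) else \<infinity>)"

definition Phi_opt ::
    "real^'n^'n \<Rightarrow> real^'m^'n \<Rightarrow> (complex \<Rightarrow> complex^'m^'m) \<Rightarrow> real^'n^'n \<Rightarrow> complex \<Rightarrow> complex^'m^'m"
  where
  "Phi_opt A B \<Psi> L z =
     matrix_inv (matrix_inv (\<Psi> z) + adj (transfer_fun A B z) ** cmat L ** transfer_fun A B z)"


section \<open>McMillan degree\<close>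

text \<open>The minor of order \<open>k\<close> with rows \<open>r 0, \<dots>, r (k - 1)\<close> and columns \<open>c 0, \<dots>, c (k - 1)\<close>.\<close>

definition minor ::
    "nat \<Rightarrow> (nat \<Rightarrow> 'm) \<Rightarrow> (nat \<Rightarrow> 'm) \<Rightarrow> ('a::comm_ring_1)^'m^'m \<Rightarrow> 'a" where
  "minor k r c N = (\<Sum>p | p permutes {..<k}. of_int (sign p) * (\<Prod>i<k. N $ r i $ c (p i)))"

text \<open>For the rational matrix \<open>N / q\<close>, the degree at a point of the Riemann sphere is the largest
  order with which the point occurs as a pole of some minor, and the McMillan degree is the sum
  over all points (Kalman, McMillan). A minor of order \<open>k\<close> of \<open>N / q\<close> is the minor of \<open>N\<close> divided
  by \<open>q ^ k\<close>. The truncated subtraction gives \<open>0\<close> where a minor has no pole.\<close>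

definition pole_degree :: "complex \<Rightarrow> complex poly^'m^'m \<Rightarrow> complex poly \<Rightarrow> nat" where
  "pole_degree a N q =
     Max {k * order a q - order a (minor k r c N) | k r c. k \<le> CARD('m) \<and> minor k r c N \<noteq> 0}"

definition pole_degree_inf :: "complex poly^'m^'m \<Rightarrow> complex poly \<Rightarrow> nat" where
  "pole_degree_inf N q =
     Max {degree (minor k r c N) - k * degree q | k r c. k \<le> CARD('m) \<and> minor k r c N \<noteq> 0}"

definition rational_degree :: "complex poly^'m^'m \<Rightarrow> complex poly \<Rightarrow> nat" where
  "rational_degree N q = (\<Sum>a | poly q a = 0. pole_degree a N q) + pole_degree_inf N q"

definition represents ::
    "complex poly^'m^'m \<Rightarrow> complex poly \<Rightarrow> (complex \<Rightarrow> complex^'m^'m) \<Rightarrow> bool" where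
  "represents N q \<Phi> \<longleftrightarrow> q \<noteq> 0 \<and>
     (AE z in circle. \<forall>i j. \<Phi> z $ i $ j = poly (N $ i $ j) z / poly q z)"

text \<open>All representations of a rational function have the same degree, so the infimum only selects
  this value, and gives \<open>\<infinity>\<close> when \<open>\<Phi>\<close> is not rational.\<close>

definition McMillan_degree :: "(complex \<Rightarrow> complex^'m^'m) \<Rightarrow> enat" where
  "McMillan_degree \<Phi> = Inf {enat (rational_degree N q) | N q. represents N q \<Phi>}"

end

theory Submission
  imports Defs "HOL-Complex_Analysis.Cauchy_Integral_Theorem"
    "HOL-Computational_Algebra.Fundamental_Theorem_Algebra"
begin

text \<open>
  After a congruence with the square root of \<open>\<Sigma>\<close> the moment constraint is \<open>\<integral> G \<Phi> G\<^sup>* = I\<close>. The proof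
  rests on one inequality, the tangent inequality of the concave function \<open>ln det\<close>
  (\<open>ln_det_tangent\<close>), which is strict away from the point of contact.

  Let \<open>L\<close> be such that \<open>P = \<Psi>\<^sup>-\<^sup>1 + G\<^sup>* L G\<close> is positive definite on the circle and \<open>\<Phi> = P\<^sup>-\<^sup>1\<close> has the
  moment \<open>I\<close>. Such an \<open>L\<close> is a zero of the gradient \<open>I - \<integral> G P\<^sup>-\<^sup>1 G\<^sup>*\<close> of the dual functional. The
  tangent inequality at \<open>P\<close>, integrated, shows that \<open>L\<close> is the unique minimizer of the dual functional,
  also in comparison with boundary points, since the linear term is the inner product with the gradient
  (\<open>dual_optimality\<close>). The tangent inequality at \<open>\<Phi>\<close>, integrated, shows that \<open>\<Phi>\<close> is the unique minimizer
  of the primal problem, since \<open>\<integral> tr (G\<^sup>* L G \<Phi>')\<close> is the trace of \<open>L\<close> for all feasible \<open>\<Phi>'\<close>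
  (\<open>primal_optimality\<close>). Uniqueness of \<open>L\<close> needs that \<open>L \<mapsto> G\<^sup>* L G\<close> is injective on the range of
  \<open>\<Gamma>\<close>, and this map is the adjoint of \<open>\<Gamma>\<close>.

  The existence of such an \<open>L\<close> (\<open>stationary_point_exists\<close>) has two ingredients. The first is a continuous
  positive definite density with moment \<open>I\<close>, the maximum entropy density for a trivial prior, which is
  given by an explicit formula in terms of a state feedback (\<open>unit_moment_density\<close>); the Lyapunov-like
  equation for \<open>A A\<^sup>T\<close> enters here. It makes the dual functional coercive. The second is a barrier: the
  dual functional is minimized under the constraint \<open>P \<ge> s I\<close>, and the minimizer is compared with
  \<open>L = 0\<close>, which bounds \<open>\<integral> tr P\<^sup>-\<^sup>1\<close> independently of \<open>s\<close>. If \<open>P\<close> were nearly singular at a point of the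
  circle, the Lipschitz condition would make this integral large, since \<open>1 / \<bar>\<theta>\<bar>\<close> is not integrable
  (\<open>uniform_coercivity\<close>). So the constraint is inactive for small \<open>s\<close>.

  For the degree, the McMillan degree of \<open>N / q\<close> is read off from the determinants of the square matrices
  formed from columns of \<open>[q I, N]\<close>: it is their maximal degree minus the degree of their greatest common
  divisor. This does not change when \<open>[q I, N]\<close> is multiplied from the left by a nonsingular matrix, so the
  inverses in \<open>(\<Psi>\<^sup>-\<^sup>1 + G\<^sup>* L G)\<^sup>-\<^sup>1\<close> cost nothing; the feedback by \<open>G\<^sup>* L G\<close>, which has a realization with
  \<open>2 n\<close> states, raises the degree by at most \<open>2 n\<close> by the Cauchy--Binet formula
  (\<open>McMillan_degree_feedback\<close>).
\<close>

section \<open>Complex matrices\<close>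

subsection \<open>Adjoint, inner product and norm\<close>

lemma adj_nth [simp]: "adj M $ i $ j = cnj (M $ j $ i)"
  by (simp add: adj_def conj_mat_def transpose_def)

lemma conj_mat_nth [simp]: "conj_mat M $ i $ j = cnj (M $ i $ j)"
  by (simp add: conj_mat_def)

lemma cmat_nth [simp]: "cmat M $ i $ j = complex_of_real (M $ i $ j)"
  by (simp add: cmat_def)

lemma mat_nth: "mat k $ i $ j = (if i = j then k else 0)"
  by (simp add: mat_def)

lemma mult_nth: "(A ** B) $ i $ j = (\<Sum>k\<in>UNIV. A $ i $ k * B $ k $ j)"
  by (simp add: matrix_matrix_mult_def)

lemma mult_vec_nth: "(A *v x) $ i = (\<Sum>k\<in>UNIV. A $ i $ k * x $ k)"
  by (simp add: matrix_vector_mult_def)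

lemma adj_adj [simp]: "adj (adj M) = M"
  by (simp add: vec_eq_iff)

lemma adj_mult: "adj (A ** B) = adj B ** adj A"
  by (simp add: vec_eq_iff mult_nth mult.commute)

lemma adj_add: "adj (A + B) = adj A + adj B"
  by (simp add: vec_eq_iff)

lemma adj_diff: "adj (A - B) = adj A - adj B"
  by (simp add: vec_eq_iff)

lemma adj_scaleR: "adj (c *\<^sub>R A) = c *\<^sub>R adj A"
  by (simp add: vec_eq_iff)

lemma adj_mat [simp]: "adj (mat k) = mat (cnj k)"
  by (simp add: vec_eq_iff mat_nth)

lemma adj_zero [simp]: "adj 0 = 0"
  by (simp add: vec_eq_iff)

lemma adj_cmat: "adj (cmat A) = cmat (transpose A)"
  by (simp add: vec_eq_iff transpose_def)

lemma cmat_mult: "cmat (A ** B) = cmat A ** cmat B"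
  by (simp add: vec_eq_iff mult_nth)

lemma cmat_add: "cmat (A + B) = cmat A + cmat B"
  by (simp add: vec_eq_iff)

lemma cmat_diff: "cmat (A - B) = cmat A - cmat B"
  by (simp add: vec_eq_iff)

lemma cmat_scaleR: "cmat (c *\<^sub>R A) = c *\<^sub>R cmat A"
  by (simp add: vec_eq_iff complex_eq_iff)

lemma cmat_mat [simp]: "cmat (mat 1) = mat 1"
  by (simp add: vec_eq_iff mat_nth)

lemma cmat_zero [simp]: "cmat 0 = 0"
  by (simp add: vec_eq_iff)

lemma cmat_inject [simp]: "cmat A = cmat B \<longleftrightarrow> A = B"
  by (simp add: vec_eq_iff)

lemma conj_mat_mult: "conj_mat (A ** B) = conj_mat A ** conj_mat B"
  by (simp add: vec_eq_iff mult_nth)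

lemma conj_mat_add: "conj_mat (A + B) = conj_mat A + conj_mat B"
  by (simp add: vec_eq_iff)

lemma conj_mat_diff: "conj_mat (A - B) = conj_mat A - conj_mat B"
  by (simp add: vec_eq_iff)

lemma conj_mat_mat [simp]: "conj_mat (mat k) = mat (cnj k)"
  by (simp add: vec_eq_iff mat_nth)

lemma conj_mat_cmat [simp]: "conj_mat (cmat A) = cmat A"
  by (simp add: vec_eq_iff)

lemma conj_mat_adj: "conj_mat (adj A) = adj (conj_mat A)"
  by (simp add: vec_eq_iff)

lemma conj_mat_scaleR: "conj_mat (c *\<^sub>R A) = c *\<^sub>R conj_mat A"
  by (simp add: vec_eq_iff)

text \<open>The inner product of the space of complex matrices is the real part of \<open>tr (X\<^sup>* Y)\<close>, and its
  norm is the Frobenius norm. Hence the traces of the problem are inner products, and moving a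
  factor to its adjoint is an identity of inner products.\<close>

lemma inner_matrix: "X \<bullet> Y = (\<Sum>i\<in>UNIV. \<Sum>j\<in>UNIV. Re (cnj (X $ i $ j) * Y $ i $ j))"
  by (simp add: inner_vec_def inner_complex_def)

lemma inner_vec_complex: "x \<bullet> y = (\<Sum>i\<in>UNIV. Re (cnj (x $ i) * y $ i))" for x y :: "complex^'n"
  by (simp add: inner_vec_def inner_complex_def)

lemma inner_eq_trace: "X \<bullet> Y = Re (trace (adj X ** Y))"
  unfolding inner_matrix trace_def mult_nth adj_nth Re_sum
  by (rule sum.swap)

lemma inner_mat_1: "mat 1 \<bullet> X = Re (trace X)"
  by (simp add: inner_eq_trace)

lemma inner_adj_vec: "(A *v x) \<bullet> y = x \<bullet> (adj A *v y)" for A :: "complex^'n^'k"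
proof -
  have "(A *v x) \<bullet> y = Re (\<Sum>i\<in>UNIV. \<Sum>j\<in>UNIV. cnj (A $ i $ j) * cnj (x $ j) * y $ i)"
    by (simp add: inner_vec_complex mult_vec_nth sum_distrib_right sum_distrib_left)
  also have "\<dots> = Re (\<Sum>j\<in>UNIV. \<Sum>i\<in>UNIV. cnj (A $ i $ j) * cnj (x $ j) * y $ i)"
    by (subst sum.swap) rule
  also have "\<dots> = x \<bullet> (adj A *v y)"
    by (simp add: inner_vec_complex mult_vec_nth sum_distrib_right sum_distrib_left mult_ac)
  finally show ?thesis .
qed

lemma inner_mult_left: "(A ** X) \<bullet> Y = X \<bullet> (adj A ** Y)"
  by (simp add: inner_eq_trace adj_mult matrix_mul_assoc)

lemma inner_mult_right: "(X ** A) \<bullet> Y = X \<bullet> (Y ** adj A)" for X :: "complex^'n^'k"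
proof -
  have "(X ** A) \<bullet> Y = Re (trace (adj A ** (adj X ** Y)))"
    by (simp add: inner_eq_trace adj_mult matrix_mul_assoc)
  also have "\<dots> = Re (trace ((adj X ** Y) ** adj A))"
    by (subst trace_mul_sym) rule
  finally show ?thesis
    by (simp add: inner_eq_trace matrix_mul_assoc)
qed

lemma inner_adj_adj: "adj X \<bullet> adj Y = X \<bullet> Y"
  unfolding inner_matrix by (subst sum.swap) (simp add: mult.commute)

lemma norm_adj [simp]: "norm (adj X) = norm X"
  by (simp add: norm_eq_sqrt_inner inner_adj_adj)

lemma norm_mult_vec_le: "norm (A *v x) \<le> norm A * norm x" for A :: "complex^'n^'k"
proof -
  have row: "norm ((A *v x) $ i) \<le> norm (A $ i) * norm x" for i
  proof -
    have "norm ((A *v x) $ i) \<le> (\<Sum>k\<in>UNIV. \<bar>norm (A $ i $ k)\<bar> * \<bar>norm (x $ k)\<bar>)"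
      unfolding mult_vec_nth by (rule order_trans[OF norm_sum]) (simp add: norm_mult)
    also have "\<dots> \<le> norm (A $ i) * norm x"
      unfolding norm_vec_def by (rule L2_set_mult_ineq)
    finally show ?thesis .
  qed
  have "norm (A *v x) \<le> L2_set (\<lambda>i. norm (A $ i) * norm x) UNIV"
    unfolding norm_vec_def[of "A *v x"] by (rule L2_set_mono) (use row in auto)
  also have "\<dots> = norm A * norm x"
    by (simp add: L2_set_left_distrib norm_vec_def)
  finally show ?thesis .
qed

lemma norm_mult_le: "norm (A ** B) \<le> norm A * norm B" for A :: "complex^'n^'k" and B :: "complex^'l^'n"
proof -
  have row: "norm (adj (A ** B) $ j) \<le> norm A * norm (adj B $ j)" for j
  proof -
    have "norm (adj (A ** B) $ j $ i) = norm ((A *v (\<chi> k. B $ k $ j)) $ i)" for i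
      unfolding adj_nth complex_mod_cnj by (simp add: mult_nth mult_vec_nth)
    then have "norm (adj (A ** B) $ j) = norm (A *v (\<chi> k. B $ k $ j))"
      unfolding norm_vec_def[where 'a = complex] by presburger
    also have "\<dots> \<le> norm A * norm (\<chi> k. B $ k $ j)"
      by (rule norm_mult_vec_le)
    finally show ?thesis by (simp add: norm_vec_def)
  qed
  have "norm (A ** B) = norm (adj (A ** B))" by simp
  also have "\<dots> \<le> L2_set (\<lambda>j. norm A * norm (adj B $ j)) UNIV"
    unfolding norm_vec_def[of "adj (A ** B)"] by (rule L2_set_mono) (use row in auto)
  also have "\<dots> = norm A * norm (adj B)"
    by (simp only: norm_vec_def[of "adj B"] L2_set_right_distrib[OF norm_ge_zero])
  finally show ?thesis by simp
qed

lemma norm_mult3_le: "norm (X ** Y ** Z) \<le> norm X * norm Y * norm Z"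
  for X :: "complex^'n^'k" and Y :: "complex^'l^'n" and Z :: "complex^'j^'l"
  by (rule order_trans[OF norm_mult_le]) (intro mult_right_mono norm_mult_le norm_ge_zero)

lemma mult_scaleR_left: "(c *\<^sub>R A) ** B = c *\<^sub>R (A ** B)" for A :: "complex^'n^'k"
  by (simp add: scalar_matrix_assoc[symmetric])

lemma mult_scaleR_right: "A ** (c *\<^sub>R B) = c *\<^sub>R (A ** B)" for A :: "complex^'n^'k"
  by (simp add: matrix_scalar_ac scalar_matrix_assoc)

lemma mult_diff_left: "(A - B) ** C = A ** C - B ** C" for A :: "('a::comm_ring_1)^'n^'k"
  by (simp add: vec_eq_iff mult_nth left_diff_distrib sum_subtractf)

lemma mult_diff_right: "A ** (B - C) = A ** B - A ** C" for A :: "('a::comm_ring_1)^'n^'k"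
  by (simp add: vec_eq_iff mult_nth right_diff_distrib sum_subtractf)

lemma matrix_add_rdistrib: "(A + B) ** C = A ** C + B ** C" for A :: "('a::comm_ring_1)^'n^'k"
  by (simp add: vec_eq_iff mult_nth distrib_right sum.distrib)

lemma mult_zero_left' [simp]: "0 ** C = 0" for C :: "('a::comm_ring_1)^'n^'k"
  by (simp add: vec_eq_iff mult_nth)

lemma mult_zero_right' [simp]: "C ** 0 = 0" for C :: "('a::comm_ring_1)^'n^'k"
  by (simp add: vec_eq_iff mult_nth)

lemma scaleR_mult_vec: "(c *\<^sub>R A) *v x = c *\<^sub>R (A *v x)" for A :: "complex^'n^'k"
  by (simp add: vec_eq_iff mult_vec_nth scaleR_sum_right)

lemma mult_vec_scaleR: "A *v (c *\<^sub>R x) = c *\<^sub>R (A *v x)" for A :: "complex^'n^'k"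
  by (simp add: vec_eq_iff mult_vec_nth scaleR_sum_right)

lemma norm_mat_1_pos: "0 < norm (mat 1 :: complex^'n^'n)"
proof -
  have "(mat 1 :: complex^'n^'n) $ undefined $ undefined \<noteq> 0 $ undefined $ undefined"
    by (simp add: mat_nth)
  then show ?thesis by (metis zero_less_norm_iff)
qed

lemma bounded_bilinear_matrix_mult:
  "bounded_bilinear ((**) :: complex^'n^'k \<Rightarrow> complex^'l^'n \<Rightarrow> complex^'l^'k)"
proof
  show "\<exists>K. \<forall>(a :: complex^'n^'k) (b :: complex^'l^'n). norm (a ** b) \<le> norm a * norm b * K"
    by (rule exI[of _ 1]) (simp add: norm_mult_le)
qed (simp_all add: matrix_add_rdistrib matrix_add_ldistrib mult_scaleR_left mult_scaleR_right)

lemmas continuous_on_matrix_mult [continuous_intros] =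
  bounded_bilinear.continuous_on[OF bounded_bilinear_matrix_mult]

lemma bounded_linear_adj: "bounded_linear (adj :: complex^'n^'k \<Rightarrow> complex^'k^'n)"
  by (rule bounded_linear_intro[where K = 1]) (simp_all add: adj_add adj_scaleR)

lemma bounded_linear_cmat: "bounded_linear (cmat :: real^'n^'k \<Rightarrow> complex^'n^'k)"
  unfolding linear_conv_bounded_linear[symmetric]
  by (rule linearI) (simp_all add: cmat_add cmat_scaleR)

lemma bounded_linear_conj_mat: "bounded_linear (conj_mat :: complex^'n^'k \<Rightarrow> complex^'n^'k)"
  unfolding linear_conv_bounded_linear[symmetric]
  by (rule linearI) (simp_all add: conj_mat_add conj_mat_scaleR)

lemma inner_cmat: "cmat A \<bullet> cmat B = A \<bullet> B"
  by (simp add: inner_matrix inner_vec_def)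

lemma norm_cmat [simp]: "norm (cmat A) = norm A"
  by (simp add: norm_eq_sqrt_inner inner_cmat)

lemma det_adj: "det (adj M) = cnj (det M)" for M :: "complex^'n^'n"
proof -
  have "det (adj M) = det (conj_mat M)" by (simp add: adj_def)
  also have "\<dots> = cnj (det M)" by (simp add: det_def)
  finally show ?thesis .
qed

subsection \<open>Inverse\<close>

lemma matrix_inv_works:
  assumes "invertible A"
  shows "A ** matrix_inv A = mat 1" "matrix_inv A ** A = mat 1"
  using someI_ex[OF assms[unfolded invertible_def]] unfolding matrix_inv_def by auto

lemma matrix_inv_eqI:
  fixes A B :: "('a::field)^'n^'n"
  assumes "A ** B = mat 1"
  shows "invertible A" "matrix_inv A = B"
proof -
  show inv: "invertible A" using assms invertible_right_inverse by blast
  have "matrix_inv A = matrix_inv A ** (A ** B)" by (simp add: assms)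
  also have "\<dots> = B" using matrix_inv_works(2)[OF inv] by (simp add: matrix_mul_assoc)
  finally show "matrix_inv A = B" .
qed

lemma invertible_matrix_inv:
  fixes A :: "('a::field)^'n^'n"
  assumes "invertible A"
  shows "invertible (matrix_inv A)" "matrix_inv (matrix_inv A) = A"
  using matrix_inv_eqI[OF matrix_inv_works(2)[OF assms]] by auto

lemma matrix_inv_mult:
  fixes A B :: "('a::field)^'n^'n"
  assumes "invertible A" "invertible B"
  shows "matrix_inv (A ** B) = matrix_inv B ** matrix_inv A"
proof (rule matrix_inv_eqI(2))
  have "A ** B ** (matrix_inv B ** matrix_inv A) = A ** (B ** matrix_inv B) ** matrix_inv A"
    by (simp only: matrix_mul_assoc)
  then show "A ** B ** (matrix_inv B ** matrix_inv A) = mat 1"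
    by (simp add: matrix_inv_works assms)
qed

lemma adj_matrix_inv:
  fixes A :: "complex^'n^'n"
  assumes "invertible A"
  shows "invertible (adj A)" "matrix_inv (adj A) = adj (matrix_inv A)"
proof -
  have "adj A ** adj (matrix_inv A) = mat 1"
    unfolding adj_mult[symmetric] by (simp add: matrix_inv_works assms)
  then show "invertible (adj A)" "matrix_inv (adj A) = adj (matrix_inv A)"
    using matrix_inv_eqI by blast+
qed

lemma conj_mat_matrix_inv:
  fixes A :: "complex^'n^'n"
  assumes "invertible A"
  shows "conj_mat (matrix_inv A) = matrix_inv (conj_mat A)"
proof -
  have "conj_mat A ** conj_mat (matrix_inv A) = mat 1"
    unfolding conj_mat_mult[symmetric] by (simp add: matrix_inv_works assms)
  then show ?thesis by (simp add: matrix_inv_eqI(2))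
qed

lemma cmat_matrix_inv:
  fixes A :: "real^'n^'n"
  assumes "invertible A"
  shows "invertible (cmat A)" "matrix_inv (cmat A) = cmat (matrix_inv A)"
proof -
  have "cmat A ** cmat (matrix_inv A) = mat 1"
    unfolding cmat_mult[symmetric] by (simp add: matrix_inv_works assms)
  then show "invertible (cmat A)" "matrix_inv (cmat A) = cmat (matrix_inv A)"
    using matrix_inv_eqI by blast+
qed

lemma invertible_iff_ker: "invertible A \<longleftrightarrow> (\<forall>x. A *v x = 0 \<longrightarrow> x = 0)" for A :: "('a::field)^'n^'n"
  unfolding invertible_left_inverse matrix_left_invertible_ker ..

lemma matrix_inv_diff:
  fixes A B :: "('a::field)^'n^'n"
  assumes "invertible A" "invertible B"
  shows "matrix_inv A - matrix_inv B = matrix_inv A ** (B - A) ** matrix_inv B"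
  unfolding mult_diff_left mult_diff_right
  by (simp add: matrix_inv_works assms matrix_mul_assoc[symmetric])

lemma det_matrix_inv:
  fixes A :: "('a::field)^'n^'n"
  assumes "invertible A"
  shows "det (matrix_inv A) = inverse (det A)"
  using det_mul[of A "matrix_inv A"]
  by (metis assms det_I inverse_unique matrix_inv_works(1))

subsection \<open>The spectral theorem for Hermitian matrices\<close>

text \<open>A zero of a nonnegative form is a minimum of it, so that the gradient of the form vanishes
  there.\<close>

lemma psd_form_zero:
  fixes M :: "complex^'n^'n"
  assumes herm: "adj M = M" and V: "subspace V" "\<And>y. y \<in> V \<Longrightarrow> M *v y \<in> V"
    and nonneg: "\<And>y. y \<in> V \<Longrightarrow> 0 \<le> y \<bullet> (M *v y)"
    and x: "x \<in> V" "x \<bullet> (M *v x) = 0"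
  shows "M *v x = 0"
proof -
  define y where "y = M *v x"
  have yV: "y \<in> V" using V x y_def by blast
  have sym: "x \<bullet> (M *v y) = y \<bullet> y"
    by (metis herm inner_adj_vec inner_commute y_def)
  \<comment> \<open>the form at \<open>x - t *\<^sub>R M x\<close> is \<open>- 2 t \<bar>M x\<bar>\<^sup>2 + O(t\<^sup>2)\<close>\<close>
  have q: "0 \<le> - 2 * t * (y \<bullet> y) + t\<^sup>2 * (y \<bullet> (M *v y))" for t
  proof -
    have "x - t *\<^sub>R y \<in> V" using V x yV by (simp add: subspace_diff subspace_scale)
    from nonneg[OF this] show ?thesis
      using x sym by (simp add: matrix_vector_mult_diff_distrib mult_vec_scaleR inner_diff
          y_def[symmetric] inner_commute power2_eq_square algebra_simps)
  qed
  have "y \<bullet> y = 0"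
  proof (rule ccontr)
    assume "y \<bullet> y \<noteq> 0"
    then have pos: "y \<bullet> y > 0" by (simp add: less_le)
    define c where "c = y \<bullet> (M *v y)"
    have c0: "c \<ge> 0" using nonneg[OF yV] c_def by simp
    define t where "t = (y \<bullet> y) / (c + 1)"
    have t: "t > 0" using pos c0 t_def by simp
    have "t * c < 2 * (y \<bullet> y)"
    proof -
      have "e * c < 2 * e * (c + 1)" if "e > 0" for e :: real
        using that mult_nonneg_nonneg[of c e] c0 by (simp add: algebra_simps add_nonneg_pos)
      from this[OF pos] show ?thesis
        unfolding t_def using c0 by (simp add: pos_divide_less_eq)
    qed
    then have "t * (t * c) < t * (2 * (y \<bullet> y))"
      using t by (rule mult_strict_left_mono)
    with q[of t] show False
      by (simp add: c_def power2_eq_square algebra_simps)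
  qed
  then show ?thesis by (simp add: y_def)
qed

text \<open>At the maximum \<open>d\<close> of \<open>x \<bullet> M x\<close> on the unit sphere of \<open>V\<close>, the form of \<open>d I - M\<close> is
  nonnegative on \<open>V\<close> and zero at the maximizer.\<close>

lemma hermitian_eigenvector_in_subspace:
  fixes M :: "complex^'n^'n"
  assumes herm: "adj M = M" and V: "subspace V" "\<And>y. y \<in> V \<Longrightarrow> M *v y \<in> V" and "z \<in> V" "z \<noteq> 0"
  shows "\<exists>x\<in>V. \<exists>d. norm x = 1 \<and> M *v x = d *\<^sub>R x"
proof -
  define S where "S = V \<inter> sphere 0 1"
  have "compact S" unfolding S_def
    by (simp add: closed_Int_compact closed_subspace V)
  moreover have "z /\<^sub>R norm z \<in> S"
    using assms by (simp add: S_def subspace_scale)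
  moreover have "continuous_on S (\<lambda>x. x \<bullet> (M *v x))"
    by (intro continuous_intros linear_continuous_on)
       (simp add: linear_conv_bounded_linear[symmetric])
  ultimately obtain x where x: "x \<in> S" and max: "\<And>y. y \<in> S \<Longrightarrow> y \<bullet> (M *v y) \<le> x \<bullet> (M *v x)"
    by (metis continuous_attains_sup empty_iff)
  define d where "d = x \<bullet> (M *v x)"
  define N where "N = d *\<^sub>R mat 1 - M"
  have N: "N *v y = d *\<^sub>R y - M *v y" for y
    by (simp add: N_def matrix_vector_mult_diff_rdistrib scaleR_mult_vec)
  have x1: "norm x = 1" and xV: "x \<in> V" using x by (auto simp: S_def)
  have "N *v x = 0"
  proof (rule psd_form_zero[OF _ V(1)])
    show "adj N = N" by (simp add: N_def adj_diff adj_scaleR herm)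
    show "N *v y \<in> V" if "y \<in> V" for y
      using that V by (simp add: N subspace_diff subspace_scale)
    show "x \<in> V" by fact
    show "x \<bullet> (N *v x) = 0"
      using x1 by (simp add: N inner_diff d_def dot_square_norm)
    show "0 \<le> y \<bullet> (N *v y)" if "y \<in> V" for y
    proof (cases "y = 0")
      case False
      have "y /\<^sub>R norm y \<in> S" using that False V by (simp add: S_def subspace_scale)
      from max[OF this] have "(y \<bullet> (M *v y)) / (norm y)\<^sup>2 \<le> d"
        by (simp add: mult_vec_scaleR d_def power2_eq_square divide_inverse mult_ac)
      then have "y \<bullet> (M *v y) \<le> d * (norm y)\<^sup>2"
        using False by (simp add: divide_le_eq)
      then show ?thesis by (simp add: N inner_diff power2_norm_eq_inner)
    qed simp
  qed
  then have "M *v x = d *\<^sub>R x" by (simp add: N)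
  with x1 xV show ?thesis by blast
qed

definition cdiag :: "('n \<Rightarrow> real) \<Rightarrow> complex^'n^'n" where
  "cdiag d = (\<chi> i j. if i = j then complex_of_real (d i) else 0)"

lemma cdiag_nth: "cdiag d $ i $ j = (if i = j then complex_of_real (d i) else 0)"
  by (simp add: cdiag_def)

lemma mult_cdiag: "(U ** cdiag d) $ i $ j = U $ i $ j * complex_of_real (d j)"
  by (simp add: mult_nth cdiag_nth if_distrib if_distribR cong: if_cong)

lemma cdiag_mult_cdiag: "cdiag c ** cdiag d = cdiag (\<lambda>i. c i * d i)"
  by (simp add: vec_eq_iff mult_cdiag cdiag_nth)

lemma adj_cdiag: "adj (cdiag d) = cdiag d"
  by (simp add: vec_eq_iff cdiag_nth)

lemma cdiag_1: "cdiag (\<lambda>i. 1) = mat 1"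
  by (simp add: vec_eq_iff cdiag_nth mat_nth)

lemma det_cdiag: "det (cdiag d) = complex_of_real (\<Prod>i\<in>UNIV. d i)"
  by (subst det_diagonal) (simp_all add: cdiag_nth)

lemma trace_cdiag: "trace (cdiag d) = complex_of_real (\<Sum>i\<in>UNIV. d i)"
  by (simp add: trace_def cdiag_nth)

text \<open>The induction runs over the subsets of the index type, so that the eigenvectors are indexed like
  the columns of a matrix. The orthogonality is the complex one; the inner product is only its real
  part.\<close>

lemma orthonormal_eigenvectors:
  fixes M :: "complex^'n^'n" and S :: "'n set"
  assumes herm: "adj M = M"
  shows "\<exists>f d. (\<forall>i\<in>S. norm (f i) = 1 \<and> M *v f i = d i *\<^sub>R f i) \<and>
    (\<forall>i\<in>S. \<forall>j\<in>S. i \<noteq> j \<longrightarrow> (\<Sum>k\<in>UNIV. cnj (f i $ k) * f j $ k) = 0)"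
proof (induction S rule: finite_induct[OF finite])
  case 1
  then show ?case by auto
next
  case (2 s S)
  then obtain f d where f: "\<And>i. i \<in> S \<Longrightarrow> norm (f i) = 1" "\<And>i. i \<in> S \<Longrightarrow> M *v f i = d i *\<^sub>R f i"
    and orth: "\<And>i j. i \<in> S \<Longrightarrow> j \<in> S \<Longrightarrow> i \<noteq> j \<Longrightarrow> (\<Sum>k\<in>UNIV. cnj (f i $ k) * f j $ k) = 0"
    by metis
  define V where "V = {x :: complex^'n. \<forall>i\<in>S. (\<Sum>k\<in>UNIV. cnj (f i $ k) * x $ k) = 0}"
  have sub: "subspace V"
    unfolding subspace_def V_def
    by (auto simp: distrib_left sum.distrib scaleR_sum_right[symmetric])
  have inv: "M *v x \<in> V" if "x \<in> V" for x
  proof -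
    have "(\<Sum>k\<in>UNIV. cnj (f i $ k) * (M *v x) $ k) = 0" if i: "i \<in> S" for i
    proof -
      have "(\<Sum>k\<in>UNIV. cnj (f i $ k) * (M *v x) $ k)
          = (\<Sum>k\<in>UNIV. \<Sum>l\<in>UNIV. cnj (f i $ k) * M $ k $ l * x $ l)"
        by (simp add: mult_vec_nth sum_distrib_left mult.assoc)
      also have "\<dots> = (\<Sum>l\<in>UNIV. \<Sum>k\<in>UNIV. cnj (f i $ k) * M $ k $ l * x $ l)"
        by (rule sum.swap)
      also have "\<dots> = (\<Sum>l\<in>UNIV. cnj ((adj M *v f i) $ l) * x $ l)"
        by (simp add: mult_vec_nth sum_distrib_right sum_distrib_left mult_ac)
      also have "\<dots> = complex_of_real (d i) * (\<Sum>l\<in>UNIV. cnj (f i $ l) * x $ l)"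
        by (simp add: herm f i sum_distrib_left scaleR_conv_of_real[where 'a = complex] mult_ac)
      also have "\<dots> = 0" using \<open>x \<in> V\<close> i by (simp add: V_def)
      finally show ?thesis .
    qed
    then show ?thesis by (simp add: V_def)
  qed
  \<comment> \<open>a square matrix with the adjoints of the \<open>f i\<close> as rows and a zero row has a nontrivial kernel\<close>
  define Z where "Z = (\<chi> i k. if i \<in> S then cnj (f i $ k) else 0)"
  have "row s Z = 0" using 2 by (simp add: Z_def row_def vec_eq_iff)
  then have "det Z = 0" by (rule det_zero_row(2))
  then obtain z where z: "z \<noteq> 0" "Z *v z = 0"
    using invertible_det_nz invertible_iff_ker by blast
  have "z \<in> V" unfolding V_def
  proof (safe)
    fix i assume "i \<in> S"
    have "(Z *v z) $ i = 0" using z by simp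
    then show "(\<Sum>k\<in>UNIV. cnj (f i $ k) * z $ k) = 0" using \<open>i \<in> S\<close> by (simp add: mult_vec_nth Z_def)
  qed
  then obtain x c where x: "x \<in> V" "norm x = 1" "M *v x = c *\<^sub>R x"
    using hermitian_eigenvector_in_subspace[OF herm sub inv] z by blast
  have x0: "(\<Sum>k\<in>UNIV. cnj (f i $ k) * x $ k) = 0" if "i \<in> S" for i
    using x that by (simp add: V_def)
  have x1: "(\<Sum>k\<in>UNIV. cnj (x $ k) * f i $ k) = 0" if "i \<in> S" for i
  proof -
    have "(\<Sum>k\<in>UNIV. cnj (x $ k) * f i $ k) = cnj (\<Sum>k\<in>UNIV. cnj (f i $ k) * x $ k)"
      by (simp add: mult.commute)
    with x0[OF that] show ?thesis by simp
  qed
  show ?case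
    by (rule exI[of _ "f(s := x)"], rule exI[of _ "d(s := c)"])
       (use 2 f orth x x0 x1 in auto)
qed

theorem hermitian_diagonalization:
  fixes M :: "complex^'n^'n"
  assumes herm: "adj M = M"
  obtains U :: "complex^'n^'n" and d where "adj U ** U = mat 1" "U ** adj U = mat 1" "M = U ** cdiag d ** adj U"
proof -
  obtain f :: "'n \<Rightarrow> complex^'n" and d where fd: "\<forall>i\<in>UNIV. norm (f i) = 1 \<and> M *v f i = d i *\<^sub>R f i"
    and orth0: "\<forall>i\<in>UNIV. \<forall>j\<in>UNIV. i \<noteq> j \<longrightarrow> (\<Sum>k\<in>UNIV. cnj (f i $ k) * f j $ k) = 0"
    using orthonormal_eigenvectors[OF herm, of UNIV] by (elim exE conjE) (rule that)
  have f: "norm (f i) = 1" "M *v f i = d i *\<^sub>R f i" for i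
    using fd by auto
  have orth: "i \<noteq> j \<Longrightarrow> (\<Sum>k\<in>UNIV. cnj (f i $ k) * f j $ k) = 0" for i j
    using orth0 by auto
  define U where "U = (\<chi> k i. f i $ k)"
  have diag: "(\<Sum>k\<in>UNIV. cnj (f i $ k) * f i $ k) = 1" for i
  proof -
    have "(\<Sum>k\<in>UNIV. cnj (f i $ k) * f i $ k) = complex_of_real (\<Sum>k\<in>UNIV. (norm (f i $ k))\<^sup>2)"
      unfolding of_real_sum by (rule sum.cong) (simp_all add: complex_norm_square[symmetric] mult.commute)
    also have "(\<Sum>k\<in>UNIV. (norm (f i $ k))\<^sup>2) = (norm (f i))\<^sup>2"
      by (simp add: norm_vec_def L2_set_def sum_nonneg)
    finally show ?thesis using f by simp
  qed
  have 1: "adj U ** U = mat 1"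
    using orth diag by (auto simp: vec_eq_iff mult_nth U_def mat_nth)
  then have 2: "U ** adj U = mat 1" by (simp add: matrix_left_right_inverse)
  have "(M ** U) $ k $ i = (U ** cdiag d) $ k $ i" for k i
  proof -
    have "(M ** U) $ k $ i = (M *v f i) $ k" by (simp add: mult_nth mult_vec_nth U_def)
    also have "\<dots> = (U ** cdiag d) $ k $ i" by (simp add: f mult_cdiag U_def scaleR_conv_of_real[where 'a = complex] mult.commute)
    finally show ?thesis .
  qed
  then have "M ** U = U ** cdiag d" by (simp add: vec_eq_iff)
  then have "U ** cdiag d ** adj U = M"
    by (metis 2 matrix_mul_assoc matrix_mul_rid)
  with 1 2 that show ?thesis by metis
qed

section \<open>Positive definite matrices\<close>

lemma pos_semidef_hermitian: "pos_semidef M \<Longrightarrow> adj M = M"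
  by (simp add: pos_semidef_def)

lemma pos_def_hermitian: "pos_def M \<Longrightarrow> adj M = M"
  by (simp add: pos_def_def)

lemma pos_def_imp_semidef: "pos_def M \<Longrightarrow> pos_semidef M"
  by (auto simp: pos_def_def pos_semidef_def) (metis inner_zero_left less_imp_le order_refl)

lemma pos_semidef_minus_mat_iff:
  "pos_semidef (M - s *\<^sub>R mat 1) \<longleftrightarrow> adj M = M \<and> (\<forall>x. s * (x \<bullet> x) \<le> x \<bullet> (M *v x))"
  by (auto simp: pos_semidef_def adj_diff adj_scaleR matrix_vector_mult_diff_rdistrib
      scaleR_mult_vec inner_diff)

lemma pos_def_invertible: "pos_def M \<Longrightarrow> invertible M"
  unfolding invertible_iff_ker pos_def_def by (metis inner_zero_right less_irrefl)

lemma pos_def_inverse_hermitian: "pos_def M \<Longrightarrow> adj (matrix_inv M) = matrix_inv M"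
  by (metis adj_matrix_inv(2) pos_def_hermitian pos_def_invertible)

lemma pos_def_mult_adj:
  fixes C :: "complex^'n^'n"
  assumes "invertible C"
  shows "pos_def (C ** adj C)"
  unfolding pos_def_def
proof (intro conjI allI impI)
  show "adj (C ** adj C) = C ** adj C" by (simp add: adj_mult)
  fix x :: "complex^'n" assume "x \<noteq> 0"
  then have "adj C *v x \<noteq> 0"
    using adj_matrix_inv(1)[OF assms] invertible_iff_ker by blast
  then have "0 < (adj C *v x) \<bullet> (adj C *v x)" by simp
  then show "0 < x \<bullet> ((C ** adj C) *v x)"
    by (simp add: inner_adj_vec matrix_vector_mul_assoc[symmetric])
qed

lemma pos_def_congruence:
  fixes M C :: "complex^'n^'n"
  assumes "pos_def M" "invertible C"
  shows "pos_def (adj C ** M ** C)"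
  unfolding pos_def_def
proof (intro conjI allI impI)
  show "adj (adj C ** M ** C) = adj C ** M ** C"
    using assms by (simp add: adj_mult pos_def_hermitian matrix_mul_assoc)
  fix x :: "complex^'n" assume "x \<noteq> 0"
  then have "C *v x \<noteq> 0" using assms invertible_iff_ker by blast
  then have "0 < (C *v x) \<bullet> (M *v (C *v x))" using assms by (simp add: pos_def_def)
  then show "0 < x \<bullet> ((adj C ** M ** C) *v x)"
    by (simp add: inner_adj_vec matrix_vector_mul_assoc[symmetric])
qed

lemma pos_def_congruence_iff:
  fixes M C :: "complex^'n^'n"
  assumes "invertible C"
  shows "pos_def (adj C ** M ** C) \<longleftrightarrow> pos_def M"
proof
  assume p: "pos_def (adj C ** M ** C)"
  have "adj (matrix_inv C) ** (adj C ** M ** C) ** matrix_inv C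
      = (adj (matrix_inv C) ** adj C) ** M ** (C ** matrix_inv C)"
    by (simp add: matrix_mul_assoc)
  also have "\<dots> = M" by (simp add: adj_mult[symmetric] matrix_inv_works assms)
  finally show "pos_def M"
    using pos_def_congruence[OF p invertible_matrix_inv(1)[OF assms]] by simp
qed (use assms pos_def_congruence in blast)

lemma pos_def_matrix_inv:
  assumes "pos_def M"
  shows "pos_def (matrix_inv M)"
proof -
  note inv = pos_def_invertible[OF assms]
  have "adj (matrix_inv M) ** M ** matrix_inv M = matrix_inv M"
    by (simp add: pos_def_inverse_hermitian assms matrix_inv_works inv)
  then show ?thesis
    using pos_def_congruence[OF assms invertible_matrix_inv(1)[OF inv]] by simp
qed

lemma pos_semidef_add: "pos_semidef M \<Longrightarrow> pos_semidef N \<Longrightarrow> pos_semidef (M + N)"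
  by (simp add: pos_semidef_def adj_add matrix_vector_mult_add_rdistrib inner_add)

lemma pos_semidef_scaleR: "pos_semidef M \<Longrightarrow> 0 \<le> c \<Longrightarrow> pos_semidef (c *\<^sub>R M)"
  by (simp add: pos_semidef_def adj_scaleR scaleR_mult_vec)

lemma pos_def_scaleR: "pos_def M \<Longrightarrow> 0 < c \<Longrightarrow> pos_def (c *\<^sub>R M)"
  by (simp add: pos_def_def adj_scaleR scaleR_mult_vec)

lemma pos_def_mat_1: "pos_def (mat 1)"
  by (simp add: pos_def_def)

lemma pos_semidef_minus_mono:
  "pos_semidef (M - s *\<^sub>R mat 1) \<Longrightarrow> t \<le> s \<Longrightarrow> pos_semidef (M - t *\<^sub>R mat 1)"
  unfolding pos_semidef_minus_mat_iff by (meson inner_ge_zero mult_right_mono order_trans)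

lemma pos_def_if_coercive: "pos_semidef (M - s *\<^sub>R mat 1) \<Longrightarrow> 0 < s \<Longrightarrow> pos_def M"
  unfolding pos_semidef_minus_mat_iff pos_def_def
  by (meson inner_gt_zero_iff less_le_trans mult_pos_pos)

lemma form_bound: "\<bar>x \<bullet> (D *v x)\<bar> \<le> norm D * (x \<bullet> x)" for D :: "complex^'n^'n"
proof -
  have "\<bar>x \<bullet> (D *v x)\<bar> \<le> norm x * norm (D *v x)" by (rule Cauchy_Schwarz_ineq2)
  also have "\<dots> \<le> norm x * (norm D * norm x)" by (intro mult_left_mono norm_mult_vec_le) simp
  finally show ?thesis by (simp add: dot_square_norm power2_eq_square mult_ac)
qed

lemma pos_semidef_perturb:
  assumes "pos_semidef (M - s *\<^sub>R mat 1)" "adj D = D" "norm D \<le> s - t"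
  shows "pos_semidef (M + D - t *\<^sub>R mat 1)"
proof -
  have "t * (x \<bullet> x) \<le> x \<bullet> ((M + D) *v x)" for x
  proof -
    have "s * (x \<bullet> x) \<le> x \<bullet> (M *v x)"
      using assms(1) by (simp add: pos_semidef_minus_mat_iff)
    moreover have "norm D * (x \<bullet> x) \<le> (s - t) * (x \<bullet> x)"
      using assms(3) by (intro mult_right_mono) auto
    ultimately show ?thesis
      using form_bound[of x D] by (simp add: matrix_vector_mult_add_rdistrib inner_add left_diff_distrib)
  qed
  then show ?thesis
    using assms by (simp add: pos_semidef_minus_mat_iff adj_add)
qed

lemma mult_axis: "A *v axis i 1 = column i A" for A :: "('a::comm_ring_1)^'n^'k"
  by (simp add: vec_eq_iff mult_vec_nth column_def axis_def if_distrib cong: if_cong)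

lemma diag_entry_form:
  fixes U :: "complex^'n^'n"
  assumes U: "adj U ** U = mat 1" and M: "M = U ** cdiag d ** adj U"
  shows "\<exists>x. x \<noteq> 0 \<and> x \<bullet> x = 1 \<and> x \<bullet> (M *v x) = d i"
proof -
  define x where "x = U *v axis i 1"
  have Ux: "adj U *v x = axis i 1" by (simp add: x_def matrix_vector_mul_assoc U)
  have "cdiag d *v axis i 1 = d i *\<^sub>R axis i 1"
    unfolding mult_axis by (simp add: vec_eq_iff column_def cdiag_nth axis_def complex_eq_iff)
  then have Mx: "M *v x = d i *\<^sub>R x"
    by (simp add: M matrix_vector_mul_assoc[symmetric] Ux mult_vec_scaleR) (simp add: x_def)
  have "x \<bullet> x = axis i 1 \<bullet> (adj U *v x)" by (simp add: x_def inner_adj_vec)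
  also have "\<dots> = 1" unfolding Ux by (simp add: inner_axis_axis)
  finally show ?thesis using Mx by (intro exI[of _ x]) auto
qed

lemma mult_adj_sqrt_diag:
  assumes "\<And>i. 0 \<le> d i"
  shows "(U ** cdiag (\<lambda>i. sqrt (d i))) ** adj (U ** cdiag (\<lambda>i. sqrt (d i))) = U ** cdiag d ** adj U"
proof -
  have "(U ** cdiag (\<lambda>i. sqrt (d i))) ** adj (U ** cdiag (\<lambda>i. sqrt (d i)))
     = U ** (cdiag (\<lambda>i. sqrt (d i)) ** cdiag (\<lambda>i. sqrt (d i))) ** adj U"
    by (simp only: adj_mult adj_cdiag matrix_mul_assoc)
  also have "cdiag (\<lambda>i. sqrt (d i)) ** cdiag (\<lambda>i. sqrt (d i)) = cdiag d"
    using assms by (simp add: cdiag_mult_cdiag)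
  finally show ?thesis .
qed

lemma invertible_unitary_diag:
  fixes U :: "complex^'n^'n"
  assumes U: "adj U ** U = mat 1" "U ** adj U = mat 1" and d: "\<And>i. d i \<noteq> 0"
  shows "invertible (U ** cdiag d)"
proof (rule matrix_inv_eqI(1))
  have "U ** cdiag d ** (cdiag (\<lambda>i. inverse (d i)) ** adj U)
    = U ** (cdiag d ** cdiag (\<lambda>i. inverse (d i))) ** adj U"
    by (simp only: matrix_mul_assoc)
  then show "U ** cdiag d ** (cdiag (\<lambda>i. inverse (d i)) ** adj U) = mat 1"
    by (simp add: cdiag_mult_cdiag d cdiag_1 U)
qed

lemma pos_def_unitary_diag:
  fixes U :: "complex^'n^'n"
  assumes U: "adj U ** U = mat 1" "U ** adj U = mat 1" and d: "\<And>i. 0 < d i"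
  shows "pos_def (U ** cdiag d ** adj U)"
proof -
  have "invertible (U ** cdiag (\<lambda>i. sqrt (d i)))"
    by (rule invertible_unitary_diag[OF U]) (use d in \<open>simp add: less_imp_neq[symmetric]\<close>)
  from pos_def_mult_adj[OF this] show ?thesis
    by (simp add: mult_adj_sqrt_diag d less_imp_le)
qed

lemma pos_semidef_factorization:
  fixes M :: "complex^'n^'n"
  assumes "pos_semidef M"
  obtains C :: "complex^'n^'n" where "M = C ** adj C"
proof -
  obtain U :: "complex^'n^'n" and d where U: "adj U ** U = mat 1" "U ** adj U = mat 1"
    and M: "M = U ** cdiag d ** adj U"
    using hermitian_diagonalization[OF pos_semidef_hermitian[OF assms]] .
  have d: "0 \<le> d i" for i
    using diag_entry_form[OF U(1) M, of i] assms by (metis pos_semidef_def)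
  show ?thesis
    by (rule that[of "U ** cdiag (\<lambda>i. sqrt (d i))"]) (simp only: mult_adj_sqrt_diag[of d, OF d] M)
qed

lemma pos_def_diagonalization:
  fixes M :: "complex^'n^'n"
  assumes "pos_def M"
  obtains U :: "complex^'n^'n" and d where "adj U ** U = mat 1" "U ** adj U = mat 1"
    "\<And>i. 0 < d i" "M = U ** cdiag d ** adj U"
proof -
  obtain U :: "complex^'n^'n" and d where U: "adj U ** U = mat 1" "U ** adj U = mat 1"
    and M: "M = U ** cdiag d ** adj U"
    using hermitian_diagonalization[OF pos_def_hermitian[OF assms]] .
  have "0 < d i" for i
    using diag_entry_form[OF U(1) M, of i] assms by (auto simp: pos_def_def)
  from that[OF U this M] show ?thesis .
qed

lemma pos_def_factorization:
  fixes M :: "complex^'n^'n"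
  assumes "pos_def M"
  obtains C :: "complex^'n^'n" where "invertible C" "M = C ** adj C"
proof -
  obtain U :: "complex^'n^'n" and d where U: "adj U ** U = mat 1" "U ** adj U = mat 1"
    and d: "\<And>i. 0 < d i" and M: "M = U ** cdiag d ** adj U"
    using pos_def_diagonalization[OF assms] by blast
  have "invertible (U ** cdiag (\<lambda>i. sqrt (d i)))"
    by (rule invertible_unitary_diag[OF U]) (use d in \<open>simp add: less_imp_neq[symmetric]\<close>)
  moreover have "M = (U ** cdiag (\<lambda>i. sqrt (d i))) ** adj (U ** cdiag (\<lambda>i. sqrt (d i)))"
    by (simp only: mult_adj_sqrt_diag[of d, OF less_imp_le[OF d]] M)
  ultimately show ?thesis by (rule that)
qed

lemma det_mult_adj: "det (C ** adj C) = complex_of_real ((norm (det C))\<^sup>2)"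
  by (simp only: det_mul det_adj complex_norm_square)

lemma pos_def_det:
  fixes M :: "complex^'n^'n"
  assumes "pos_def M"
  shows "det M = complex_of_real (Re (det M))" "0 < Re (det M)"
proof -
  obtain C :: "complex^'n^'n" where C: "invertible C" "M = C ** adj C" using pos_def_factorization[OF assms] .
  then have "det C \<noteq> 0" using invertible_det_nz by blast
  then show "det M = complex_of_real (Re (det M))" "0 < Re (det M)"
    by (simp_all add: C(2) det_mult_adj)
qed

text \<open>The concavity of \<open>ln det\<close> in the form of its tangent inequality. A congruence makes \<open>M\<close> the
  identity; then it is \<open>ln d \<le> d - 1\<close> for the eigenvalues \<open>d\<close> of \<open>N\<close>. All optimality and
  uniqueness claims, both primal and dual, come down to this inequality.\<close>

lemma ln_det_tangent:
  fixes M N :: "complex^'n^'n"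
  assumes M: "pos_def M" and N: "pos_def N"
  shows "ln (Re (det N)) \<le> ln (Re (det M)) + matrix_inv M \<bullet> (N - M)"
    and "ln (Re (det N)) = ln (Re (det M)) + matrix_inv M \<bullet> (N - M) \<Longrightarrow> N = M"
proof -
  obtain C :: "complex^'n^'n" where C: "invertible C" and MC: "M = C ** adj C" using pos_def_factorization[OF M] .
  define E where "E = adj (matrix_inv C)"
  note Ci = matrix_inv_works[OF C]
  have E: "invertible E" unfolding E_def by (intro adj_matrix_inv invertible_matrix_inv C)
  have CE: "adj C ** E = mat 1" "E ** adj C = mat 1"
    unfolding E_def adj_mult[symmetric] by (simp_all add: Ci)
  have CE': "C ** adj E = mat 1" "adj E ** C = mat 1"
    by (simp_all add: E_def Ci)
  obtain U :: "complex^'n^'n" and d where U: "adj U ** U = mat 1" "U ** adj U = mat 1"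
    and d: "\<And>i. 0 < d i" and X: "adj E ** N ** E = U ** cdiag d ** adj U"
    using pos_def_diagonalization[OF pos_def_congruence[OF N E]] by blast
  have NX: "N = C ** (adj E ** N ** E) ** adj C"
  proof -
    have "C ** (adj E ** N ** E) ** adj C = (C ** adj E) ** N ** (E ** adj C)"
      by (simp only: matrix_mul_assoc)
    then show ?thesis by (simp add: CE CE')
  qed
  have invM: "matrix_inv M = E ** adj E"
  proof (rule matrix_inv_eqI(2))
    have "M ** (E ** adj E) = C ** (adj C ** E) ** adj E" by (simp only: MC matrix_mul_assoc)
    then show "M ** (E ** adj E) = mat 1" by (simp add: CE CE')
  qed
  have dX: "det (adj E ** N ** E) = complex_of_real (\<Prod>i\<in>UNIV. d i)"
  proof -
    have "det (adj E ** N ** E) = det (cdiag d) * det (adj U ** U)"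
      by (simp add: X det_mul)
    then show ?thesis by (simp add: U det_cdiag)
  qed
  have "Re (det N) = (norm (det C))\<^sup>2 * (\<Prod>i\<in>UNIV. d i)"
  proof -
    have "det N = det (C ** adj C) * complex_of_real (\<Prod>i\<in>UNIV. d i)"
      by (subst NX) (simp add: det_mul dX[simplified det_mul])
    then show ?thesis by (simp add: det_mult_adj del: of_real_prod)
  qed
  moreover have "Re (det M) = (norm (det C))\<^sup>2" by (simp add: MC det_mult_adj)
  moreover have "det C \<noteq> 0" using C invertible_det_nz by blast
  moreover have "(\<Prod>i\<in>UNIV. d i) > 0" using d by (simp add: prod_pos)
  ultimately have ln: "ln (Re (det N)) = ln (Re (det M)) + (\<Sum>i\<in>UNIV. ln (d i))"
    using d by (simp add: ln_mult ln_prod less_imp_neq[symmetric])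
  have tr: "matrix_inv M \<bullet> K = Re (trace (adj E ** K ** E))" for K
  proof -
    have "matrix_inv M \<bullet> K = Re (trace (E ** (adj E ** K)))"
      by (simp add: invM inner_eq_trace adj_mult matrix_mul_assoc)
    then show ?thesis by (subst (asm) trace_mul_sym)
  qed
  have "trace (adj E ** N ** E) = trace (cdiag d ** (adj U ** U))"
    unfolding X by (metis matrix_mul_assoc trace_mul_sym)
  then have trN: "matrix_inv M \<bullet> N = (\<Sum>i\<in>UNIV. d i)"
    by (simp add: tr U trace_cdiag)
  have "adj E ** M ** E = (adj E ** C) ** (adj C ** E)" by (simp add: MC matrix_mul_assoc)
  then have trM: "matrix_inv M \<bullet> M = real CARD('n)"
    by (simp add: tr CE CE' trace_I)
  have diff: "matrix_inv M \<bullet> (N - M) = (\<Sum>i\<in>UNIV. d i - 1)"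
    by (simp add: inner_diff trN trM sum_subtractf)
  have le: "ln (d i) \<le> d i - 1" for i using d by (rule ln_le_minus_one)
  show "ln (Re (det N)) \<le> ln (Re (det M)) + matrix_inv M \<bullet> (N - M)"
    unfolding ln diff using le by (simp add: sum_mono)
  assume "ln (Re (det N)) = ln (Re (det M)) + matrix_inv M \<bullet> (N - M)"
  then have "(\<Sum>i\<in>UNIV. (d i - 1) - ln (d i)) = 0"
    unfolding ln diff by (simp add: sum_subtractf)
  then have "ln (d i) = d i - 1" for i
    using le by (subst (asm) sum_nonneg_eq_0_iff) auto
  then have "d i = 1" for i using ln_eq_minus_one d by blast
  then have "d = (\<lambda>i. 1)" by (rule ext)
  then have "cdiag d = mat 1" by (simp only: cdiag_1)
  then have "adj E ** N ** E = mat 1" by (simp add: X U)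
  then show "N = M" by (subst NX) (simp add: MC)
qed

lemma inner_inverse_self: "invertible M \<Longrightarrow> adj (matrix_inv M) = matrix_inv M \<Longrightarrow>
    matrix_inv M \<bullet> M = real CARD('n)" for M :: "complex^'n^'n"
  by (simp add: inner_eq_trace matrix_inv_works trace_I)

subsection \<open>Bounds by the trace\<close>

lemma column_mult: "column j (A ** B) = A *v column j B"
  by (simp add: vec_eq_iff column_def mult_nth mult_vec_nth)

lemma inner_columns: "X \<bullet> Y = (\<Sum>j\<in>UNIV. column j X \<bullet> column j Y)" for X Y :: "complex^'n^'k"
  unfolding inner_matrix inner_vec_complex column_def by (subst sum.swap) simp

lemma pos_semidef_inner_nonneg:
  fixes M N :: "complex^'n^'n"
  assumes "pos_semidef M" "pos_semidef N"
  shows "0 \<le> M \<bullet> N"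
proof -
  obtain C :: "complex^'n^'n" where C: "M = C ** adj C" using pos_semidef_factorization[OF assms(1)] .
  have "M \<bullet> N = C \<bullet> (N ** C)" by (simp add: C inner_mult_right)
  also have "\<dots> \<ge> 0"
    using assms(2) by (simp add: inner_columns column_mult pos_semidef_def sum_nonneg)
  finally show ?thesis .
qed

lemma norm_le_trace:
  fixes M :: "complex^'n^'n"
  assumes "pos_semidef M"
  shows "norm M \<le> mat 1 \<bullet> M"
proof -
  obtain C :: "complex^'n^'n" where C: "M = C ** adj C" using pos_semidef_factorization[OF assms] .
  have "norm M \<le> norm C * norm C" using norm_mult_le[of C "adj C"] by (simp add: C)
  also have "\<dots> = C \<bullet> C" by (simp add: dot_square_norm power2_eq_square)
  also have "\<dots> = mat 1 \<bullet> M" unfolding C inner_mat_1 inner_eq_trace[of C C]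
    by (subst trace_mul_sym) rule
  finally show ?thesis .
qed

text \<open>With \<open>M = C C\<^sup>*\<close>, this is the Cauchy--Schwarz inequality for \<open>C\<^sup>* v\<close> and \<open>C\<^sup>-\<^sup>1 v\<close>, whose inner
  product is \<open>1\<close>.\<close>

lemma trace_inverse_ge:
  fixes M :: "complex^'n^'n"
  assumes M: "pos_def M" and v: "norm v = 1"
  shows "1 \<le> (v \<bullet> (M *v v)) * (mat 1 \<bullet> matrix_inv M)"
proof -
  obtain C :: "complex^'n^'n" where C: "invertible C" and MC: "M = C ** adj C" using pos_def_factorization[OF M] .
  define E where "E = matrix_inv C"
  have CE: "C ** E = mat 1" "E ** C = mat 1" by (simp_all add: E_def matrix_inv_works C)
  have inv: "matrix_inv M = adj E ** E"
  proof (rule matrix_inv_eqI(2))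
    have "M ** (adj E ** E) = C ** adj (E ** C) ** E" by (simp add: MC adj_mult matrix_mul_assoc)
    then show "M ** (adj E ** E) = mat 1" by (simp add: CE)
  qed
  have "1 = v \<bullet> (C *v (E *v v))" using v by (simp add: matrix_vector_mul_assoc CE dot_square_norm)
  also have "\<dots> = (adj C *v v) \<bullet> (E *v v)" by (simp add: inner_adj_vec)
  also have "\<dots> \<le> norm (adj C *v v) * norm (E *v v)" by (rule norm_cauchy_schwarz)
  also have "\<dots> \<le> norm (adj C *v v) * norm E"
    using norm_mult_vec_le[of E v] v by (simp add: mult_left_mono)
  finally have "1\<^sup>2 \<le> (norm (adj C *v v) * norm E)\<^sup>2" by (intro power_mono) auto
  moreover have "(norm (adj C *v v))\<^sup>2 = v \<bullet> (M *v v)"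
    by (simp add: power2_norm_eq_inner inner_adj_vec MC matrix_vector_mul_assoc)
  moreover have "(norm E)\<^sup>2 = mat 1 \<bullet> matrix_inv M"
    by (simp add: power2_norm_eq_inner inv inner_mat_1 inner_eq_trace)
  ultimately show ?thesis by (simp add: power_mult_distrib)
qed

lemma trace_inverse_pos: "pos_def M \<Longrightarrow> 0 < mat 1 \<bullet> matrix_inv M" for M :: "complex^'n^'n"
proof -
  assume M: "pos_def M"
  define v :: "complex^'n" where "v = axis undefined 1"
  have "norm v = 1" by (simp add: v_def)
  moreover have "v \<noteq> 0" using \<open>norm v = 1\<close> by auto
  ultimately show ?thesis
    using trace_inverse_ge[OF M, of v] M
    by (smt (verit) pos_def_def mult_nonneg_nonpos)
qed

lemma coercive_if_trace_inverse_le: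
  fixes M :: "complex^'n^'n"
  assumes M: "pos_def M" and T: "mat 1 \<bullet> matrix_inv M \<le> T"
  shows "pos_semidef (M - (1 / T) *\<^sub>R mat 1)"
  unfolding pos_semidef_minus_mat_iff
proof (intro conjI allI)
  show "adj M = M" by (rule pos_def_hermitian[OF M])
  fix x :: "complex^'n"
  show "1 / T * (x \<bullet> x) \<le> x \<bullet> (M *v x)"
  proof (cases "x = 0")
    case False
    define v where "v = x /\<^sub>R norm x"
    have T0: "T > 0" using trace_inverse_pos[OF M] T by simp
    have v1: "norm v = 1" using False by (simp add: v_def)
    then have "v \<noteq> 0" by auto
    then have "0 < v \<bullet> (M *v v)" using M by (simp add: pos_def_def)
    then have "(v \<bullet> (M *v v)) * (mat 1 \<bullet> matrix_inv M) \<le> (v \<bullet> (M *v v)) * T"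
      using T by (intro mult_left_mono) auto
    then have "1 \<le> (v \<bullet> (M *v v)) * T"
      using trace_inverse_ge[OF M v1] by simp
    then have "1 / T \<le> v \<bullet> (M *v v)" using T0 by (simp add: field_simps)
    also have "\<dots> = (x \<bullet> (M *v x)) / (x \<bullet> x)"
      by (simp add: v_def mult_vec_scaleR dot_square_norm power2_eq_square divide_inverse mult_ac)
    finally show ?thesis using False by (simp add: field_simps)
  qed simp
qed

lemma norm_inverse_le:
  fixes M :: "complex^'n^'n"
  assumes M: "pos_semidef (M - s *\<^sub>R mat 1)" and s: "0 < s"
  shows "norm (matrix_inv M) \<le> real CARD('n) / s"
proof -
  have pd: "pos_def M" by (rule pos_def_if_coercive[OF M s])
  have psd: "pos_semidef (matrix_inv M)" by (intro pos_def_imp_semidef pos_def_matrix_inv pd)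
  have "0 \<le> matrix_inv M \<bullet> (M - s *\<^sub>R mat 1)" by (rule pos_semidef_inner_nonneg[OF psd M])
  then have "s * (mat 1 \<bullet> matrix_inv M) \<le> real CARD('n)"
    using inner_inverse_self[OF pos_def_invertible[OF pd] pos_def_inverse_hermitian[OF pd]]
    by (simp add: inner_diff inner_commute)
  moreover have "s * norm (matrix_inv M) \<le> s * (mat 1 \<bullet> matrix_inv M)"
    using norm_le_trace[OF psd] s by simp
  ultimately have "s * norm (matrix_inv M) \<le> real CARD('n)" by linarith
  then show ?thesis using s by (simp add: pos_le_divide_eq mult.commute)
qed

subsection \<open>The square root\<close>

lemma pos_def_sqrt_exists:
  fixes M :: "complex^'n^'n"
  assumes "pos_def M"
  shows "\<exists>S. pos_def S \<and> S ** S = M"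
proof -
  obtain U :: "complex^'n^'n" and d where U: "adj U ** U = mat 1" "U ** adj U = mat 1"
    and d: "\<And>i. 0 < d i" and M: "M = U ** cdiag d ** adj U"
    using pos_def_diagonalization[OF assms] by blast
  define S where "S = U ** cdiag (\<lambda>i. sqrt (d i)) ** adj U"
  have "S ** S = U ** cdiag (\<lambda>i. sqrt (d i)) ** (adj U ** U) ** cdiag (\<lambda>i. sqrt (d i)) ** adj U"
    by (simp only: S_def matrix_mul_assoc)
  also have "\<dots> = U ** (cdiag (\<lambda>i. sqrt (d i)) ** cdiag (\<lambda>i. sqrt (d i))) ** adj U"
    unfolding U by (simp only: matrix_mul_rid matrix_mul_assoc)
  also have "\<dots> = M" using d by (simp add: M cdiag_mult_cdiag less_imp_le)
  finally have "S ** S = M" .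
  moreover have "pos_def S" unfolding S_def using d by (intro pos_def_unitary_diag U) simp
  ultimately show ?thesis by blast
qed

text \<open>With \<open>D = S - T\<close> one has \<open>S D + D T = 0\<close>, and both \<open>tr (D S D)\<close> and \<open>tr (D T D)\<close> are
  nonnegative.\<close>

lemma pos_def_sqrt_unique:
  fixes S T :: "complex^'n^'n"
  assumes S: "pos_def S" and T: "pos_def T" and eq: "S ** S = T ** T"
  shows "S = T"
proof -
  define D where "D = S - T"
  have D: "adj D = D" using S T by (simp add: D_def adj_diff pos_def_hermitian)
  have "S ** D + D ** T = 0"
    by (simp add: D_def mult_diff_left mult_diff_right eq)
  then have SD: "S ** D = - (D ** T)" by (simp add: eq_neg_iff_add_eq_0)
  have nonneg: "0 \<le> D \<bullet> (R ** D)" if "pos_def R" for R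
    using pos_def_imp_semidef[OF that]
    by (simp add: inner_columns column_mult pos_semidef_def sum_nonneg)
  have "D \<bullet> (D ** T) = D \<bullet> (T ** D)"
    using inner_adj_adj[of D "D ** T"] D T by (simp add: adj_mult pos_def_hermitian)
  then have "D \<bullet> (S ** D) = 0"
    using nonneg[OF S] nonneg[OF T] SD by simp
  then have "column j D \<bullet> (S *v column j D) = 0" for j
    using pos_def_imp_semidef[OF S]
    by (simp add: inner_columns column_mult pos_semidef_def sum_nonneg_eq_0_iff)
  then have "column j D = 0" for j using S by (metis less_irrefl pos_def_def)
  then have "D = 0" by (simp add: vec_eq_iff column_def)
  then show ?thesis by (simp add: D_def)
qed

lemma cmat_form:
  "x \<bullet> (cmat S *v x) = (\<chi> i. Re (x $ i)) \<bullet> (S *v (\<chi> i. Re (x $ i)))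
    + (\<chi> i. Im (x $ i)) \<bullet> (S *v (\<chi> i. Im (x $ i)))"
  by (simp add: inner_vec_complex inner_vec_def mult_vec_nth sum.distrib)

lemma sym_pos_def_iff: "sym_pos_def S \<longleftrightarrow> pos_def (cmat S)" for S :: "real^'n^'n"
proof
  assume S: "sym_pos_def S"
  have nonneg: "0 \<le> x \<bullet> (S *v x)" for x
    using S by (cases "x = 0") (auto simp: sym_pos_def_def less_imp_le)
  have "0 < x \<bullet> (cmat S *v x)" if "x \<noteq> 0" for x
  proof -
    have "(\<chi> i. Re (x $ i)) \<noteq> 0 \<or> (\<chi> i. Im (x $ i)) \<noteq> 0"
      using that by (auto simp: vec_eq_iff complex_eq_iff)
    then show ?thesis
      unfolding cmat_form using S nonneg
      by (auto simp: sym_pos_def_def add_pos_nonneg add_nonneg_pos)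
  qed
  then show "pos_def (cmat S)" using S by (simp add: pos_def_def adj_cmat sym_pos_def_def)
next
  assume S: "pos_def (cmat S)"
  have "0 < x \<bullet> (S *v x)" if "x \<noteq> 0" for x
  proof -
    define y where "y = (\<chi> i. complex_of_real (x $ i))"
    have "y \<noteq> 0" using that by (auto simp: vec_eq_iff y_def)
    then have "0 < y \<bullet> (cmat S *v y)" using S by (simp add: pos_def_def)
    then show ?thesis unfolding cmat_form by (simp add: y_def inner_vec_def mult_vec_nth)
  qed
  moreover have "transpose S = S"
    using pos_def_hermitian[OF S] by (simp add: adj_cmat)
  ultimately show "sym_pos_def S" by (simp add: sym_pos_def_def)
qed

text \<open>The complex conjugate of the square root of a real matrix is again a square root of it, hence
  the square root is real.\<close>

lemma matrix_sqrt:
  fixes S :: "real^'n^'n"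
  assumes S: "sym_pos_def S"
  shows "sym_pos_def (matrix_sqrt S)" "matrix_sqrt S ** matrix_sqrt S = S"
proof -
  obtain R where R: "pos_def R" "R ** R = cmat S"
    using pos_def_sqrt_exists S sym_pos_def_iff by blast
  have "pos_def (conj_mat R)" unfolding pos_def_def
  proof (intro conjI allI impI)
    show "adj (conj_mat R) = conj_mat R"
      using R(1) by (simp add: conj_mat_adj[symmetric] pos_def_hermitian)
    fix x :: "complex^'n" assume "x \<noteq> 0"
    define y where "y = (\<chi> i. cnj (x $ i))"
    have "y \<noteq> 0" using \<open>x \<noteq> 0\<close> by (auto simp: y_def vec_eq_iff)
    then have "0 < y \<bullet> (R *v y)" using R by (simp add: pos_def_def)
    also have "y \<bullet> (R *v y) = x \<bullet> (conj_mat R *v x)"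
    proof -
      have "(conj_mat R *v x) $ i = cnj ((R *v y) $ i)" for i
        by (simp add: mult_vec_nth y_def)
      then show ?thesis by (simp add: inner_vec_complex) (simp add: y_def)
    qed
    finally show "0 < x \<bullet> (conj_mat R *v x)" .
  qed
  moreover have "conj_mat R ** conj_mat R = R ** R"
    by (simp add: conj_mat_mult[symmetric] R)
  ultimately have "conj_mat R = R" using R(1) pos_def_sqrt_unique by blast
  then have "R = cmat (\<chi> i j. Re (R $ i $ j))"
    by (simp add: vec_eq_iff complex_eq_iff)
  then obtain Q where Q: "R = cmat Q" by blast
  have "sym_pos_def Q \<and> Q ** Q = S"
    using R Q by (simp add: sym_pos_def_iff cmat_mult[symmetric])
  moreover have "Q' = Q" if "sym_pos_def Q' \<and> Q' ** Q' = S" for Q'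
  proof -
    have "pos_def (cmat Q')" "cmat Q' ** cmat Q' = R ** R"
      using that R by (simp_all add: sym_pos_def_iff cmat_mult[symmetric])
    then have "cmat Q' = R" using R(1) pos_def_sqrt_unique by blast
    then show ?thesis by (simp add: Q)
  qed
  ultimately have "sym_pos_def (matrix_sqrt S) \<and> matrix_sqrt S ** matrix_sqrt S = S"
    unfolding matrix_sqrt_def by (rule theI)
  then show "sym_pos_def (matrix_sqrt S)" "matrix_sqrt S ** matrix_sqrt S = S" by auto
qed

section \<open>Continuity and measurability of matrix operations\<close>

lemma matrix_inv_cramer:
  fixes A :: "('a::field)^'n^'n"
  assumes "invertible A"
  shows "matrix_inv A =
    (\<chi> k j. det (\<chi> i l. if l = k then (if i = j then 1 else 0) else A $ i $ l) / det A)"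
proof -
  have "matrix_inv A $ k $ j = det (\<chi> i l. if l = k then (if i = j then 1 else 0) else A $ i $ l) / det A"
    for k j
  proof -
    have "A *v column j (matrix_inv A) = (\<chi> i. if i = j then 1 else 0)"
      using matrix_inv_works(1)[OF assms]
      by (simp add: vec_eq_iff mult_vec_nth mult_nth column_def mat_nth)
    then have "column j (matrix_inv A)
      = (\<chi> k. det (\<chi> i l. if l = k then (\<chi> i. if i = j then 1 else 0) $ i else A $ i $ l) / det A)"
      using cramer[of A] assms invertible_det_nz by blast
    then show ?thesis by (simp add: column_def vec_eq_iff cong: if_cong)
  qed
  then show ?thesis by (simp add: vec_eq_iff)
qed

lemma continuous_on_det [continuous_intros]:
  fixes f :: "'a::topological_space \<Rightarrow> complex^'n^'n"
  shows "continuous_on S f \<Longrightarrow> continuous_on S (\<lambda>z. det (f z))"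
  unfolding det_def by (intro continuous_intros) auto

lemma continuous_on_matrix_inv:
  fixes f :: "'a::topological_space \<Rightarrow> complex^'n^'n"
  assumes f: "continuous_on S f" and inv: "\<And>z. z \<in> S \<Longrightarrow> invertible (f z)"
  shows "continuous_on S (\<lambda>z. matrix_inv (f z))"
proof -
  have "continuous_on S (\<lambda>z. (\<chi> k j. det (\<chi> i l. if l = k then (if i = j then 1 else 0)
      else f z $ i $ l) / det (f z)) :: complex^'n^'n)"
  proof (intro continuous_on_vec_lambda continuous_on_divide continuous_on_det f)
    show "continuous_on S (\<lambda>z. if l = k then if i = j then 1 else 0 else f z $ i $ l)"
      for l k i j :: 'n
      by (cases "l = k") (auto intro!: continuous_intros f)
    show "\<forall>z\<in>S. det (f z) \<noteq> 0" using inv invertible_det_nz by blast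
  qed
  then show ?thesis
    by (subst continuous_on_cong[OF refl matrix_inv_cramer[OF inv]]) auto
qed

lemma continuous_on_adj [continuous_intros]:
  "continuous_on S f \<Longrightarrow> continuous_on S (\<lambda>z. adj (f z))"
  by (rule bounded_linear.continuous_on[OF bounded_linear_adj])

lemma continuous_on_conj_mat [continuous_intros]:
  "continuous_on S f \<Longrightarrow> continuous_on S (\<lambda>z. conj_mat (f z))"
  by (rule bounded_linear.continuous_on[OF bounded_linear_conj_mat])

lemma borel_measurable_matrix:
  fixes f :: "'a \<Rightarrow> complex^'n^'k"
  assumes "\<And>i j. (\<lambda>z. f z $ i $ j) \<in> borel_measurable M"
  shows "f \<in> borel_measurable M"
proof (subst borel_measurable_euclidean_space, safe)
  fix b :: "complex^'n^'k" assume "b \<in> Basis"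
  then obtain i j u where "b = axis i (axis j u)" by (auto simp: Basis_vec_def)
  then show "(\<lambda>x. f x \<bullet> b) \<in> borel_measurable M"
    by (simp add: inner_axis assms borel_measurable_inner)
qed

lemma borel_measurable_matrix_nth [measurable (raw)]:
  fixes f :: "'a \<Rightarrow> complex^'n^'k"
  assumes "f \<in> borel_measurable M"
  shows "(\<lambda>z. f z $ i $ j) \<in> borel_measurable M"
  by (rule measurable_compose[OF assms]) (intro borel_measurable_continuous_onI continuous_intros)

lemma borel_measurable_matrix_mult [measurable (raw)]:
  fixes f :: "'a \<Rightarrow> complex^'n^'k" and g :: "'a \<Rightarrow> complex^'l^'n"
  assumes "f \<in> borel_measurable M" "g \<in> borel_measurable M"
  shows "(\<lambda>z. f z ** g z) \<in> borel_measurable M"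
  by (rule borel_measurable_continuous_Pair[OF assms]) (intro continuous_intros)

lemma borel_measurable_adj [measurable (raw)]:
  assumes "f \<in> borel_measurable M"
  shows "(\<lambda>z. adj (f z)) \<in> borel_measurable M"
  by (rule measurable_compose[OF assms]) (intro borel_measurable_continuous_onI continuous_intros)

lemma borel_measurable_det [measurable (raw)]:
  fixes f :: "'a \<Rightarrow> complex^'n^'n"
  assumes "f \<in> borel_measurable M"
  shows "(\<lambda>z. det (f z)) \<in> borel_measurable M"
  by (rule measurable_compose[OF assms]) (intro borel_measurable_continuous_onI continuous_intros)

lemma borel_measurable_trace [measurable (raw)]:
  fixes f :: "'a \<Rightarrow> complex^'n^'n"
  assumes "f \<in> borel_measurable M"
  shows "(\<lambda>z. trace (f z)) \<in> borel_measurable M"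
  unfolding trace_def using assms by measurable

text \<open>On singular matrices \<open>matrix_inv\<close> is constant, because its defining property is
  unsatisfiable there; hence it is a Borel function on all matrices.\<close>

lemma borel_measurable_matrix_inv [measurable (raw)]:
  fixes f :: "'a \<Rightarrow> complex^'n^'n"
  assumes f [measurable]: "f \<in> borel_measurable M"
  shows "(\<lambda>z. matrix_inv (f z)) \<in> borel_measurable M"
proof -
  define g where "g z = (\<chi> k j. det (\<chi> i l. if l = k then (if i = j then 1 else 0)
      else f z $ i $ l) / det (f z) :: complex^'n^'n)" for z
  have g [measurable]: "g \<in> borel_measurable M"
  proof (rule borel_measurable_matrix)
    fix k j
    have [measurable]: "(\<lambda>z. \<chi> i l. if l = k then (if i = j then 1 else 0) else f z $ i $ l)
        \<in> borel_measurable M"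
    proof (rule borel_measurable_matrix)
      fix i l
      show "(\<lambda>z. (\<chi> i l. if l = k then if i = j then 1 else 0 else f z $ i $ l) $ i $ l)
          \<in> borel_measurable M"
        by (cases "l = k") auto
    qed
    show "(\<lambda>z. g z $ k $ j) \<in> borel_measurable M" unfolding g_def vec_lambda_beta by measurable
  qed
  have "matrix_inv (f z) = (if det (f z) \<noteq> 0 then g z else (SOME A'. False))" for z
  proof (cases "det (f z) = 0")
    case True
    then have "\<not> invertible (f z)" using invertible_det_nz by blast
    then have "(\<lambda>A'. f z ** A' = mat 1 \<and> A' ** f z = mat 1) = (\<lambda>A'. False)"
      by (auto simp: invertible_def)
    then show ?thesis using True by (simp add: matrix_inv_def)
  next
    case False
    then show ?thesis using matrix_inv_cramer[of "f z"] invertible_det_nz[of "f z"] by (simp add: g_def)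
  qed
  then show ?thesis by simp
qed

section \<open>Integration over the circle\<close>

abbreviation circ :: "complex set" where "circ \<equiv> sphere 0 1"

abbreviation angle_measure :: "real measure" where
  "angle_measure \<equiv> uniform_measure lborel {-pi..pi}"

lemma cis_measurable: "cis \<in> measurable angle_measure (restrict_space borel circ)"
proof (rule measurable_restrict_space2)
  have "cis \<in> borel_measurable borel"
    by (intro borel_measurable_continuous_onI continuous_on_cis continuous_on_id)
  then show "cis \<in> measurable angle_measure borel"
    by (simp add: measurable_cong_sets[of angle_measure borel borel borel])
qed auto

lemma space_circle [simp]: "space circle = circ"
  by (simp add: circle_def space_restrict_space)

lemma sets_circle [measurable_cong]: "sets circle = sets (restrict_space borel circ)"
  by (simp add: circle_def)

lemma emeasure_angles: "emeasure lborel {-pi..pi} = ennreal (2 * pi)"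
  by simp

lemma emeasure_circle_UNIV: "emeasure circle (space circle) = 1"
proof -
  have "circ \<in> sets (restrict_space borel circ)"
    using sets.top[of "restrict_space borel circ"] by (simp add: space_restrict_space)
  then have "emeasure circle circ = emeasure angle_measure (cis -` circ \<inter> space angle_measure)"
    unfolding circle_def by (rule emeasure_distr[OF cis_measurable])
  also have "cis -` circ \<inter> space angle_measure = UNIV" by auto
  also have "emeasure angle_measure UNIV = 1"
    using pi_gt_zero by (subst emeasure_uniform_measure) (simp_all add: ennreal_divide_self)
  finally show ?thesis by simp
qed

interpretation circle: finite_measure circle
  by (rule finite_measureI) (simp only: emeasure_circle_UNIV, simp)

lemma measure_circle [simp]: "measure circle circ = 1"
  using emeasure_circle_UNIV by (simp add: measure_def)

lemma continuous_measurable_circle: "continuous_on circ f \<Longrightarrow> f \<in> borel_measurable circle"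
  using borel_measurable_continuous_on_restrict
  by (subst measurable_cong_sets[OF sets_circle refl])

lemma continuous_bounded_circle:
  fixes f :: "complex \<Rightarrow> 'b::real_normed_vector"
  assumes "continuous_on circ f"
  shows "\<exists>K>0. \<forall>z\<in>circ. norm (f z) \<le> K"
proof -
  have "bounded (f ` circ)" by (intro compact_imp_bounded compact_continuous_image assms) simp
  then show ?thesis unfolding bounded_pos by auto
qed

lemma integrable_circle_bounded:
  fixes f :: "complex \<Rightarrow> 'b::{banach, second_countable_topology}"
  assumes "f \<in> borel_measurable circle" "AE z in circle. norm (f z) \<le> K"
  shows "integrable circle f"
  using circle.integrable_const_bound assms by blast

lemma integrable_circle_continuous:
  fixes f :: "complex \<Rightarrow> 'b::{banach, second_countable_topology}"
  assumes "continuous_on circ f"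
  shows "integrable circle f"
proof -
  obtain K where "\<And>z. z \<in> circ \<Longrightarrow> norm (f z) \<le> K"
    using continuous_bounded_circle[OF assms] by blast
  then show ?thesis
    by (intro integrable_circle_bounded[where K = K] continuous_measurable_circle assms AE_I2) simp
qed

lemma integral_circle_mono:
  fixes f g :: "complex \<Rightarrow> real"
  assumes "integrable circle f" "integrable circle g" "\<And>z. z \<in> circ \<Longrightarrow> f z \<le> g z"
  shows "(LINT z|circle. f z) \<le> (LINT z|circle. g z)"
  using assms by (intro integral_mono) auto

lemma integral_circle_cong:
  "(\<And>z. z \<in> circ \<Longrightarrow> f z = g z) \<Longrightarrow> (LINT z|circle. f z) = (LINT z|circle. g z)"
  by (rule Bochner_Integration.integral_cong) auto

lemma AE_circle_ex:
  assumes "AE z in circle. P z"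
  shows "\<exists>z\<in>circ. P z"
proof (rule ccontr)
  assume "\<not> ?thesis"
  then have "AE z in circle. P z \<longrightarrow> False" by (intro AE_I2) auto
  with assms have "AE z in circle. False" by (rule AE_mp)
  then have "emeasure circle {z \<in> space circle. True} = 0"
    by (intro emeasure_eq_0_AE) simp
  moreover have "{z \<in> space circle. True} = space circle" by blast
  ultimately show False using emeasure_circle_UNIV by (simp only: zero_neq_one one_neq_zero)
qed

lemma AE_circle_angle:
  assumes "AE z in circle. P z"
  shows "AE \<theta> in lborel. \<theta> \<in> {-pi..pi} \<longrightarrow> P (cis \<theta>)"
proof -
  have "AE \<theta> in angle_measure. P (cis \<theta>)"
    using assms unfolding circle_def by (rule AE_distrD[OF cis_measurable])
  then show ?thesis
    by (subst (asm) AE_uniform_measure) auto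
qed

lemma integral_circle:
  fixes f :: "complex \<Rightarrow> 'b::{banach, second_countable_topology}"
  assumes f: "f \<in> borel_measurable circle"
  shows "(LINT z|circle. f z) = (1 / (2 * pi)) *\<^sub>R (LBINT \<theta>:{-pi..pi}. f (cis \<theta>))"
    and "integrable circle f \<longleftrightarrow> set_integrable lborel {-pi..pi} (\<lambda>\<theta>. f (cis \<theta>))"
proof -
  have f': "f \<in> borel_measurable (restrict_space borel circ)"
    using f by (simp add: measurable_cong_sets[OF sets_circle refl])
  have m: "(\<lambda>\<theta>. f (cis \<theta>)) \<in> borel_measurable lborel"
    using measurable_compose[OF cis_measurable f'] by simp
  have dens: "angle_measure = density lborel (\<lambda>\<theta>. ennreal (indicator {-pi..pi} \<theta> / (2 * pi)))"
    unfolding uniform_measure_def emeasure_angles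
    by (intro arg_cong[where f = "density lborel"] ext)
       (simp add: divide_ennreal[symmetric] indicator_def)
  have eq: "(\<lambda>\<theta>. (indicator {-pi..pi} \<theta> / (2 * pi)) *\<^sub>R f (cis \<theta>))
      = (\<lambda>\<theta>. (1 / (2 * pi)) *\<^sub>R (indicator {-pi..pi} \<theta> *\<^sub>R f (cis \<theta>)))"
    by (rule ext) simp
  have "(LINT z|circle. f z) = (LINT \<theta>|angle_measure. f (cis \<theta>))"
    unfolding circle_def by (rule integral_distr[OF cis_measurable f'])
  also have "\<dots> = (LINT \<theta>|lborel. (indicator {-pi..pi} \<theta> / (2 * pi)) *\<^sub>R f (cis \<theta>))"
    unfolding dens using m by (intro integral_density) auto
  also have "\<dots> = (1 / (2 * pi)) *\<^sub>R (LBINT \<theta>:{-pi..pi}. f (cis \<theta>))"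
    by (simp only: eq set_lebesgue_integral_def integral_scaleR_right)
  finally show "(LINT z|circle. f z) = (1 / (2 * pi)) *\<^sub>R (LBINT \<theta>:{-pi..pi}. f (cis \<theta>))" .
  have "integrable circle f \<longleftrightarrow> integrable angle_measure (\<lambda>\<theta>. f (cis \<theta>))"
    unfolding circle_def by (rule integrable_distr_eq[OF cis_measurable f'])
  also have "\<dots> \<longleftrightarrow> integrable lborel (\<lambda>\<theta>. (indicator {-pi..pi} \<theta> / (2 * pi)) *\<^sub>R f (cis \<theta>))"
    unfolding dens using m by (intro integrable_density) auto
  also have "\<dots> \<longleftrightarrow> set_integrable lborel {-pi..pi} (\<lambda>\<theta>. f (cis \<theta>))"
    unfolding eq set_integrable_def
  proof
    assume "integrable lborel (\<lambda>\<theta>. (1 / (2 * pi)) *\<^sub>R (indicator {-pi..pi} \<theta> *\<^sub>R f (cis \<theta>)))"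
    from integrable_scaleR_right[of "2 * pi", OF this]
    show "integrable lborel (\<lambda>\<theta>. indicator {-pi..pi} \<theta> *\<^sub>R f (cis \<theta>))" by simp
  qed (rule integrable_scaleR_right)
  finally show "integrable circle f \<longleftrightarrow> set_integrable lborel {-pi..pi} (\<lambda>\<theta>. f (cis \<theta>))" .
qed

lemma uniform_measure_uminus: "distr angle_measure borel uminus = angle_measure"
proof (rule measure_eqI)
  fix X assume "X \<in> sets (distr angle_measure borel uminus)"
  then have X: "X \<in> sets borel" by simp
  have um: "uminus \<in> measurable angle_measure (borel :: real measure)"
    by (simp add: measurable_cong_sets[of angle_measure borel borel borel])
  have pre: "uminus -` X \<in> sets (borel :: real measure)"
    using measurable_sets[of uminus borel borel X] X by simp
  have "emeasure (distr angle_measure borel uminus) X = emeasure angle_measure (uminus -` X)"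
    using emeasure_distr[OF um X] by simp
  also have "\<dots> = emeasure lborel ({-pi..pi} \<inter> uminus -` X) / emeasure lborel {-pi..pi}"
    using pre by (intro emeasure_uniform_measure) auto
  also have "{-pi..pi} \<inter> uminus -` X = uminus -` ({-pi..pi} \<inter> X)" by auto
  also have "emeasure lborel (uminus -` ({-pi..pi} \<inter> X)) = emeasure (distr lborel borel uminus) ({-pi..pi} \<inter> X)"
    using X by (subst emeasure_distr) auto
  also have "\<dots> / emeasure lborel {-pi..pi} = emeasure angle_measure X"
    unfolding lborel_distr_uminus using X by (subst emeasure_uniform_measure) auto
  finally show "emeasure (distr angle_measure borel uminus) X = emeasure angle_measure X" .
qed simp

lemma cnj_measurable_circle: "cnj \<in> measurable circle circle"
proof -
  have "cnj \<in> measurable circle (restrict_space borel circ)"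
    by (intro measurable_restrict_space2 continuous_measurable_circle continuous_intros) auto
  then show ?thesis by (subst measurable_cong_sets[OF refl sets_circle])
qed

text \<open>The measure is invariant under conjugation, which makes the moments of real-valued processes
  real.\<close>

lemma circle_cnj: "distr circle circle cnj = circle"
proof -
  have c: "cnj \<in> measurable (restrict_space borel circ) (restrict_space borel circ)"
    using cnj_measurable_circle measurable_cong_sets[OF sets_circle sets_circle] by blast
  have um: "uminus \<in> measurable angle_measure (borel :: real measure)"
    by (simp add: measurable_cong_sets[of angle_measure borel borel borel])
  have cb: "cis \<in> measurable borel (restrict_space borel circ)"
    using cis_measurable by (simp add: measurable_cong_sets[of angle_measure borel])
  have "distr circle circle cnj = distr circle (restrict_space borel circ) cnj"
    by (rule distr_cong) (simp_all add: sets_circle)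
  also have "\<dots> = distr angle_measure (restrict_space borel circ) (cnj \<circ> cis)"
    unfolding circle_def by (rule distr_distr[OF c cis_measurable])
  also have "cnj \<circ> cis = cis \<circ> uminus" by (auto simp: cis_cnj)
  also have "distr angle_measure (restrict_space borel circ) (cis \<circ> uminus)
      = distr (distr angle_measure borel uminus) (restrict_space borel circ) cis"
    by (rule distr_distr[symmetric, OF cb um])
  finally show ?thesis by (simp add: uniform_measure_uminus circle_def)
qed

lemma integral_circle_cnj:
  fixes f :: "complex \<Rightarrow> 'b::{banach, second_countable_topology}"
  assumes "f \<in> borel_measurable circle"
  shows "(LINT z|circle. f (cnj z)) = (LINT z|circle. f z)"
  using integral_distr[OF cnj_measurable_circle assms] by (simp add: circle_cnj)

lemma AE_circle_cnj: "AE z in circle. P z \<Longrightarrow> AE z in circle. P (cnj z)"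
  by (rule AE_distrD[OF cnj_measurable_circle, unfolded circle_cnj])

lemma circ_angle:
  assumes "z \<in> circ"
  obtains \<theta> where "z = cis \<theta>" "-pi \<le> \<theta>" "\<theta> \<le> pi"
proof
  show "z = cis (Arg z)" using assms cis_Arg[of z] by (cases "z = 0") (auto simp: sgn_div_norm)
  show "-pi \<le> Arg z" "Arg z \<le> pi" using Arg_bounded[of z] by auto
qed

text \<open>Every arc has positive measure, so a closed condition on a continuous function holds
  everywhere once it holds almost everywhere.\<close>

lemma AE_circle_imp_all:
  fixes f :: "complex \<Rightarrow> 'b::topological_space"
  assumes f: "continuous_on circ f" and C: "closed C" and ae: "AE z in circle. f z \<in> C"
    and z: "z \<in> circ"
  shows "f z \<in> C"
proof (rule ccontr)
  assume "f z \<notin> C"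
  obtain t where t: "z = cis t" "-pi \<le> t" "t \<le> pi" using circ_angle[OF z] .
  have "continuous_on UNIV (\<lambda>\<theta>. f (cis \<theta>))"
    by (rule continuous_on_compose2[OF f continuous_on_cis[OF continuous_on_id]]) auto
  then have "open ((\<lambda>\<theta>. f (cis \<theta>)) -` (- C))"
    using C by (intro open_vimage) auto
  moreover have "t \<in> (\<lambda>\<theta>. f (cis \<theta>)) -` (- C)" using \<open>f z \<notin> C\<close> t by simp
  ultimately obtain e where e: "e > 0" "ball t e \<subseteq> (\<lambda>\<theta>. f (cis \<theta>)) -` (- C)"
    using open_contains_ball by blast
  define l u where "l = max (-pi) (t - e)" and "u = min pi (t + e)"
  have "l < u" using t e pi_gt_zero by (auto simp: l_def u_def)
  have "AE \<theta> in lborel. \<theta> \<notin> {l<..<u}"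
    using AE_circle_angle[OF ae]
  proof (rule AE_mp, intro AE_I2 impI notI)
    fix \<theta> assume h: "\<theta> \<in> {-pi..pi} \<longrightarrow> f (cis \<theta>) \<in> C" "\<theta> \<in> {l<..<u}"
    then have "\<theta> \<in> ball t e" by (auto simp: l_def u_def dist_real_def)
    then have "f (cis \<theta>) \<notin> C" using e by auto
    with h show False by (auto simp: l_def u_def)
  qed
  from emeasure_eq_0_AE[OF this] have "emeasure lborel {x \<in> space lborel. x \<in> {l<..<u}} = 0" .
  moreover have "{x \<in> space lborel. x \<in> {l<..<u}} = {l<..<u}" by auto
  ultimately have "emeasure lborel {l<..<u} = 0" by (simp only:)
  then show False using \<open>l < u\<close> by simp
qed

section \<open>A logarithmically divergent integral\<close>

lemma norm_cis_diff_le: "norm (cis a - cis b) \<le> \<bar>a - b\<bar>"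
proof -
  have "cis a - cis b = cis b * (exp (\<i> * of_real (a - b)) - 1)"
    by (simp add: cis_conv_exp right_diff_distrib exp_add[symmetric] algebra_simps)
  then have "norm (cis a - cis b) = 2 * \<bar>sin ((a - b) / 2)\<bar>"
    by (simp only: norm_mult norm_cis dist_exp_i_1 mult_1)
  also have "\<dots> \<le> \<bar>a - b\<bar>" using abs_sin_x_le_abs_x[of "(a - b) / 2"] by simp
  finally show ?thesis .
qed

lemma has_integral_inverse_shift:
  assumes "0 < \<eta>" "0 < L"
  shows "((\<lambda>x. 1 / (\<eta> + L * \<bar>x - c\<bar>)) has_integral (ln (1 + L * pi / \<eta>) / L)) {c..c + pi}"
    and "((\<lambda>x. 1 / (\<eta> + L * \<bar>x - c\<bar>)) has_integral (ln (1 + L * pi / \<eta>) / L)) {c - pi..c}"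
proof -
  have "1 + L * pi / \<eta> = (\<eta> + L * pi) / \<eta>"
    using assms by (simp add: add_divide_distrib)
  then have ln: "(ln (\<eta> + L * pi) - ln \<eta>) / L = ln (1 + L * pi / \<eta>) / L"
    using assms add_pos_pos[of \<eta> "L * pi"] by (simp add: ln_div)
  have d1: "((\<lambda>x. ln (\<eta> + L * (x - c)) / L) has_real_derivative 1 / (\<eta> + L * (x - c))) (at x within S)"
    if "c \<le> x" for x S
  proof -
    have "0 < \<eta> + L * (x - c)" using assms that by (simp add: add_pos_nonneg)
    then show ?thesis using assms by (auto intro!: derivative_eq_intros)
  qed
  have d2: "((\<lambda>x. - (ln (\<eta> + L * (c - x)) / L)) has_real_derivative 1 / (\<eta> + L * (c - x))) (at x within S)"
    if "x \<le> c" for x S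
  proof -
    have "0 < \<eta> + L * (c - x)" using assms that by (simp add: add_pos_nonneg)
    then show ?thesis using assms by (auto intro!: derivative_eq_intros)
  qed
  have "((\<lambda>x. 1 / (\<eta> + L * (x - c))) has_integral
      (ln (\<eta> + L * (c + pi - c)) / L - ln (\<eta> + L * (c - c)) / L)) {c..c + pi}"
    by (intro fundamental_theorem_of_calculus)
       (auto simp: has_real_derivative_iff_has_vector_derivative[symmetric] intro: d1)
  then show "((\<lambda>x. 1 / (\<eta> + L * \<bar>x - c\<bar>)) has_integral (ln (1 + L * pi / \<eta>) / L)) {c..c + pi}"
    unfolding ln[symmetric]
    by (subst has_integral_cong[where g = "\<lambda>x. 1 / (\<eta> + L * (x - c))"])
       (auto simp: diff_divide_distrib)
  have "((\<lambda>x. 1 / (\<eta> + L * (c - x))) has_integral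
      (- ln (\<eta> + L * (c - c)) / L - - ln (\<eta> + L * (c - (c - pi))) / L)) {c - pi..c}"
    by (intro fundamental_theorem_of_calculus)
       (auto simp: has_real_derivative_iff_has_vector_derivative[symmetric] intro: d2)
  then show "((\<lambda>x. 1 / (\<eta> + L * \<bar>x - c\<bar>)) has_integral (ln (1 + L * pi / \<eta>) / L)) {c - pi..c}"
    unfolding ln[symmetric]
    by (subst has_integral_cong[where g = "\<lambda>x. 1 / (\<eta> + L * (c - x))"])
       (auto simp: diff_divide_distrib)
qed

text \<open>In dimension one \<open>1 / \<bar>z - z0\<bar>\<close> is not integrable; quantitatively, an integrand that is
  at least \<open>1 / (\<eta> + L \<bar>z - z0\<bar>)\<close> has an integral of order \<open>ln (1 / \<eta>)\<close>.\<close>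

lemma integral_circle_ge_ln:
  fixes f :: "complex \<Rightarrow> real"
  assumes f: "continuous_on circ f" and z0: "z0 \<in> circ" and "0 < \<eta>" "0 < L"
    and ge: "\<And>z. z \<in> circ \<Longrightarrow> 1 \<le> (\<eta> + L * norm (z - z0)) * f z"
  shows "ln (1 + L * pi / \<eta>) / (2 * pi * L) \<le> (LINT z|circle. f z)"
proof -
  obtain t where t: "z0 = cis t" "-pi \<le> t" "t \<le> pi" using circ_angle[OF z0] .
  have fpos: "0 \<le> f z" if "z \<in> circ" for z
  proof (rule ccontr)
    assume "\<not> 0 \<le> f z"
    then have "(\<eta> + L * norm (z - z0)) * f z \<le> 0"
      using assms by (intro mult_nonneg_nonpos) auto
    with ge[OF that] show False by simp
  qed
  have low: "1 / (\<eta> + L * \<bar>x - t\<bar>) \<le> f (cis x)" for x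
  proof -
    have "1 \<le> (\<eta> + L * norm (cis x - z0)) * f (cis x)" by (rule ge) simp
    also have "\<dots> \<le> (\<eta> + L * \<bar>x - t\<bar>) * f (cis x)"
      using assms fpos[of "cis x"] norm_cis_diff_le[of x t] t(1)
      by (intro mult_right_mono add_left_mono mult_left_mono) auto
    finally have "1 \<le> (\<eta> + L * \<bar>x - t\<bar>) * f (cis x)" .
    moreover have "0 < \<eta> + L * \<bar>x - t\<bar>" using assms by (simp add: add_pos_nonneg)
    ultimately show ?thesis by (simp add: pos_divide_le_eq mult.commute)
  qed
  have cont: "continuous_on UNIV (\<lambda>x. f (cis x))"
    by (rule continuous_on_compose2[OF f continuous_on_cis[OF continuous_on_id]]) auto
  have int: "(\<lambda>x. f (cis x)) integrable_on {a..b}" for a b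
    by (rule integrable_continuous_interval) (rule continuous_on_subset[OF cont], simp)
  define J where "J = (if t \<le> 0 then {t..t + pi} else {t - pi..t})"
  have J: "J \<subseteq> {-pi..pi}" "(\<lambda>x. f (cis x)) integrable_on J"
    using t int by (auto simp: J_def)
  have "((\<lambda>x. 1 / (\<eta> + L * \<bar>x - t\<bar>)) has_integral (ln (1 + L * pi / \<eta>) / L)) J"
    using has_integral_inverse_shift[OF assms(3,4)] by (simp add: J_def)
  then have "ln (1 + L * pi / \<eta>) / L \<le> integral J (\<lambda>x. f (cis x))"
    by (rule has_integral_le[OF _ integrable_integral[OF J(2)]]) (rule low)
  also have "\<dots> \<le> integral {-pi..pi} (\<lambda>x. f (cis x))"
    using J int fpos by (intro integral_subset_le) auto
  also have "\<dots> = (LBINT x:{-pi..pi}. f (cis x))"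
    using integral_circle(2)[OF continuous_measurable_circle[OF f]] integrable_circle_continuous[OF f]
    by (intro set_borel_integral_eq_integral(2)[symmetric]) blast
  also have "\<dots> = 2 * pi * (LINT z|circle. f z)"
    using integral_circle(1)[OF continuous_measurable_circle[OF f]] by simp
  finally show ?thesis using assms by (simp add: field_simps)
qed

section \<open>The filter bank and the moment map\<close>

lemma mat_mult_vec: "mat z *v v = z *s v" for v :: "complex^'n"
  by (simp add: vec_eq_iff mult_vec_nth mat_nth if_distrib if_distribR cong: if_cong)

lemma mat_mult: "mat z ** M = (\<chi> i j. z * M $ i $ j)" for M :: "complex^'k^'n"
  by (simp add: vec_eq_iff mult_nth mat_nth if_distrib if_distribR cong: if_cong)

lemma mult_mat: "M ** mat z = (\<chi> i j. z * M $ i $ j)" for M :: "complex^'n^'k"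
  by (simp add: vec_eq_iff mult_nth mat_nth if_distrib if_distribR mult.commute cong: if_cong)

lemma continuous_on_mat [continuous_intros]:
  fixes f :: "'a::topological_space \<Rightarrow> complex"
  assumes "continuous_on S f"
  shows "continuous_on S (\<lambda>z. mat (f z) :: complex^'n^'n)"
  unfolding mat_def
proof (intro continuous_on_vec_lambda)
  show "continuous_on S (\<lambda>z. if i = j then f z else 0)" for i j :: 'n
    by (cases "i = j") (auto intro: assms)
qed

lemma circ_mult_cnj: "z \<in> circ \<Longrightarrow> z * cnj z = 1"
  by (simp add: complex_norm_square[symmetric])

lemma resolvent_invertible:
  assumes "stable_matrix A" "1 \<le> norm z"
  shows "invertible (mat z - cmat A)"
  unfolding invertible_iff_ker
proof (intro allI impI)
  fix v assume "(mat z - cmat A) *v v = 0"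
  then have "cmat A *v v = z *s v"
    by (simp add: matrix_vector_mult_diff_rdistrib mat_mult_vec)
  then show "v = 0" using assms unfolding stable_matrix_def by (meson not_le)
qed

text \<open>The members of \<open>cont_density_span\<close>, characterized without a decomposition into densities.\<close>

definition symbol :: "(complex \<Rightarrow> complex^'m^'m) \<Rightarrow> bool" where
  "symbol \<Phi> \<longleftrightarrow> continuous_on circ \<Phi> \<and>
     (\<forall>z\<in>circ. adj (\<Phi> z) = \<Phi> z) \<and> (\<forall>z\<in>circ. \<Phi> (cnj z) = conj_mat (\<Phi> z))"

lemma symbol_add: "symbol \<Phi> \<Longrightarrow> symbol \<Psi> \<Longrightarrow> symbol (\<lambda>z. \<Phi> z + \<Psi> z)"
  by (simp add: symbol_def adj_add conj_mat_add continuous_on_add)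

lemma symbol_scaleR: "symbol \<Phi> \<Longrightarrow> symbol (\<lambda>z. c *\<^sub>R \<Phi> z)"
  by (simp add: symbol_def adj_scaleR conj_mat_scaleR continuous_intros)

lemma transpose_zero [simp]: "transpose 0 = 0"
  by (simp add: transpose_def vec_eq_iff)

lemma symbol_const: "transpose L = L \<Longrightarrow> symbol (\<lambda>z. cmat L)"
  by (simp add: symbol_def adj_cmat)

lemma symbol_matrix_inv:
  assumes "symbol \<Phi>" "\<And>z. z \<in> circ \<Longrightarrow> invertible (\<Phi> z)"
  shows "symbol (\<lambda>z. matrix_inv (\<Phi> z))"
  using assms continuous_on_matrix_inv[of circ \<Phi>]
  by (simp add: symbol_def conj_mat_matrix_inv adj_matrix_inv(2)[symmetric])

lemma symbol_AE_I:
  assumes "continuous_on circ \<Phi>" "AE z in circle. adj (\<Phi> z) = \<Phi> z"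
    "AE z in circle. \<Phi> (cnj z) = conj_mat (\<Phi> z)"
  shows "symbol \<Phi>"
  unfolding symbol_def
proof (intro conjI ballI)
  have c: "continuous_on circ (\<lambda>z. \<Phi> (cnj z))"
    by (rule continuous_on_compose2[OF assms(1)]) (auto intro!: continuous_intros)
  have "adj (\<Phi> z) - \<Phi> z \<in> {0}" if "z \<in> circ" for z
    using assms(2) that
    by (intro AE_circle_imp_all[of "\<lambda>z. adj (\<Phi> z) - \<Phi> z"]) (auto intro!: continuous_intros assms(1))
  then show "adj (\<Phi> z) = \<Phi> z" if "z \<in> circ" for z using that by simp
  have "\<Phi> (cnj z) - conj_mat (\<Phi> z) \<in> {0}" if "z \<in> circ" for z
    using assms(3) that
    by (intro AE_circle_imp_all[of "\<lambda>z. \<Phi> (cnj z) - conj_mat (\<Phi> z)"])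
       (auto intro!: continuous_intros assms(1) c)
  then show "\<Phi> (cnj z) = conj_mat (\<Phi> z)" if "z \<in> circ" for z using that by simp
qed (fact assms(1))

lemma symbol_spectral_density:
  assumes "symbol \<Phi>" "\<And>z. z \<in> circ \<Longrightarrow> pos_semidef (\<Phi> z)"
  shows "spectral_density \<Phi>"
  using assms by (auto simp: spectral_density_def symbol_def integrable_circle_continuous intro: AE_I2)

text \<open>A continuous Hermitian symbol is the difference of the densities \<open>\<Phi> + c I\<close> and \<open>c I\<close>,
  for large \<open>c\<close>.\<close>

lemma cont_density_span_iff: "\<Phi> \<in> cont_density_span \<longleftrightarrow> symbol \<Phi>"
proof
  assume "\<Phi> \<in> cont_density_span"
  then obtain k :: nat and c F where F: "\<And>i. i < k \<Longrightarrow> continuous_on circ (F i) \<and> spectral_density (F i)"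
    and \<Phi>: "\<Phi> = (\<lambda>z. \<Sum>i<k. c i *\<^sub>R F i z)"
    unfolding cont_density_span_def by blast
  have F': "symbol (F i)" if "i < k" for i
  proof (rule symbol_AE_I)
    show "continuous_on circ (F i)" using F[OF that] by simp
    show "AE z in circle. adj (F i z) = F i z" "AE z in circle. F i (cnj z) = conj_mat (F i z)"
      using F[OF that] by (auto simp: spectral_density_def pos_semidef_def elim: AE_mp)
  qed
  have "symbol (\<lambda>z. \<Sum>i<j. c i *\<^sub>R F i z)" if "j \<le> k" for j
    using that
  proof (induction j)
    case 0
    show ?case using symbol_const[of 0] by simp
  next
    case (Suc j)
    then show ?case using F'[of j] by (simp add: symbol_add symbol_scaleR)
  qed
  then show "symbol \<Phi>" by (simp add: \<Phi>)
next
  assume s: "symbol \<Phi>"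
  then obtain K where K: "K > 0" "\<And>z. z \<in> circ \<Longrightarrow> norm (\<Phi> z) \<le> K"
    using continuous_bounded_circle[of \<Phi>] by (auto simp: symbol_def)
  define F where "F i = (if i = 0 then (\<lambda>z. \<Phi> z + K *\<^sub>R mat 1) else (\<lambda>z. mat 1))" for i :: nat
  define c where "c i = (if i = 0 then 1 else - K)" for i :: nat
  have 1: "symbol (\<lambda>z. mat 1 :: complex^'a^'a)"
    using symbol_const[of "mat 1"] by simp
  then have sym: "symbol (F i)" for i
    using symbol_add[OF s symbol_scaleR[OF 1, of K]] by (simp add: F_def)
  have "pos_semidef (F i z)" if "z \<in> circ" for i z
  proof (cases "i = 0")
    case True
    have "- (x \<bullet> (\<Phi> z *v x)) \<le> K * (x \<bullet> x)" for x
      using form_bound[of x "\<Phi> z"] mult_right_mono[OF K(2)[OF that], of "x \<bullet> x"] by simp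
    then have "0 \<le> x \<bullet> (\<Phi> z *v x) + K * (x \<bullet> x)" for x
      by (simp add: minus_le_iff[symmetric] algebra_simps add.commute add_increasing2)
         (metis add.commute diff_ge_0_iff_ge diff_minus_eq_add)
    then show ?thesis
      using True s that
      by (simp add: F_def pos_semidef_def adj_add adj_scaleR symbol_def
          matrix_vector_mult_add_rdistrib scaleR_mult_vec inner_add)
  next
    case False
    then show ?thesis by (simp add: F_def pos_def_imp_semidef pos_def_mat_1)
  qed
  then have "continuous_on circ (F i) \<and> spectral_density (F i)" for i
    using sym[of i] by (auto intro: symbol_spectral_density simp: symbol_def[of "F i"])
  moreover have "\<Phi> = (\<lambda>z. \<Sum>i<2. c i *\<^sub>R F i z)"
    by (simp add: F_def c_def numeral_2_eq_2)
  ultimately show "\<Phi> \<in> cont_density_span"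
    unfolding cont_density_span_def by blast
qed

lemma integral_matrix_nth:
  fixes f :: "complex \<Rightarrow> complex^'n^'k"
  assumes "integrable circle f"
  shows "(LINT z|circle. f z) $ i $ j = (LINT z|circle. f z $ i $ j)"
  by (rule integral_bounded_linear[OF _ assms, symmetric])
     (rule bounded_linear_compose[OF bounded_linear_vec_nth bounded_linear_vec_nth])

locale stable_filter =
  fixes A :: "real^'n^'n" and B :: "real^'m^'n"
  assumes stable: "stable_matrix A"
begin

abbreviation "G \<equiv> transfer_fun A B"

abbreviation \<Gamma> :: "(complex \<Rightarrow> complex^'m^'m) \<Rightarrow> complex^'n^'n" where "\<Gamma> \<equiv> Gamma_op A B"

lemma resolvent_works:
  assumes "z \<in> circ"
  shows "invertible (mat z - cmat A)" "(mat z - cmat A) ** G z = cmat B"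
proof -
  show inv: "invertible (mat z - cmat A)" using resolvent_invertible[OF stable] assms by simp
  show "(mat z - cmat A) ** G z = cmat B"
    by (simp add: transfer_fun_def matrix_mul_assoc matrix_inv_works[OF inv])
qed

lemma continuous_resolvent: "continuous_on circ (\<lambda>z. matrix_inv (mat z - cmat A))"
  by (intro continuous_on_matrix_inv continuous_intros resolvent_works)

lemma continuous_G: "continuous_on circ G"
  unfolding transfer_fun_def by (intro continuous_intros continuous_resolvent)

lemma measurable_G [measurable]: "G \<in> borel_measurable circle"
  by (rule continuous_measurable_circle[OF continuous_G])

lemma G_cnj: "z \<in> circ \<Longrightarrow> G (cnj z) = conj_mat (G z)"
  using resolvent_works(1)
  by (simp add: transfer_fun_def conj_mat_mult conj_mat_matrix_inv conj_mat_diff)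

lemma G_bounded: obtains K where "K > 0" "\<And>z. z \<in> circ \<Longrightarrow> norm (G z) \<le> K"
  using continuous_bounded_circle[OF continuous_G] by blast

definition gain :: real where
  "gain = 1 + (SUP z\<in>circ. norm (G z))\<^sup>2"

lemma gain_pos: "0 < gain"
  by (simp add: gain_def add_pos_nonneg)

lemma norm_sandwich_le:
  fixes X :: "complex^'l^'k"
  assumes z: "z \<in> circ" and P: "norm P \<le> norm (G z)" and Q: "norm Q \<le> norm (G z)"
  shows "norm (P ** X ** Q) \<le> gain * norm X"
proof -
  define K where "K = (SUP z\<in>circ. norm (G z))"
  have "bdd_above ((\<lambda>z. norm (G z)) ` circ)"
    using G_bounded by (metis bdd_aboveI2)
  then have GK: "norm (G z) \<le> K" unfolding K_def using z by (rule cSUP_upper[rotated])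
  have "norm (P ** X ** Q) \<le> norm P * norm X * norm Q" by (rule norm_mult3_le)
  also have "\<dots> \<le> K * norm X * K"
    using P Q GK order_trans[OF norm_ge_zero GK] by (intro mult_mono mult_nonneg_nonneg) auto
  also have "\<dots> \<le> gain * norm X"
    by (simp add: gain_def K_def[symmetric] power2_eq_square algebra_simps)
  finally show ?thesis .
qed

lemma G_lipschitz:
  obtains C where "C > 0" "\<And>z w. z \<in> circ \<Longrightarrow> w \<in> circ \<Longrightarrow> norm (G z - G w) \<le> C * norm (z - w)"
proof -
  obtain K where K: "K > 0" "\<And>z. z \<in> circ \<Longrightarrow> norm (matrix_inv (mat z - cmat A)) \<le> K"
    using continuous_bounded_circle[OF continuous_resolvent] by blast
  obtain K' where K': "K' > 0" "\<And>z. z \<in> circ \<Longrightarrow> norm (G z) \<le> K'"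
    using G_bounded by blast
  define c where "c = norm (mat 1 :: complex^'n^'n)"
  have m: "norm (mat x :: complex^'n^'n) = norm x * c" for x
  proof -
    have "norm (mat x :: complex^'n^'n) = L2_set (\<lambda>i::'n. norm x * norm (mat 1 $ i :: complex^'n)) UNIV"
      unfolding norm_vec_def[of "mat x :: complex^'n^'n"]
    proof (rule L2_set_cong)
      fix i :: 'n
      have "norm (mat x $ i :: complex^'n) = L2_set (\<lambda>j. norm x * norm (mat 1 $ i $ j :: complex)) UNIV"
        unfolding norm_vec_def[of "mat x $ i :: complex^'n"] by (rule L2_set_cong) (auto simp: mat_nth)
      then show "norm (mat x $ i :: complex^'n) = norm x * norm (mat 1 $ i :: complex^'n)"
        by (simp add: L2_set_right_distrib norm_vec_def)
    qed simp
    also have "\<dots> = norm x * c" by (simp add: L2_set_right_distrib[symmetric] norm_vec_def c_def)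
    finally show ?thesis .
  qed
  have "norm (G z - G w) \<le> (K * c * K' + 1) * norm (z - w)" if "z \<in> circ" "w \<in> circ" for z w
  proof -
    let ?R = "matrix_inv (mat z - cmat A)"
    have "?R ** (mat w - cmat A) ** G w = ?R ** cmat B"
      using resolvent_works(2)[OF that(2)] by (simp add: matrix_mul_assoc[symmetric])
    moreover have "?R ** (mat z - cmat A) ** G w = G w"
      using matrix_inv_works[OF resolvent_works(1)[OF that(1)]] by simp
    moreover have "?R ** (mat (w - z)) ** G w
        = ?R ** (mat w - cmat A) ** G w - ?R ** (mat z - cmat A) ** G w"
    proof -
      have "(mat (w - z) :: complex^'n^'n) = (mat w - cmat A) - (mat z - cmat A)"
        by (simp add: vec_eq_iff mat_nth)
      then show ?thesis by (simp only: mult_diff_left mult_diff_right)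
    qed
    ultimately have "G z - G w = ?R ** mat (w - z) ** G w"
      by (simp add: transfer_fun_def)
    also have "norm \<dots> \<le> norm ?R * norm (mat (w - z) :: complex^'n^'n) * norm (G w)"
      by (rule norm_mult3_le)
    also have "\<dots> \<le> K * (norm (w - z) * c) * K'"
      unfolding m using K K' that by (intro mult_mono mult_nonneg_nonneg) (auto simp: c_def)
    also have "\<dots> = (K * c * K') * norm (z - w)"
      by (simp add: norm_minus_commute mult_ac)
    also have "\<dots> \<le> (K * c * K' + 1) * norm (z - w)"
      by (intro mult_right_mono) auto
    finally show ?thesis .
  qed
  moreover have "K * c * K' + 1 > 0" using K(1) K'(1) by (simp add: c_def add_nonneg_pos)
  ultimately show ?thesis using that by blast
qed

subsection \<open>The moment map and its adjoint\<close>

abbreviation adjoint_op :: "real^'n^'n \<Rightarrow> complex \<Rightarrow> complex^'m^'m" where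
  "adjoint_op L z \<equiv> adj (G z) ** cmat L ** G z"

lemma measurable_moment:
  assumes [measurable]: "\<Phi> \<in> borel_measurable circle"
  shows "(\<lambda>z. G z ** \<Phi> z ** adj (G z)) \<in> borel_measurable circle"
  by measurable

lemma integrable_moment:
  assumes "integrable circle \<Phi>"
  shows "integrable circle (\<lambda>z. G z ** \<Phi> z ** adj (G z))"
proof -
  have [measurable]: "\<Phi> \<in> borel_measurable circle" using assms by simp
  show ?thesis
  proof (rule Bochner_Integration.integrable_bound)
    show "integrable circle (\<lambda>z. gain * norm (\<Phi> z))" using assms by simp
    show "AE z in circle. norm (G z ** \<Phi> z ** adj (G z)) \<le> norm (gain * norm (\<Phi> z))"
      using norm_sandwich_le[of _ "G _" "adj (G _)"] gain_pos by (intro AE_I2) (simp add: abs_mult)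
  qed measurable
qed

lemma norm_adjoint_op_le: "z \<in> circ \<Longrightarrow> norm (adjoint_op L z) \<le> gain * norm L"
  using norm_sandwich_le[of z "adj (G z)" "G z" "cmat L"] by simp

lemma moment_norm_le:
  assumes \<Phi>: "continuous_on circ \<Phi>" and c: "\<And>z. z \<in> circ \<Longrightarrow> norm (\<Phi> z) \<le> c"
  shows "norm (\<Gamma> \<Phi>) \<le> gain * c"
proof -
  have "norm (\<Gamma> \<Phi>) \<le> (LINT z|circle. norm (G z ** \<Phi> z ** adj (G z)))"
    unfolding Gamma_op_def by (rule integral_norm_bound)
  also have "\<dots> \<le> (LINT z|circle. gain * c)"
  proof (rule integral_circle_mono)
    show "integrable circle (\<lambda>z. norm (G z ** \<Phi> z ** adj (G z)))"
      by (intro integrable_circle_continuous continuous_intros continuous_G \<Phi>)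
    fix z assume z: "z \<in> circ"
    have "norm (G z ** \<Phi> z ** adj (G z)) \<le> gain * norm (\<Phi> z)"
      by (rule norm_sandwich_le[OF z]) simp_all
    also have "\<dots> \<le> gain * c" using c[OF z] gain_pos by (intro mult_left_mono) auto
    finally show "norm (G z ** \<Phi> z ** adj (G z)) \<le> gain * c" .
  qed simp
  finally show ?thesis by simp
qed

text \<open>The adjoint of the moment map with respect to the real inner products is \<open>L \<mapsto> G\<^sup>* L G\<close>.\<close>

lemma moment_pairing:
  assumes "integrable circle \<Phi>"
  shows "cmat L \<bullet> \<Gamma> \<Phi> = (LINT z|circle. adjoint_op L z \<bullet> \<Phi> z)"
proof -
  have "cmat L \<bullet> \<Gamma> \<Phi> = (LINT z|circle. cmat L \<bullet> (G z ** \<Phi> z ** adj (G z)))"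
    unfolding Gamma_op_def by (rule integral_inner_right[symmetric]) (rule integrable_moment[OF assms])
  also have "\<dots> = (LINT z|circle. adjoint_op L z \<bullet> \<Phi> z)"
    by (intro integral_circle_cong)
       (simp add: inner_mult_right[of "cmat L" "G _"] inner_mult_left[of "adj (G _)"]
         matrix_mul_assoc[symmetric])
  finally show ?thesis .
qed

lemma moment_add:
  assumes "integrable circle \<Phi>" "integrable circle \<Psi>"
  shows "\<Gamma> (\<lambda>z. \<Phi> z + \<Psi> z) = \<Gamma> \<Phi> + \<Gamma> \<Psi>"
  unfolding Gamma_op_def matrix_add_ldistrib matrix_add_rdistrib
  by (intro Bochner_Integration.integral_add integrable_moment assms)

lemma moment_scaleR: "\<Gamma> (\<lambda>z. c *\<^sub>R \<Phi> z) = c *\<^sub>R \<Gamma> \<Phi>"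
  unfolding Gamma_op_def by (simp add: mult_scaleR_left mult_scaleR_right)

lemma moment_cong_AE:
  assumes "\<Phi> \<in> borel_measurable circle" "\<Psi> \<in> borel_measurable circle" "AE z in circle. \<Phi> z = \<Psi> z"
  shows "\<Gamma> \<Phi> = \<Gamma> \<Psi>"
  unfolding Gamma_op_def
  by (rule integral_cong_AE) (use assms in \<open>auto intro: measurable_moment elim: AE_mp\<close>)

lemma symbol_integrable: "symbol \<Phi> \<Longrightarrow> integrable circle \<Phi>"
  by (simp add: symbol_def integrable_circle_continuous)

lemma symbol_adjoint_op:
  assumes "transpose L = L"
  shows "symbol (adjoint_op L)"
  unfolding symbol_def
proof (intro conjI ballI)
  show "continuous_on circ (adjoint_op L)" by (intro continuous_intros continuous_G)
  show "adj (adjoint_op L z) = adjoint_op L z" for z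
    by (simp add: adj_mult adj_cmat assms matrix_mul_assoc)
  show "adjoint_op L (cnj z) = conj_mat (adjoint_op L z)" if "z \<in> circ" for z
    using that by (simp add: G_cnj conj_mat_mult conj_mat_adj)
qed

lemma moment_real:
  assumes "symbol \<Phi>"
  obtains L where "cmat L = \<Gamma> \<Phi>" "transpose L = L"
proof -
  define f where "f z = G z ** \<Phi> z ** adj (G z)" for z
  have f: "integrable circle f" unfolding f_def by (rule integrable_moment[OF symbol_integrable[OF assms]])
  have "\<Gamma> \<Phi> = (LINT z|circle. f (cnj z))"
    unfolding Gamma_op_def f_def[symmetric]
    using f by (intro integral_circle_cnj[symmetric]) auto
  also have "\<dots> = (LINT z|circle. conj_mat (f z))"
    using assms by (intro integral_circle_cong)
      (simp add: f_def G_cnj symbol_def conj_mat_mult conj_mat_adj)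
  also have "\<dots> = conj_mat (\<Gamma> \<Phi>)"
    unfolding Gamma_op_def f_def[symmetric] by (rule integral_bounded_linear[OF bounded_linear_conj_mat f])
  finally have "\<Gamma> \<Phi> $ i $ j = cnj (\<Gamma> \<Phi> $ i $ j)" for i j
    by (metis conj_mat_nth)
  then have "Im (\<Gamma> \<Phi> $ i $ j) = Im (cnj (\<Gamma> \<Phi> $ i $ j))" for i j by (rule arg_cong)
  then have re: "\<Gamma> \<Phi> = cmat (\<chi> i j. Re (\<Gamma> \<Phi> $ i $ j))"
    by (simp add: vec_eq_iff complex_eq_iff)
  have "adj (\<Gamma> \<Phi>) = (LINT z|circle. adj (f z))"
    unfolding Gamma_op_def f_def[symmetric] by (rule integral_bounded_linear[OF bounded_linear_adj f, symmetric])
  also have "\<dots> = (LINT z|circle. f z)"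
    using assms by (intro integral_circle_cong) (simp add: f_def adj_mult matrix_mul_assoc symbol_def)
  finally have "adj (\<Gamma> \<Phi>) = \<Gamma> \<Phi>" by (simp add: Gamma_op_def f_def)
  then show ?thesis using that re by (metis adj_cmat cmat_inject)
qed

lemma range_Gamma_iff: "L \<in> range_Gamma A B \<longleftrightarrow> (\<exists>\<Phi>. symbol \<Phi> \<and> cmat L = \<Gamma> \<Phi>)"
  by (auto simp: range_Gamma_def cont_density_span_iff)

lemma range_Gamma_symmetric: "L \<in> range_Gamma A B \<Longrightarrow> transpose L = L"
  unfolding range_Gamma_iff using moment_real by (metis cmat_inject)

lemma subspace_range_Gamma: "subspace (range_Gamma A B)"
  unfolding subspace_def
proof (intro conjI ballI allI)
  have "symbol (\<lambda>z. 0 :: complex^'m^'m)" using symbol_const[of 0] by simp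
  moreover have "\<Gamma> (\<lambda>z. 0) = 0" using moment_scaleR[of 0] by simp
  ultimately show "0 \<in> range_Gamma A B" unfolding range_Gamma_iff by (metis cmat_zero)
  show "x + y \<in> range_Gamma A B" if "x \<in> range_Gamma A B" "y \<in> range_Gamma A B" for x y
  proof -
    from that obtain \<Phi> \<Psi> where "symbol \<Phi>" "cmat x = \<Gamma> \<Phi>" "symbol \<Psi>" "cmat y = \<Gamma> \<Psi>"
      unfolding range_Gamma_iff by blast
    then have "symbol (\<lambda>z. \<Phi> z + \<Psi> z)" "cmat (x + y) = \<Gamma> (\<lambda>z. \<Phi> z + \<Psi> z)"
      by (simp_all add: symbol_add cmat_add moment_add symbol_integrable)
    then show ?thesis unfolding range_Gamma_iff by blast
  qed
  show "c *\<^sub>R x \<in> range_Gamma A B" if "x \<in> range_Gamma A B" for x c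
  proof -
    from that obtain \<Phi> where "symbol \<Phi>" "cmat x = \<Gamma> \<Phi>"
      unfolding range_Gamma_iff by blast
    then have "symbol (\<lambda>z. c *\<^sub>R \<Phi> z)" "cmat (c *\<^sub>R x) = \<Gamma> (\<lambda>z. c *\<^sub>R \<Phi> z)"
      by (simp_all add: symbol_scaleR cmat_scaleR moment_scaleR)
    then show ?thesis unfolding range_Gamma_iff by blast
  qed
qed

text \<open>\<open>L = \<Gamma> \<Phi>\<close> is orthogonal to the kernel of the adjoint, since
  \<open>\<bar>L\<bar>\<^sup>2 = \<integral> (G\<^sup>* L G) \<bullet> \<Phi>\<close>.\<close>

lemma adjoint_op_injective_AE:
  assumes "L \<in> range_Gamma A B" "AE z in circle. adjoint_op L z = 0"
  shows "L = 0"
proof -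
  obtain \<Phi> where \<Phi>: "symbol \<Phi>" "cmat L = \<Gamma> \<Phi>" using assms(1) range_Gamma_iff by blast
  have "cmat L \<bullet> cmat L = (LINT z|circle. adjoint_op L z \<bullet> \<Phi> z)"
    using moment_pairing[OF symbol_integrable[OF \<Phi>(1)], of L] \<Phi>(2) by simp
  also have "\<dots> = 0"
    using assms(2) by (intro integral_eq_zero_AE) (auto elim: AE_mp)
  finally show ?thesis by (simp add: inner_cmat)
qed

lemma adjoint_op_add: "adjoint_op (L + M) z = adjoint_op L z + adjoint_op M z"
  by (simp add: cmat_add matrix_add_ldistrib matrix_add_rdistrib)

lemma adjoint_op_diff: "adjoint_op (L - M) z = adjoint_op L z - adjoint_op M z"
  by (simp add: cmat_diff mult_diff_left mult_diff_right)

lemma adjoint_op_scaleR: "adjoint_op (c *\<^sub>R L) z = c *\<^sub>R adjoint_op L z"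
  by (simp add: cmat_scaleR mult_scaleR_left mult_scaleR_right)

text \<open>The linear map \<open>L \<mapsto> \<Gamma> (G\<^sup>* L G)\<close> is injective on the range of \<open>\<Gamma>\<close>, so that there the size
  of \<open>L\<close> is controlled by \<open>G\<^sup>* L G\<close>.\<close>

lemma norm_le_integral_adjoint_op:
  obtains c where "c > 0"
    "\<And>L. L \<in> range_Gamma A B \<Longrightarrow> norm L \<le> c * (LINT z|circle. norm (adjoint_op L z))"
proof -
  define T where "T L = \<Gamma> (adjoint_op L)" for L
  have int: "integrable circle (adjoint_op L)" for L
    by (intro integrable_circle_continuous continuous_intros continuous_G)
  have "linear T"
  proof (rule linearI)
    show "T (L + M) = T L + T M" for L M
      unfolding T_def adjoint_op_add by (rule moment_add[OF int int])
    show "T (c *\<^sub>R L) = c *\<^sub>R T L" for c L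
      unfolding T_def adjoint_op_scaleR by (rule moment_scaleR)
  qed
  then have T: "bounded_linear T" by (simp add: linear_conv_bounded_linear)
  have "L = 0" if L: "L \<in> range_Gamma A B" and 0: "T L = 0" for L
  proof (rule adjoint_op_injective_AE[OF L])
    have "(LINT z|circle. adjoint_op L z \<bullet> adjoint_op L z) = 0"
      using moment_pairing[OF int, of L L] 0 by (simp add: T_def)
    then have "AE z in circle. adjoint_op L z \<bullet> adjoint_op L z = 0"
      by (subst (asm) integral_nonneg_eq_0_iff_AE)
         (auto intro!: integrable_circle_continuous continuous_intros continuous_G)
    then show "AE z in circle. adjoint_op L z = 0" by simp
  qed
  then obtain e where e: "e > 0" "\<And>L. L \<in> range_Gamma A B \<Longrightarrow> e * norm L \<le> norm (T L)"
    using injective_imp_isometric[OF closed_subspace[OF subspace_range_Gamma] subspace_range_Gamma T]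
    by blast
  have TL: "norm (T L) \<le> gain * (LINT z|circle. norm (adjoint_op L z))" for L
  proof -
    have "norm (T L) \<le> (LINT z|circle. norm (G z ** adjoint_op L z ** adj (G z)))"
      unfolding T_def Gamma_op_def by (rule integral_norm_bound)
    also have "\<dots> \<le> (LINT z|circle. gain * norm (adjoint_op L z))"
    proof (rule integral_circle_mono)
      show "integrable circle (\<lambda>z. norm (G z ** adjoint_op L z ** adj (G z)))"
        "integrable circle (\<lambda>z. gain * norm (adjoint_op L z))"
        by (intro integrable_circle_continuous continuous_intros continuous_G)+
      show "norm (G z ** adjoint_op L z ** adj (G z)) \<le> gain * norm (adjoint_op L z)" if "z \<in> circ" for z
        by (rule norm_sandwich_le[OF that]) simp_all
    qed
    finally show ?thesis by simp
  qed
  have "norm L \<le> (gain / e) * (LINT z|circle. norm (adjoint_op L z))" if "L \<in> range_Gamma A B" for L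
    using e(2)[OF that] TL[of L] e(1) by (simp add: pos_le_divide_eq mult.commute)
  moreover have "gain / e > 0" using gain_pos e by simp
  ultimately show ?thesis using that by blast
qed

end

section \<open>A density with unit moment\<close>

subsection \<open>Resolvents of stable matrices have mean zero\<close>

lemma integral_circle_cauchy:
  fixes f :: "complex \<Rightarrow> complex"
  assumes cont: "continuous_on (cball 0 1) f" and hol: "f holomorphic_on ball 0 1"
  shows "(LINT z|circle. z * f z) = 0"
proof -
  let ?g = "part_circlepath 0 1 (-pi) pi"
  have "(f has_contour_integral 0) ?g"
  proof (rule Cauchy_theorem_convex[OF cont, of "{}"])
    show "f field_differentiable at x" if "x \<in> interior (cball 0 1) - {}" for x
      using hol that by (auto simp: holomorphic_on_open field_differentiable_def)
    show "path_image ?g \<subseteq> cball 0 1"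
      using path_image_part_circlepath_subset[of "-pi" pi 1 0] by auto
    show "pathfinish ?g = pathstart ?g"
      by (simp add: exp_minus)
  qed auto
  then have "((\<lambda>t. f (cis t) * \<i> * cis t) has_integral 0) {-pi..pi}"
    using has_contour_integral_part_circlepath_iff[of "-pi" pi f 0 0 1] by simp
  then have "((\<lambda>t. (- \<i>) * (f (cis t) * \<i> * cis t)) has_integral (- \<i>) * 0) {-pi..pi}"
    by (rule has_integral_mult_right)
  then have I: "((\<lambda>t. cis t * f (cis t)) has_integral 0) {-pi..pi}"
    by (simp add: mult_ac)
  have c: "continuous_on circ (\<lambda>z. z * f z)"
    by (intro continuous_intros continuous_on_subset[OF cont]) auto
  have "(LINT z|circle. z * f z) = (1 / (2 * pi)) *\<^sub>R (LBINT t:{-pi..pi}. cis t * f (cis t))"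
    by (rule integral_circle(1)[OF continuous_measurable_circle[OF c]])
  also have "(LBINT t:{-pi..pi}. cis t * f (cis t)) = integral {-pi..pi} (\<lambda>t. cis t * f (cis t))"
    using integral_circle(2)[OF continuous_measurable_circle[OF c]] integrable_circle_continuous[OF c]
    by (intro set_borel_integral_eq_integral(2)) blast
  also have "\<dots> = 0" using I by (rule integral_unique)
  finally show ?thesis by simp
qed

text \<open>In the variable \<open>w = 1 / z\<close>, which is the conjugate of \<open>z\<close> on the circle, the integrand is
  \<open>w (I - w F)\<^sup>-\<^sup>1 F\<close>. It is analytic in the disc and vanishes at the origin.\<close>

lemma integral_resolvent_mult:
  fixes F :: "real^'n^'n"
  assumes inv: "\<And>z. 1 \<le> norm z \<Longrightarrow> invertible (mat z - cmat F)"
  shows "(LINT z|circle. matrix_inv (mat z - cmat F) ** cmat F) = 0"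
proof -
  define N where "N w = mat 1 - mat w ** cmat F" for w
  have N: "invertible (N w)" if "norm w \<le> 1" for w
  proof (cases "w = 0")
    case True
    have "N w ** mat 1 = mat 1" using True by (simp add: N_def vec_eq_iff mat_mult mat_nth)
    then show ?thesis by (rule matrix_inv_eqI)
  next
    case False
    then have "1 \<le> norm (inverse w)" using that
      by (simp only: norm_inverse one_le_inverse_iff) simp
    then have "invertible (mat (inverse w) - cmat F)" by (rule inv)
    moreover have "N w = mat w ** (mat (inverse w) - cmat F)"
      using False by (simp add: N_def vec_eq_iff mat_mult mat_nth right_diff_distrib)
    moreover have "(mat w :: complex^'n^'n) ** mat (inverse w) = mat 1"
      using False by (simp add: vec_eq_iff mat_mult mat_nth)
    ultimately show ?thesis using matrix_inv_eqI(1) invertible_mult by metis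
  qed
  define f where "f w = matrix_inv (N w) ** cmat F" for w
  have cN: "continuous_on S N" for S unfolding N_def by (intro continuous_intros)
  have cf: "continuous_on (cball 0 1) f" unfolding f_def
    by (intro continuous_intros continuous_on_matrix_inv cN N) auto
  have hf: "(\<lambda>w. f w $ i $ j) holomorphic_on ball 0 1" for i j
  proof -
    have hN: "(\<lambda>w. if l = k then c else N w $ i $ l) holomorphic_on ball 0 1" for l k i c
      by (cases "l = k") (auto simp: N_def mat_mult intro!: holomorphic_intros)
    have hN': "(\<lambda>w. N w $ i $ l) holomorphic_on ball 0 1" for l i
      by (auto simp: N_def mat_mult intro!: holomorphic_intros)
    have "(\<lambda>w. \<Sum>k\<in>UNIV. det (\<chi> i' l. if l = i then (if i' = k then 1 else 0) else N w $ i' $ l)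
        / det (N w) * cmat F $ k $ j) holomorphic_on ball 0 1"
    proof (intro holomorphic_intros)
      show "(\<lambda>w. det (\<chi> i' l. if l = i then (if i' = k then 1 else 0) else N w $ i' $ l))
          holomorphic_on ball 0 1" for k
        unfolding det_def by (intro holomorphic_intros) (simp add: hN)
      show "(\<lambda>w. det (N w)) holomorphic_on ball 0 1"
        unfolding det_def by (intro holomorphic_intros hN')
      show "det (N w) \<noteq> 0" if "w \<in> ball 0 1" for w
        using N[of w] that invertible_det_nz by auto
    qed
    then show ?thesis
      by (rule holomorphic_transform) (simp add: f_def mult_nth matrix_inv_cramer[OF N])
  qed
  have eq: "matrix_inv (mat z - cmat F) ** cmat F = mat (cnj z) ** f (cnj z)" if "z \<in> circ" for z
  proof -
    have 1: "cnj z * z = 1" using circ_mult_cnj[OF that] by (simp add: mult.commute)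
    have "mat z - cmat F = mat z ** N (cnj z)"
      using 1 by (simp add: N_def vec_eq_iff mat_mult mat_nth right_diff_distrib mult.assoc[symmetric] mult.commute)
    moreover have "invertible (N (cnj z))" by (rule N) (use that in simp)
    moreover have zz: "(mat z :: complex^'n^'n) ** mat (cnj z) = mat 1"
      using 1 by (simp add: vec_eq_iff mat_mult mat_nth mult.commute)
    ultimately have "matrix_inv (mat z - cmat F) = matrix_inv (N (cnj z)) ** mat (cnj z)"
      using matrix_inv_mult matrix_inv_eqI[OF zz] by metis
    also have "\<dots> = mat (cnj z) ** matrix_inv (N (cnj z))" by (simp add: mat_mult mult_mat)
    finally show ?thesis by (simp add: f_def matrix_mul_assoc)
  qed
  have cm: "continuous_on circ (\<lambda>z. mat z ** f z)"
    by (intro continuous_intros continuous_on_subset[OF cf]) auto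
  have "(LINT z|circle. matrix_inv (mat z - cmat F) ** cmat F) = (LINT z|circle. mat (cnj z) ** f (cnj z))"
    by (intro integral_circle_cong eq)
  also have "\<dots> = (LINT z|circle. mat z ** f z)"
    by (rule integral_circle_cnj) (rule continuous_measurable_circle[OF cm])
  finally have eqI: "(LINT z|circle. matrix_inv (mat z - cmat F) ** cmat F) = (LINT z|circle. mat z ** f z)" .
  have "(LINT z|circle. mat z ** f z) $ i $ j = 0" for i j
  proof -
    have "(LINT z|circle. mat z ** f z) $ i $ j = (LINT z|circle. z * f z $ i $ j)"
      by (subst integral_matrix_nth[OF integrable_circle_continuous[OF cm]]) (simp add: mat_mult)
    also have "\<dots> = 0"
      by (rule integral_circle_cauchy[OF _ hf]) (intro continuous_intros cf)
    finally show ?thesis .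
  qed
  then show ?thesis unfolding eqI by (simp add: vec_eq_iff)
qed

text \<open>On the circle, \<open>I - F F\<^sup>T = N N\<^sup>* + F N\<^sup>* + N F\<^sup>T\<close> for \<open>N = z I - F\<close>; after multiplication by
  \<open>N\<^sup>-\<^sup>1\<close> and its adjoint, the last two terms have mean zero.\<close>

lemma integral_resolvent_lyapunov:
  fixes F :: "real^'n^'n"
  assumes inv: "\<And>z. 1 \<le> norm z \<Longrightarrow> invertible (mat z - cmat F)"
  shows "(LINT z|circle. matrix_inv (mat z - cmat F) ** cmat (mat 1 - F ** transpose F)
    ** adj (matrix_inv (mat z - cmat F))) = mat 1"
proof -
  define R where "R z = matrix_inv (mat z - cmat F)" for z
  have cR: "continuous_on circ R"
    unfolding R_def by (intro continuous_on_matrix_inv continuous_intros inv) simp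
  have eq: "R z ** cmat (mat 1 - F ** transpose F) ** adj (R z)
      = mat 1 + R z ** cmat F + adj (R z ** cmat F)" if z: "z \<in> circ" for z
  proof -
    define N where "N = mat z - cmat F"
    have "invertible N" unfolding N_def by (rule inv) (use z in simp)
    then have RN: "R z ** N = mat 1" by (simp add: R_def N_def matrix_inv_works)
    then have NR: "adj N ** adj (R z) = mat 1" by (simp add: adj_mult[symmetric])
    have zz: "(mat z :: complex^'n^'n) ** mat (cnj z) = mat 1"
      using circ_mult_cnj[OF z] by (simp add: vec_eq_iff mat_mult mat_nth)
    have com: "mat (cnj z) ** cmat F = cmat F ** mat (cnj z)"
      by (simp add: mat_mult mult_mat)
    have "cmat (mat 1 - F ** transpose F) = N ** adj N + cmat F ** adj N + N ** adj (cmat F)"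
      by (simp add: N_def adj_diff mult_diff_left mult_diff_right zz cmat_diff cmat_mult adj_cmat)
    then have "R z ** cmat (mat 1 - F ** transpose F) ** adj (R z)
        = (R z ** N) ** (adj N ** adj (R z)) + R z ** cmat F ** (adj N ** adj (R z))
          + (R z ** N) ** adj (cmat F) ** adj (R z)"
      by (simp only: matrix_add_ldistrib matrix_add_rdistrib matrix_mul_assoc)
    then show ?thesis by (simp add: RN NR adj_mult)
  qed
  have i1: "integrable circle (\<lambda>z. R z ** cmat F)"
    by (intro integrable_circle_continuous continuous_intros cR)
  have "(LINT z|circle. R z ** cmat (mat 1 - F ** transpose F) ** adj (R z))
      = (LINT z|circle. mat 1 + R z ** cmat F + adj (R z ** cmat F))"
    by (intro integral_circle_cong eq)
  also have "\<dots> = mat 1 + (LINT z|circle. R z ** cmat F) + adj (LINT z|circle. R z ** cmat F)"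
    using i1 integrable_bounded_linear[OF bounded_linear_adj i1]
    by (simp add: Bochner_Integration.integral_add integral_bounded_linear[OF bounded_linear_adj])
  also have "\<dots> = mat 1" using integral_resolvent_mult[OF inv] by (simp add: R_def)
  finally show ?thesis by (simp add: R_def)
qed

subsection \<open>The maximum entropy density\<close>

locale unit_moment_filter = stable_filter A B for A :: "real^'n^'n" and B :: "real^'m^'n" +
  fixes H :: "real^'n^'m"
  assumes inj_B: "\<And>x. B *v x = 0 \<Longrightarrow> x = 0"
    and lyapunov: "mat 1 - A ** transpose A = B ** H + transpose H ** transpose B"
begin

text \<open>The state feedback \<open>K = (B\<^sup>T B)\<^sup>-\<^sup>1 B\<^sup>T A\<close> turns \<open>A\<close> into \<open>F = A - B K = P A\<close>, where \<open>P\<close> is the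
  orthogonal projection onto the complement of the range of \<open>B\<close>. The equation for \<open>A A\<^sup>T\<close> gives
  \<open>F F\<^sup>T = P\<close>. Hence \<open>F\<close> is a contraction; an eigenvector of \<open>F\<^sup>T\<close> for an eigenvalue of
  modulus at least \<open>1\<close> would be orthogonal to the range of \<open>B\<close> and so an eigenvector of \<open>A\<^sup>T\<close>.
  With \<open>R = (z I - F)\<^sup>-\<^sup>1\<close> and \<open>D = I - K R B\<close> one has \<open>G D = R B\<close>, and the density
  \<open>D (B\<^sup>T B)\<^sup>-\<^sup>1 D\<^sup>*\<close> has the moment \<open>\<integral> R (I - F F\<^sup>T) R\<^sup>* = I\<close>.\<close>

lemma unit_moment_density:
  obtains \<Phi> where "symbol \<Phi>" "\<And>z. z \<in> circ \<Longrightarrow> pos_def (\<Phi> z)" "\<Gamma> \<Phi> = mat 1"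
proof -
  define S where "S = transpose B ** B"
  have "x = 0" if "S *v x = 0" for x
  proof -
    have "(B *v x) \<bullet> (B *v x) = x \<bullet> (S *v x)"
      by (simp add: S_def matrix_vector_mul_assoc[symmetric] dot_lmul_matrix[symmetric] inner_commute)
    then show ?thesis using that inj_B by simp
  qed
  then have S: "invertible S" unfolding invertible_iff_ker by blast
  have Sr: "S ** matrix_inv S = mat 1" "matrix_inv S ** S = mat 1" using matrix_inv_works[OF S] .
  have tS: "transpose S = S" by (simp add: S_def matrix_transpose_mul)
  have tSi: "transpose (matrix_inv S) = matrix_inv S"
  proof -
    have "S ** transpose (matrix_inv S) = transpose (matrix_inv S ** S)"
      by (simp add: matrix_transpose_mul tS)
    then show ?thesis using matrix_inv_eqI(2)[of S "transpose (matrix_inv S)"] Sr by simp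
  qed
  define Q where "Q = B ** matrix_inv S ** transpose B"
  define P where "P = mat 1 - Q"
  have tQ: "transpose Q = Q" by (simp add: Q_def matrix_transpose_mul tSi matrix_mul_assoc)
  have QB: "Q ** B = B"
  proof -
    have "Q ** B = B ** (matrix_inv S ** S)" by (simp add: Q_def S_def matrix_mul_assoc)
    then show ?thesis by (simp add: Sr)
  qed
  have BQ: "transpose B ** Q = transpose B"
    using arg_cong[OF QB, of transpose] by (simp add: matrix_transpose_mul tQ)
  have QQ: "Q ** Q = Q"
  proof -
    have "Q ** Q = (Q ** B) ** matrix_inv S ** transpose B"
      by (subst (2) Q_def) (simp only: matrix_mul_assoc)
    then show ?thesis unfolding QB by (simp only: Q_def[symmetric])
  qed
  have tP: "transpose P = P" by (simp add: P_def vec_eq_iff transpose_def) (metis tQ[unfolded vec_eq_iff transpose_def vec_lambda_beta] mat_nth)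
  have PB: "P ** B = 0" by (simp add: P_def mult_diff_left QB)
  have BP: "transpose B ** P = 0" by (simp add: P_def mult_diff_right BQ)
  have PP: "P ** P = P" by (simp add: P_def mult_diff_left mult_diff_right QQ)
  define K where "K = matrix_inv S ** transpose B ** A"
  define F where "F = A - B ** K"
  have F: "F = P ** A" by (simp add: F_def K_def P_def Q_def mult_diff_left matrix_mul_assoc)
  have FF: "mat 1 - F ** transpose F = Q"
  proof -
    have AA: "A ** transpose A = mat 1 - (B ** H + transpose H ** transpose B)"
      using lyapunov by (simp add: algebra_simps)
    have "F ** transpose F = P ** (A ** transpose A) ** P"
      by (simp add: F matrix_transpose_mul tP matrix_mul_assoc)
    also have "\<dots> = P ** P - (P ** B) ** H ** P - P ** transpose H ** (transpose B ** P)"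
      by (simp add: AA mult_diff_left mult_diff_right matrix_add_ldistrib matrix_add_rdistrib matrix_mul_assoc)
    also have "\<dots> = P" by (simp add: PB BP PP)
    finally show ?thesis by (simp add: P_def)
  qed
  have inv: "invertible (mat z - cmat F)" if z: "1 \<le> norm z" for z
  proof -
    have "invertible (mat z - cmat (transpose F))"
      unfolding invertible_iff_ker
    proof (intro allI impI)
      fix v assume "(mat z - cmat (transpose F)) *v v = 0"
      then have Fv: "cmat (transpose F) *v v = z *s v"
        by (simp add: matrix_vector_mult_diff_rdistrib mat_mult_vec)
      have zs: "(z *s v) \<bullet> (z *s v) = (norm z)\<^sup>2 * (v \<bullet> v)"
        by (simp add: inner_vec_def norm_mult power2_norm_eq_inner[symmetric] power_mult_distrib sum_distrib_left)
      have "(z *s v) \<bullet> (z *s v) = v \<bullet> (cmat F *v (cmat (transpose F) *v v))"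
        unfolding Fv[symmetric] by (simp only: inner_adj_vec adj_cmat transpose_transpose)
      also have "\<dots> = v \<bullet> (cmat (mat 1 - Q) *v v)"
        by (simp add: matrix_vector_mul_assoc cmat_mult[symmetric] FF[symmetric])
      also have "\<dots> = v \<bullet> v - v \<bullet> (cmat (Q ** Q) *v v)"
        by (simp add: cmat_diff matrix_vector_mult_diff_rdistrib inner_diff QQ)
      also have "v \<bullet> (cmat (Q ** Q) *v v) = (cmat Q *v v) \<bullet> (cmat Q *v v)"
        by (simp add: inner_adj_vec adj_cmat tQ cmat_mult matrix_vector_mul_assoc)
      finally have e: "(norm z)\<^sup>2 * (v \<bullet> v) = v \<bullet> v - (cmat Q *v v) \<bullet> (cmat Q *v v)"
        using zs by simp
      have "1 * (v \<bullet> v) \<le> (norm z)\<^sup>2 * (v \<bullet> v)"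
        using z by (intro mult_right_mono) (auto simp: one_le_power)
      then have "(cmat Q *v v) \<bullet> (cmat Q *v v) \<le> 0" using e by simp
      then have Qv: "cmat Q *v v = 0" by (metis inner_eq_zero_iff inner_ge_zero order_antisym)
      have "cmat (transpose A) *v v = cmat (transpose F) *v v"
      proof -
        have "cmat (transpose F) *v v = cmat (transpose A) *v (cmat P *v v)"
          by (simp add: F matrix_transpose_mul tP cmat_mult matrix_vector_mul_assoc)
        also have "cmat P *v v = v"
          using Qv by (simp add: P_def cmat_diff matrix_vector_mult_diff_rdistrib)
        finally show ?thesis by simp
      qed
      then have "adj (mat (cnj z) - cmat A) *v v = 0"
        using Fv by (simp add: adj_diff adj_cmat matrix_vector_mult_diff_rdistrib mat_mult_vec)
      moreover have "invertible (adj (mat (cnj z) - cmat A))"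
        using z by (intro adj_matrix_inv resolvent_invertible[OF stable]) simp
      ultimately show "v = 0" using invertible_iff_ker by blast
    qed
    moreover have "mat z - cmat (transpose F) = transpose (mat z - cmat F)"
      by (simp add: vec_eq_iff transpose_def mat_nth)
    ultimately show ?thesis by (simp add: invertible_det_nz)
  qed
  define R where "R z = matrix_inv (mat z - cmat F)" for z
  define D where "D z = mat 1 - cmat K ** R z ** cmat B" for z
  define \<Phi> where "\<Phi> z = D z ** cmat (matrix_inv S) ** adj (D z)" for z
  have Rw: "(mat z - cmat F) ** R z = mat 1" "invertible (R z)" if "z \<in> circ" for z
    unfolding R_def using that by (simp_all add: matrix_inv_works invertible_matrix_inv inv)
  have GD: "G z ** D z = R z ** cmat B" if z: "z \<in> circ" for z
  proof -
    let ?N = "mat z - cmat A"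
    have "?N ** (R z ** cmat B) = (mat z - cmat F) ** R z ** cmat B - cmat B ** cmat K ** R z ** cmat B"
      by (simp add: F_def cmat_diff cmat_mult mult_diff_left matrix_mul_assoc)
    also have "\<dots> = cmat B ** D z" by (simp add: Rw[OF z] D_def mult_diff_right matrix_mul_assoc)
    finally have "matrix_inv ?N ** (?N ** (R z ** cmat B)) = matrix_inv ?N ** (cmat B ** D z)" by simp
    then show ?thesis
      by (simp add: transfer_fun_def matrix_mul_assoc matrix_inv_works resolvent_works(1)[OF z])
  qed
  have cR: "continuous_on circ R"
    unfolding R_def by (intro continuous_on_matrix_inv continuous_intros inv) simp
  have cD: "continuous_on circ D" unfolding D_def by (intro continuous_intros cR)
  have sym: "symbol \<Phi>" unfolding symbol_def
  proof (intro conjI ballI)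
    show "continuous_on circ \<Phi>" unfolding \<Phi>_def by (intro continuous_intros cD)
    show "adj (\<Phi> z) = \<Phi> z" for z by (simp add: \<Phi>_def adj_mult adj_cmat tSi matrix_mul_assoc)
    fix z assume z: "z \<in> circ"
    have "R (cnj z) = conj_mat (R z)"
      using inv[of z] z by (simp add: R_def conj_mat_matrix_inv conj_mat_diff)
    then have "D (cnj z) = conj_mat (D z)" by (simp add: D_def conj_mat_diff conj_mat_mult)
    then show "\<Phi> (cnj z) = conj_mat (\<Phi> z)" by (simp add: \<Phi>_def conj_mat_mult conj_mat_adj)
  qed
  have "sym_pos_def S"
    unfolding sym_pos_def_def
  proof (intro conjI allI impI tS)
    fix x :: "real^'m" assume "x \<noteq> 0"
    then have "B *v x \<noteq> 0" using inj_B by blast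
    then have "0 < (B *v x) \<bullet> (B *v x)" by simp
    then show "0 < x \<bullet> (S *v x)"
      by (simp add: S_def matrix_vector_mul_assoc[symmetric] dot_lmul_matrix[symmetric] inner_commute)
  qed
  then have pS: "pos_def (cmat (matrix_inv S))"
    using pos_def_matrix_inv[of "cmat S"] by (simp add: sym_pos_def_iff cmat_matrix_inv[OF S])
  have pd: "pos_def (\<Phi> z)" if z: "z \<in> circ" for z
  proof -
    have "x = 0" if "D z *v x = 0" for x
    proof -
      have "R z *v (cmat B *v x) = G z *v (D z *v x)"
        by (simp add: matrix_vector_mul_assoc GD[OF z])
      then have Bx: "cmat B *v x = 0" using that Rw(2)[OF z] invertible_iff_ker by auto
      have "B *v (\<chi> i. Re (x $ i)) = 0" "B *v (\<chi> i. Im (x $ i)) = 0"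
        using Bx by (auto simp: vec_eq_iff mult_vec_nth complex_eq_iff)
      from this[THEN inj_B] show ?thesis by (simp add: vec_eq_iff complex_eq_iff)
    qed
    then have "invertible (D z)" unfolding invertible_iff_ker by blast
    from pos_def_congruence[OF pS adj_matrix_inv(1)[OF this]]
    show ?thesis by (simp add: \<Phi>_def)
  qed
  have "\<Gamma> \<Phi> = (LINT z|circle. R z ** cmat (mat 1 - F ** transpose F) ** adj (R z))"
    unfolding Gamma_op_def
  proof (rule integral_circle_cong)
    fix z assume z: "z \<in> circ"
    have "G z ** \<Phi> z ** adj (G z) = (G z ** D z) ** cmat (matrix_inv S) ** adj (G z ** D z)"
      by (simp add: \<Phi>_def adj_mult matrix_mul_assoc)
    then show "G z ** \<Phi> z ** adj (G z) = R z ** cmat (mat 1 - F ** transpose F) ** adj (R z)"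
      by (simp add: GD[OF z] FF Q_def cmat_mult adj_mult adj_cmat matrix_mul_assoc)
  qed
  also have "\<dots> = mat 1" unfolding R_def by (rule integral_resolvent_lyapunov[OF inv])
  finally show ?thesis using that sym pd by blast
qed

end

section \<open>The dual problem\<close>

lemma trace_inner: "trace L = mat 1 \<bullet> cmat L"
  by (simp add: inner_mat_1 trace_def)

lemma le_if_le_add_multiple:
  fixes a C :: real
  assumes "\<And>t. 0 < t \<Longrightarrow> t \<le> 1 \<Longrightarrow> - C * t \<le> a"
  shows "0 \<le> a"
proof (rule ccontr)
  assume a: "\<not> 0 \<le> a"
  define t where "t = min 1 (- a / (2 * (\<bar>C\<bar> + 1)))"
  have "0 < - a / (2 * (\<bar>C\<bar> + 1))" using a by (intro divide_pos_pos) auto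
  then have t: "0 < t" "t \<le> 1" by (simp_all only: t_def min_less_iff_conj min.cobounded1) simp
  have "t * (2 * (\<bar>C\<bar> + 1)) \<le> - a"
  proof -
    have "t \<le> - a / (2 * (\<bar>C\<bar> + 1))" by (simp add: t_def)
    moreover have "0 < 2 * (\<bar>C\<bar> + 1)" by simp
    ultimately show ?thesis by (simp only: pos_le_divide_eq)
  qed
  moreover have "C * t \<le> \<bar>C\<bar> * t" using t by (intro mult_right_mono) auto
  ultimately show False using assms[OF t] a t by (simp add: algebra_simps)
qed

text \<open>Here \<open>F\<close> is the Lipschitz continuous representative of the prior density \<open>\<Psi>\<close>. All estimates
  below hold at every point of the circle.\<close>

locale dual_problem = unit_moment_filter A B H
  for A :: "real^'n^'n" and B :: "real^'m^'n" and H :: "real^'n^'m" +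
  fixes F :: "complex \<Rightarrow> complex^'m^'m" and \<alpha> LF :: real
  assumes F_symbol: "symbol F"
    and \<alpha>: "0 < \<alpha>" and F_coercive: "\<And>z. z \<in> circ \<Longrightarrow> pos_semidef (F z - \<alpha> *\<^sub>R mat 1)"
    and LF: "0 \<le> LF" and F_lipschitz:
      "\<And>z w. z \<in> circ \<Longrightarrow> w \<in> circ \<Longrightarrow> norm (F z - F w) \<le> LF * norm (z - w)"
begin

text \<open>The pencil is the inverse of the candidate density \<open>(\<Psi>\<^sup>-\<^sup>1 + G\<^sup>* L G)\<^sup>-\<^sup>1\<close>. It is congruent to
  \<open>I + G1\<^sup>* L G1\<close> by the spectral factor, so that \<open>dual_fun\<close> differs from the functional \<open>J\<close> by the
  constant \<open>\<integral> ln det \<Psi>\<close> only. The residual is the gradient of \<open>dual_fun\<close>.\<close>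

definition pencil :: "real^'n^'n \<Rightarrow> complex \<Rightarrow> complex^'m^'m" where
  "pencil L z = matrix_inv (F z) + adjoint_op L z"

definition interior_point :: "real^'n^'n \<Rightarrow> bool" where
  "interior_point L \<longleftrightarrow> transpose L = L \<and> (\<forall>z\<in>circ. pos_def (pencil L z))"

definition coercive_by :: "real \<Rightarrow> real^'n^'n \<Rightarrow> bool" where
  "coercive_by s L \<longleftrightarrow> transpose L = L \<and> (\<forall>z\<in>circ. pos_semidef (pencil L z - s *\<^sub>R mat 1))"

definition dual_fun :: "real^'n^'n \<Rightarrow> real" where
  "dual_fun L = trace L - (LINT z|circle. ln (Re (det (pencil L z))))"

definition residual :: "real^'n^'n \<Rightarrow> complex^'n^'n" where
  "residual L = mat 1 - \<Gamma> (\<lambda>z. matrix_inv (pencil L z))"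

lemma F_pos_def: "z \<in> circ \<Longrightarrow> pos_def (F z)"
  using pos_def_if_coercive F_coercive \<alpha> by blast

lemma F_inv_symbol: "symbol (\<lambda>z. matrix_inv (F z))"
  by (intro symbol_matrix_inv F_symbol pos_def_invertible F_pos_def)

lemma pencil_symbol: "transpose L = L \<Longrightarrow> symbol (pencil L)"
  unfolding pencil_def[abs_def] by (intro symbol_add F_inv_symbol symbol_adjoint_op)

lemma pencil_continuous: "continuous_on circ (pencil L)"
  using F_inv_symbol unfolding pencil_def[abs_def] symbol_def
  by (intro continuous_intros continuous_G) auto

lemma pencil_diff: "pencil L z - pencil M z = adjoint_op (L - M) z"
  by (simp add: pencil_def adjoint_op_diff)

lemma pencil_add: "pencil (L + M) z = pencil L z + adjoint_op M z"
  by (simp add: pencil_def adjoint_op_add)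

lemma coercive_interior: "coercive_by s L \<Longrightarrow> 0 < s \<Longrightarrow> interior_point L"
  unfolding coercive_by_def interior_point_def using pos_def_if_coercive by blast

lemma interior_symmetric: "interior_point L \<Longrightarrow> transpose L = L"
  by (simp add: interior_point_def)

lemma pencil_pos_def: "interior_point L \<Longrightarrow> z \<in> circ \<Longrightarrow> pos_def (pencil L z)"
  by (simp add: interior_point_def)

lemma inv_pencil_symbol:
  assumes "interior_point L" shows "symbol (\<lambda>z. matrix_inv (pencil L z))"
  by (intro symbol_matrix_inv pencil_symbol pos_def_invertible pencil_pos_def
      interior_symmetric[OF assms] assms)

lemma ln_det_continuous:
  assumes "interior_point L"
  shows "continuous_on circ (\<lambda>z. ln (Re (det (pencil L z))))"
proof (intro continuous_intros pencil_continuous ballI)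
  show "Re (det (pencil L z)) \<noteq> 0" if "z \<in> circ" for z
    using pos_def_det(2)[OF pencil_pos_def[OF assms that]] by simp
qed

lemma dual_fun_tangent:
  assumes L: "interior_point L" and M: "interior_point M"
  shows "dual_fun L + cmat (M - L) \<bullet> residual L \<le> dual_fun M"
proof -
  have i: "integrable circle (\<lambda>z. ln (Re (det (pencil N z))))" if "interior_point N" for N
    by (intro integrable_circle_continuous ln_det_continuous that)
  have si: "integrable circle (\<lambda>z. matrix_inv (pencil L z))"
    by (intro symbol_integrable inv_pencil_symbol L)
  have ic: "integrable circle (\<lambda>z. adjoint_op (M - L) z \<bullet> matrix_inv (pencil L z))"
    using inv_pencil_symbol[OF L]
    by (intro integrable_circle_continuous continuous_intros continuous_G) (auto simp: symbol_def)
  have "(LINT z|circle. ln (Re (det (pencil M z)))) \<le>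
      (LINT z|circle. ln (Re (det (pencil L z))) + adjoint_op (M - L) z \<bullet> matrix_inv (pencil L z))"
  proof (rule integral_circle_mono)
    fix z assume z: "z \<in> circ"
    show "ln (Re (det (pencil M z))) \<le>
        ln (Re (det (pencil L z))) + adjoint_op (M - L) z \<bullet> matrix_inv (pencil L z)"
      using ln_det_tangent(1)[OF pencil_pos_def[OF L z] pencil_pos_def[OF M z]]
      by (simp add: pencil_diff inner_commute)
  qed (intro Bochner_Integration.integrable_add i L M ic)+
  also have "\<dots> = (LINT z|circle. ln (Re (det (pencil L z)))) + cmat (M - L) \<bullet> \<Gamma> (\<lambda>z. matrix_inv (pencil L z))"
    unfolding moment_pairing[OF si] by (intro Bochner_Integration.integral_add i L ic)
  finally show ?thesis
    by (simp add: dual_fun_def residual_def inner_diff cmat_diff trace_inner inner_commute)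
qed

lemma residual_lipschitz:
  assumes s: "0 < s"
  obtains C where "\<And>L M. coercive_by s L \<Longrightarrow> coercive_by s M \<Longrightarrow>
    norm (residual L - residual M) \<le> C * norm (L - M)" "0 \<le> C"
proof -
  note c = gain_pos and c1 = moment_norm_le and c2 = norm_adjoint_op_le
  define k where "k = real CARD('m) / s"
  have k: "k > 0" using s by (simp add: k_def)
  have "norm (residual L - residual M) \<le> (gain * (k * gain * k)) * norm (L - M)"
    if L: "coercive_by s L" and M: "coercive_by s M" for L M
  proof -
    let ?L = "\<lambda>z. matrix_inv (pencil L z)" and ?M = "\<lambda>z. matrix_inv (pencil M z)"
    note iL = coercive_interior[OF L s] and iM = coercive_interior[OF M s]
    have sym: "symbol ?L" "symbol ?M" using inv_pencil_symbol iL iM by auto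
    have "residual L - residual M = \<Gamma> ?M + \<Gamma> (\<lambda>z. (- 1) *\<^sub>R ?L z)"
      unfolding moment_scaleR by (simp add: residual_def)
    also have "\<dots> = \<Gamma> (\<lambda>z. ?M z + (- 1) *\<^sub>R ?L z)"
      using symbol_integrable[OF sym(1)] symbol_integrable[OF sym(2)]
      by (intro moment_add[symmetric] integrable_scaleR_right) auto
    also have "norm \<dots> \<le> gain * (k * (gain * norm (L - M)) * k)"
    proof (rule c1)
      show "continuous_on circ (\<lambda>z. ?M z + (- 1) *\<^sub>R ?L z)"
        using sym by (intro continuous_intros) (auto simp: symbol_def)
      fix z assume z: "z \<in> circ"
      have "?M z + (- 1) *\<^sub>R ?L z = ?M z ** adjoint_op (L - M) z ** ?L z"
        using matrix_inv_diff[OF pos_def_invertible pos_def_invertible, OF pencil_pos_def[OF iM z] pencil_pos_def[OF iL z]]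
        by (simp add: pencil_diff)
      also have "norm \<dots> \<le> norm (?M z) * norm (adjoint_op (L - M) z) * norm (?L z)"
        by (rule norm_mult3_le)
      also have "\<dots> \<le> k * (gain * norm (L - M)) * k"
        using norm_inverse_le[OF _ s, of "pencil L z"] norm_inverse_le[OF _ s, of "pencil M z"] L M z c c2[OF z, of "L - M"] k
        by (intro mult_mono mult_nonneg_nonneg) (auto simp: k_def coercive_by_def)
      finally show "norm (?M z + (- 1) *\<^sub>R ?L z) \<le> k * (gain * norm (L - M)) * k" .
    qed
    finally show ?thesis by (simp add: mult_ac)
  qed
  moreover have "0 \<le> gain * (k * gain * k)" using c k by simp
  ultimately show ?thesis using that by blast
qed

lemma dual_fun_continuous:
  assumes s: "0 < s"
  shows "continuous_on {L. coercive_by s L} dual_fun"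
proof -
  note c = gain_pos and c1 = moment_norm_le
  define b where "b = norm (mat 1 :: complex^'n^'n) + gain * (real CARD('m) / s)"
  have r: "norm (residual L) \<le> b" if L: "coercive_by s L" for L
  proof -
    have "norm (\<Gamma> (\<lambda>z. matrix_inv (pencil L z))) \<le> gain * (real CARD('m) / s)"
      using inv_pencil_symbol[OF coercive_interior[OF L s]] L
      by (intro c1 norm_inverse_le s) (auto simp: symbol_def coercive_by_def)
    then show ?thesis
      unfolding residual_def b_def by (intro order_trans[OF norm_triangle_ineq4]) auto
  qed
  have half: "dual_fun L - dual_fun M \<le> b * norm (L - M)"
    if L: "coercive_by s L" and M: "coercive_by s M" for L M
  proof -
    have "dual_fun L - dual_fun M \<le> cmat (L - M) \<bullet> residual L"
      using dual_fun_tangent[OF coercive_interior[OF L s] coercive_interior[OF M s]]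
      by (simp add: cmat_diff inner_diff)
    also have "\<dots> \<le> norm (L - M) * norm (residual L)"
      using norm_cauchy_schwarz[of "cmat (L - M)" "residual L"] by simp
    also have "\<dots> \<le> norm (L - M) * b" using r[OF L] by (intro mult_left_mono) auto
    finally show ?thesis by (simp add: mult.commute)
  qed
  have "dist (dual_fun L) (dual_fun M) \<le> b * dist L M" if "coercive_by s L" "coercive_by s M" for L M
    using half[OF that] half[OF that(2,1)] by (simp add: dist_norm norm_minus_commute abs_le_iff)
  moreover have "b \<ge> 0" using c s by (simp add: b_def)
  ultimately have "b-lipschitz_on {L. coercive_by s L} dual_fun"
    by (intro lipschitz_onI) auto
  then show ?thesis by (rule lipschitz_on_continuous_on)
qed

text \<open>Since \<open>I = \<Gamma> \<Phi>\<close> for a coercive \<open>\<Phi>\<close>, the trace of \<open>L\<close> is the integral of the inner product of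
  \<open>\<Phi>\<close> and \<open>G\<^sup>* L G\<close>, which dominates the logarithm.\<close>

lemma dual_fun_coercive:
  obtains c C where "c > 0"
    "\<And>L. L \<in> range_Gamma A B \<Longrightarrow> interior_point L \<Longrightarrow> c * norm L - C \<le> dual_fun L"
proof -
  obtain \<Phi> where \<Phi>: "symbol \<Phi>" "\<And>z. z \<in> circ \<Longrightarrow> pos_def (\<Phi> z)" "\<Gamma> \<Phi> = mat 1"
    using unit_moment_density by blast
  have cont: "continuous_on circ \<Phi>" "continuous_on circ (\<lambda>z. matrix_inv (F z))"
    using \<Phi>(1) F_inv_symbol by (auto simp: symbol_def)
  obtain T where T: "T > 0" "\<And>z. z \<in> circ \<Longrightarrow> norm (matrix_inv (\<Phi> z)) \<le> T"
    using continuous_bounded_circle[OF continuous_on_matrix_inv[OF cont(1) pos_def_invertible[OF \<Phi>(2)]]]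
    by blast
  obtain KF where KF: "KF > 0" "\<And>z. z \<in> circ \<Longrightarrow> norm (matrix_inv (F z)) \<le> KF"
    using continuous_bounded_circle[OF cont(2)] by blast
  obtain K where K: "K > 0" "\<And>z. z \<in> circ \<Longrightarrow> norm (\<Phi> z) \<le> K"
    using continuous_bounded_circle[OF cont(1)] by blast
  define b where "b = 1 / (norm (mat 1 :: complex^'m^'m) * T)"
  note n1 = norm_mat_1_pos[where 'n = 'm]
  have b: "b > 0" using n1 T by (simp add: b_def)
  have \<Phi>b: "pos_semidef (\<Phi> z - b *\<^sub>R mat 1)" if z: "z \<in> circ" for z
    unfolding b_def
  proof (rule coercive_if_trace_inverse_le[OF \<Phi>(2)[OF z]])
    show "mat 1 \<bullet> matrix_inv (\<Phi> z) \<le> norm (mat 1 :: complex^'m^'m) * T"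
      using T(2)[OF z] by (intro order_trans[OF norm_cauchy_schwarz] mult_left_mono) auto
  qed
  define X :: "complex^'m^'m" where "X = (2 / b) *\<^sub>R mat 1"
  have X: "pos_def X" unfolding X_def using b by (intro pos_def_scaleR pos_def_mat_1) simp
  have invX: "matrix_inv X = (b / 2) *\<^sub>R mat 1"
    by (rule matrix_inv_eqI(2)) (use b in \<open>simp add: X_def mult_scaleR_left mult_scaleR_right\<close>)
  define C where "C = b / 2 * KF + KF * K + \<bar>ln (Re (det X))\<bar>"
  obtain e where e: "e > 0" "\<And>L. L \<in> range_Gamma A B \<Longrightarrow> norm L \<le> e * (LINT z|circle. norm (adjoint_op L z))"
    using norm_le_integral_adjoint_op by blast
  have "b / (2 * e) * norm L - C \<le> dual_fun L"
    if L: "L \<in> range_Gamma A B" and int: "interior_point L" for L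
  proof -
    have pw: "b / 2 * norm (adjoint_op L z) - C \<le> adjoint_op L z \<bullet> \<Phi> z - ln (Re (det (pencil L z)))"
      if z: "z \<in> circ" for z
    proof -
      let ?M = "pencil L z"
      note pd = pencil_pos_def[OF int z]
      have psd: "pos_semidef ?M" by (rule pos_def_imp_semidef[OF pd])
      have 1: "b * (mat 1 \<bullet> ?M) \<le> ?M \<bullet> \<Phi> z"
        using pos_semidef_inner_nonneg[OF psd \<Phi>b[OF z]] by (simp add: inner_diff inner_commute)
      have "0 \<le> matrix_inv X \<bullet> X"
        by (intro pos_semidef_inner_nonneg pos_def_imp_semidef pos_def_matrix_inv X)
      then have 2: "ln (Re (det ?M)) \<le> \<bar>ln (Re (det X))\<bar> + b / 2 * (mat 1 \<bullet> ?M)"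
        using ln_det_tangent(1)[OF X pd] by (simp add: invX inner_diff)
      have "norm (adjoint_op L z) \<le> norm ?M + norm (matrix_inv (F z))"
        unfolding pencil_def by (metis add_diff_cancel_left' norm_triangle_ineq4)
      then have 3: "norm (adjoint_op L z) \<le> mat 1 \<bullet> ?M + KF"
        using norm_le_trace[OF psd] KF(2)[OF z] by simp
      have "matrix_inv (F z) \<bullet> \<Phi> z \<le> KF * K"
        using KF(2)[OF z] K(2)[OF z] KF(1) by (intro order_trans[OF norm_cauchy_schwarz] mult_mono) auto
      moreover have "adjoint_op L z \<bullet> \<Phi> z = ?M \<bullet> \<Phi> z - matrix_inv (F z) \<bullet> \<Phi> z"
        by (simp add: pencil_def inner_add)
      moreover have "b / 2 * norm (adjoint_op L z) \<le> b / 2 * (mat 1 \<bullet> ?M + KF)"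
        using 3 b by (intro mult_left_mono) auto
      ultimately show ?thesis using 1 2 by (simp add: C_def algebra_simps)
    qed
    have i1: "integrable circle (\<lambda>z. adjoint_op L z \<bullet> \<Phi> z)" "integrable circle (\<lambda>z. norm (adjoint_op L z))"
      by (intro integrable_circle_continuous continuous_intros continuous_G cont)+
    have i2: "integrable circle (\<lambda>z. ln (Re (det (pencil L z))))"
      by (intro integrable_circle_continuous ln_det_continuous int)
    have "trace L = (LINT z|circle. adjoint_op L z \<bullet> \<Phi> z)"
      using moment_pairing[OF symbol_integrable[OF \<Phi>(1)], of L] by (simp add: \<Phi>(3) trace_inner inner_commute)
    then have "dual_fun L = (LINT z|circle. adjoint_op L z \<bullet> \<Phi> z - ln (Re (det (pencil L z))))"
      using i1 i2 by (simp add: dual_fun_def)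
    moreover have "(LINT z|circle. b / 2 * norm (adjoint_op L z) - C)
        \<le> (LINT z|circle. adjoint_op L z \<bullet> \<Phi> z - ln (Re (det (pencil L z))))"
      using i1 i2 by (intro integral_circle_mono pw Bochner_Integration.integrable_diff) auto
    moreover have "(LINT z|circle. b / 2 * norm (adjoint_op L z) - C)
        = b / 2 * (LINT z|circle. norm (adjoint_op L z)) - C"
      using i1 by simp
    moreover have "b / (2 * e) * norm L \<le> b / 2 * (LINT z|circle. norm (adjoint_op L z))"
    proof -
      have "b / (2 * e) * norm L \<le> b / (2 * e) * (e * (LINT z|circle. norm (adjoint_op L z)))"
        using e L b by (intro mult_left_mono) auto
      then show ?thesis using e by simp
    qed
    ultimately show ?thesis by linarith
  qed
  moreover have "b / (2 * e) > 0" using b e by simp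
  ultimately show ?thesis using that by blast
qed

text \<open>A form that is small at a point of the circle stays small near this point, by the Lipschitz
  condition, which makes the integral of the trace of the inverse large.\<close>

lemma uniform_coercivity:
  assumes R: "0 \<le> R"
  obtains \<delta> where "\<delta> > 0" "\<And>L. interior_point L \<Longrightarrow> norm L \<le> R \<Longrightarrow>
    (LINT z|circle. mat 1 \<bullet> matrix_inv (pencil L z)) \<le> T \<Longrightarrow> coercive_by \<delta> L"
proof -
  obtain CG where CG: "CG > 0" "\<And>z w. z \<in> circ \<Longrightarrow> w \<in> circ \<Longrightarrow> norm (G z - G w) \<le> CG * norm (z - w)"
    using G_lipschitz by blast
  obtain KG where KG: "KG > 0" "\<And>z. z \<in> circ \<Longrightarrow> norm (G z) \<le> KG" using G_bounded by blast
  define k where "k = real CARD('m) / \<alpha>"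
  have k: "k > 0" using \<alpha> by (simp add: k_def)
  define C where "C = k * LF * k + 2 * (CG * R * KG) + 1"
  have C: "C > 0" using k LF CG KG R by (simp add: C_def add_nonneg_pos)
  have lip: "norm (pencil L z - pencil L w) \<le> C * norm (z - w)"
    if L: "norm L \<le> R" and z: "z \<in> circ" and w: "w \<in> circ" for L z w
  proof -
    have kz: "norm (matrix_inv (F u)) \<le> k" if "u \<in> circ" for u
      unfolding k_def by (intro norm_inverse_le F_coercive that \<alpha>)
    have "matrix_inv (F z) - matrix_inv (F w) = matrix_inv (F z) ** (F w - F z) ** matrix_inv (F w)"
      by (intro matrix_inv_diff pos_def_invertible F_pos_def z w)
    also have "norm \<dots> \<le> norm (matrix_inv (F z)) * norm (F w - F z) * norm (matrix_inv (F w))"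
      by (rule norm_mult3_le)
    also have "\<dots> \<le> k * (LF * norm (z - w)) * k"
      using kz z w F_lipschitz[OF w z] k LF
      by (intro mult_mono mult_nonneg_nonneg) (auto simp: norm_minus_commute)
    finally have 1: "norm (matrix_inv (F z) - matrix_inv (F w)) \<le> k * LF * k * norm (z - w)"
      by (simp add: mult_ac)
    have bd: "norm (adj (X :: complex^'m^'n) ** cmat L ** Y) \<le> x * R * y"
      if "norm X \<le> x" "norm Y \<le> y" for X Y :: "complex^'m^'n" and x y
    proof -
      have "norm (adj X ** cmat L ** Y) \<le> norm X * norm L * norm Y"
        using norm_mult3_le[of "adj X" "cmat L" Y] by simp
      also have "\<dots> \<le> x * R * y"
        using that L R order_trans[OF norm_ge_zero that(1)]
        by (intro mult_mono mult_nonneg_nonneg) auto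
      finally show ?thesis .
    qed
    have "adjoint_op L z - adjoint_op L w = adj (G z - G w) ** cmat L ** G z + adj (G w) ** cmat L ** (G z - G w)"
      by (simp add: adj_diff mult_diff_left mult_diff_right)
    also have "norm \<dots> \<le> (CG * norm (z - w)) * R * KG + KG * R * (CG * norm (z - w))"
      using CG(2)[OF z w] KG(2)[OF z] KG(2)[OF w]
      by (intro order_trans[OF norm_triangle_ineq] add_mono bd)
    finally have 2: "norm (adjoint_op L z - adjoint_op L w) \<le> 2 * (CG * R * KG) * norm (z - w)"
      by (simp add: mult_ac)
    have "pencil L z - pencil L w = (matrix_inv (F z) - matrix_inv (F w)) + (adjoint_op L z - adjoint_op L w)"
      by (simp add: pencil_def)
    then have "norm (pencil L z - pencil L w) \<le> k * LF * k * norm (z - w) + 2 * (CG * R * KG) * norm (z - w)"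
      using norm_triangle_le[OF add_mono[OF 1 2]] by simp
    also have "\<dots> \<le> C * norm (z - w)" by (simp add: C_def algebra_simps)
    finally show ?thesis .
  qed
  define \<delta> where "\<delta> = C * pi / exp (2 * pi * C * T)"
  have "coercive_by \<delta> L"
    if int: "interior_point L" and LR: "norm L \<le> R"
      and LT: "(LINT z|circle. mat 1 \<bullet> matrix_inv (pencil L z)) \<le> T" for L
    unfolding coercive_by_def pos_semidef_minus_mat_iff
  proof (intro conjI ballI allI)
    show "transpose L = L" by (rule interior_symmetric[OF int])
    fix z0 assume z0: "z0 \<in> circ"
    show "adj (pencil L z0) = pencil L z0" by (rule pos_def_hermitian[OF pencil_pos_def[OF int z0]])
    fix x :: "complex^'m"
    show "\<delta> * (x \<bullet> x) \<le> x \<bullet> (pencil L z0 *v x)"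
    proof (cases "x = 0")
      case False
      define v where "v = x /\<^sub>R norm x"
      have v1: "norm v = 1" using False by (simp add: v_def)
      then have v0: "v \<noteq> 0" by auto
      define \<eta> where "\<eta> = v \<bullet> (pencil L z0 *v v)"
      have \<eta>: "\<eta> > 0" using pencil_pos_def[OF int z0] v0 by (simp add: \<eta>_def pos_def_def)
      have "ln (1 + C * pi / \<eta>) / (2 * pi * C) \<le> (LINT z|circle. mat 1 \<bullet> matrix_inv (pencil L z))"
      proof (rule integral_circle_ge_ln[OF _ z0 \<eta> C])
        show "continuous_on circ (\<lambda>z. mat 1 \<bullet> matrix_inv (pencil L z))"
          using inv_pencil_symbol[OF int] by (intro continuous_intros) (simp add: symbol_def)
        fix z assume z: "z \<in> circ"
        have "v \<bullet> (pencil L z *v v) = \<eta> + v \<bullet> ((pencil L z - pencil L z0) *v v)"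
          by (simp add: \<eta>_def matrix_vector_mult_diff_rdistrib inner_diff)
        also have "\<dots> \<le> \<eta> + norm (pencil L z - pencil L z0)"
          using form_bound[of v "pencil L z - pencil L z0"] v1 by (simp add: dot_square_norm)
        also have "\<dots> \<le> \<eta> + C * norm (z - z0)" using lip[OF LR z z0] by simp
        finally have "(v \<bullet> (pencil L z *v v)) * (mat 1 \<bullet> matrix_inv (pencil L z))
            \<le> (\<eta> + C * norm (z - z0)) * (mat 1 \<bullet> matrix_inv (pencil L z))"
          using trace_inverse_pos[OF pencil_pos_def[OF int z]] by (intro mult_right_mono) auto
        then show "1 \<le> (\<eta> + C * norm (z - z0)) * (mat 1 \<bullet> matrix_inv (pencil L z))"
          using trace_inverse_ge[OF pencil_pos_def[OF int z] v1] by simp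
      qed
      then have "ln (1 + C * pi / \<eta>) / (2 * pi * C) \<le> T" using LT by (rule order_trans)
      moreover have "0 < 2 * pi * C" using C by simp
      ultimately have "ln (1 + C * pi / \<eta>) \<le> T * (2 * pi * C)"
        by (simp only: pos_divide_le_eq)
      then have "ln (1 + C * pi / \<eta>) \<le> 2 * pi * C * T" by (simp only: mult.commute)
      then have "1 + C * pi / \<eta> \<le> exp (2 * pi * C * T)"
      proof -
        assume "ln (1 + C * pi / \<eta>) \<le> 2 * pi * C * T"
        then have "exp (ln (1 + C * pi / \<eta>)) \<le> exp (2 * pi * C * T)" by simp
        moreover have "0 < 1 + C * pi / \<eta>" using C \<eta> by (simp add: add_pos_pos)
        ultimately show ?thesis by (simp only: exp_ln)
      qed
      then have "C * pi / \<eta> \<le> exp (2 * pi * C * T)" by simp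
      then have "\<delta> \<le> \<eta>" using \<eta> by (simp add: \<delta>_def field_simps)
      moreover have "\<eta> = (x \<bullet> (pencil L z0 *v x)) / (x \<bullet> x)"
        by (simp add: \<eta>_def v_def mult_vec_scaleR dot_square_norm power2_eq_square divide_inverse mult_ac)
      ultimately show ?thesis using False by (simp add: field_simps)
    qed simp
  qed
  moreover have "\<delta> > 0" using C by (simp add: \<delta>_def)
  ultimately show ?thesis using that by blast
qed

subsection \<open>Existence of a stationary point\<close>

lemma coercive_by_mono: "coercive_by s L \<Longrightarrow> t \<le> s \<Longrightarrow> coercive_by t L"
  unfolding coercive_by_def using pos_semidef_minus_mono by blast

lemma coercive_by_perturb:
  assumes "coercive_by s L" "transpose D = D" "\<And>z. z \<in> circ \<Longrightarrow> norm (adjoint_op D z) \<le> s - t"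
  shows "coercive_by t (L + D)"
  using assms symbol_adjoint_op[OF assms(2)]
  by (auto simp: coercive_by_def pencil_add symbol_def transpose_def vec_eq_iff intro!: pos_semidef_perturb)

lemma coercive_by_convex:
  assumes "coercive_by s L" "coercive_by s M" "0 \<le> t" "t \<le> 1"
  shows "coercive_by s (L + t *\<^sub>R (M - L))"
  unfolding coercive_by_def
proof (intro conjI ballI)
  have t: "transpose L = L" "transpose M = M" using assms by (auto simp: coercive_by_def)
  then show "transpose (L + t *\<^sub>R (M - L)) = L + t *\<^sub>R (M - L)"
    by (simp add: transpose_def vec_eq_iff)
  fix z assume "z \<in> circ"
  then have "pos_semidef ((1 - t) *\<^sub>R (pencil L z - s *\<^sub>R mat 1) + t *\<^sub>R (pencil M z - s *\<^sub>R mat 1))"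
    using assms by (intro pos_semidef_add pos_semidef_scaleR) (auto simp: coercive_by_def)
  moreover have "pencil (L + t *\<^sub>R (M - L)) z - s *\<^sub>R mat 1
      = (1 - t) *\<^sub>R (pencil L z - s *\<^sub>R mat 1) + t *\<^sub>R (pencil M z - s *\<^sub>R mat 1)"
    unfolding pencil_add adjoint_op_scaleR pencil_diff[symmetric] by (simp add: algebra_simps)
  ultimately show "pos_semidef (pencil (L + t *\<^sub>R (M - L)) z - s *\<^sub>R mat 1)" by simp
qed

lemma closed_coercive: "closed {L. coercive_by s L}"
proof -
  have eq: "{L. coercive_by s L} = {L. transpose L = L} \<inter> (\<Inter>z\<in>circ. {L. adj (pencil L z) = pencil L z} \<inter>
      (\<Inter>x. {L. s * (x \<bullet> x) \<le> x \<bullet> (pencil L z *v x)}))"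
    by (auto simp: coercive_by_def pos_semidef_minus_mat_iff)
  have cp: "continuous_on UNIV (\<lambda>L. pencil L z)" for z
    unfolding pencil_def
    by (intro continuous_intros bounded_linear.continuous_on[OF bounded_linear_cmat])
  have cpv: "continuous_on UNIV (\<lambda>L. pencil L z *v x)" for z x
    unfolding matrix_vector_mult_def by (intro continuous_intros cp)
  have ct: "continuous_on UNIV (transpose :: real^'n^'n \<Rightarrow> real^'n^'n)"
    unfolding transpose_def by (intro continuous_intros)
  show ?thesis unfolding eq
    by (intro closed_Int closed_INT ballI closed_Collect_eq closed_Collect_le continuous_intros cp cpv ct)
qed

text \<open>The tangent inequality is used at the points \<open>N\<close> of the segment from \<open>L\<close> to \<open>M\<close>: minimality of
  \<open>L\<close> makes the directional derivative at \<open>N\<close> nonnegative, and the residual is continuous. In this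
  way no integral has to be differentiated with respect to a parameter.\<close>

lemma minimizer_variational:
  assumes s: "0 < s" and L: "coercive_by s L" and M: "coercive_by s M"
    and min: "\<And>t. 0 < t \<Longrightarrow> t \<le> 1 \<Longrightarrow> dual_fun L \<le> dual_fun (L + t *\<^sub>R (M - L))"
  shows "0 \<le> cmat (M - L) \<bullet> residual L"
proof -
  obtain C where C: "\<And>L M. coercive_by s L \<Longrightarrow> coercive_by s M \<Longrightarrow>
    norm (residual L - residual M) \<le> C * norm (L - M)" "0 \<le> C"
    using residual_lipschitz[OF s] by blast
  show ?thesis
  proof (rule le_if_le_add_multiple)
    fix t :: real assume t: "0 < t" "t \<le> 1"
    define N where "N = L + t *\<^sub>R (M - L)"
    have N: "coercive_by s N" unfolding N_def using t by (intro coercive_by_convex L M) auto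
    have "dual_fun N + cmat (L - N) \<bullet> residual N \<le> dual_fun L"
      by (intro dual_fun_tangent coercive_interior[OF _ s] N L)
    then have "cmat (L - N) \<bullet> residual N \<le> 0" using min[OF t] by (simp add: N_def)
    moreover have "L - N = (- t) *\<^sub>R (M - L)" by (simp add: N_def)
    ultimately have "- t * (cmat (M - L) \<bullet> residual N) \<le> 0" by (simp only: cmat_scaleR inner_scaleR_left)
    then have "0 \<le> cmat (M - L) \<bullet> residual N" using t by (simp add: zero_le_mult_iff)
    also have "\<dots> = cmat (M - L) \<bullet> residual L + cmat (M - L) \<bullet> (residual N - residual L)"
      by (simp add: inner_diff)
    also have "cmat (M - L) \<bullet> (residual N - residual L) \<le> norm (M - L) * (C * (t * norm (M - L)))"
    proof -
      have "norm (residual N - residual L) \<le> C * norm (N - L)" by (rule C(1)[OF N L])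
      also have "norm (N - L) = t * norm (M - L)" using t by (simp add: N_def)
      finally have "norm (cmat (M - L)) * norm (residual N - residual L) \<le> norm (M - L) * (C * (t * norm (M - L)))"
        by (simp add: mult_left_mono)
      then show ?thesis by (rule order_trans[OF norm_cauchy_schwarz])
    qed
    finally show "- (C * norm (M - L) * norm (M - L)) * t \<le> cmat (M - L) \<bullet> residual L"
      by (simp add: mult_ac)
  qed
qed

text \<open>The dual function is minimized over the compact set of those \<open>L\<close> for which the pencil is
  bounded below by \<open>s\<close>. Comparison of the minimizer with \<open>L = 0\<close> bounds the integral of the trace
  of the inverse pencil, independently of \<open>s\<close>, and so gives a lower bound \<open>\<delta>\<close> of the pencil that
  does not depend on \<open>s\<close>. For \<open>s < \<delta>\<close> the constraint is inactive.\<close>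

theorem stationary_point_exists:
  obtains L s where "L \<in> range_Gamma A B" "0 < s" "coercive_by s L" "residual L = 0"
proof -
  have zero: "0 \<in> range_Gamma A B" by (rule subspace_0[OF subspace_range_Gamma])
  have p0: "pencil 0 z = matrix_inv (F z)" for z by (simp add: pencil_def)
  obtain KF where KF: "KF > 0" "\<And>z. z \<in> circ \<Longrightarrow> norm (F z) \<le> KF"
    using continuous_bounded_circle[of F] F_symbol by (auto simp: symbol_def)
  note n1 = norm_mat_1_pos[where 'n = 'm]
  define \<beta> where "\<beta> = 1 / (norm (mat 1 :: complex^'m^'m) * KF)"
  have \<beta>: "\<beta> > 0" using n1 KF by (simp add: \<beta>_def)
  have F\<beta>: "pos_semidef (matrix_inv (F z) - \<beta> *\<^sub>R mat 1)" if z: "z \<in> circ" for z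
    unfolding \<beta>_def
  proof (rule coercive_if_trace_inverse_le)
    show "pos_def (matrix_inv (F z))" by (intro pos_def_matrix_inv F_pos_def z)
    have "matrix_inv (matrix_inv (F z)) = F z" by (intro invertible_matrix_inv pos_def_invertible F_pos_def z)
    then show "mat 1 \<bullet> matrix_inv (matrix_inv (F z)) \<le> norm (mat 1 :: complex^'m^'m) * KF"
      using KF(2)[OF z] by (simp add: order_trans[OF norm_cauchy_schwarz] mult_left_mono)
  qed
  have zero_coercive: "coercive_by s 0" if "s \<le> \<beta>" for s
    using that pos_semidef_minus_mono[OF F\<beta>] by (simp add: coercive_by_def p0)
  obtain c C where c: "c > 0" "\<And>L. L \<in> range_Gamma A B \<Longrightarrow> interior_point L \<Longrightarrow> c * norm L - C \<le> dual_fun L"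
    using dual_fun_coercive by blast
  define R where "R = max 0 ((dual_fun 0 + C) / c)"
  have R: "norm L \<le> R" if "L \<in> range_Gamma A B" "interior_point L" "dual_fun L \<le> dual_fun 0" for L
  proof -
    have "norm L \<le> (dual_fun 0 + C) / c"
      using c(2)[OF that(1,2)] that(3) c(1) by (simp add: pos_le_divide_eq mult.commute)
    then show ?thesis by (simp add: R_def)
  qed
  define T where "T = (real CARD('m) + norm (mat 1 :: complex^'n^'n) * R) / \<beta>"
  obtain \<delta> where \<delta>: "\<delta> > 0" and un: "\<And>L. interior_point L \<Longrightarrow> norm L \<le> R \<Longrightarrow>
    (LINT z|circle. mat 1 \<bullet> matrix_inv (pencil L z)) \<le> T \<Longrightarrow> coercive_by \<delta> L"
    using uniform_coercivity[of R T] by (auto simp: R_def)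
  define s where "s = min \<beta> (\<delta> / 2)"
  have s: "0 < s" "s \<le> \<beta>" "s < \<delta>" using \<beta> \<delta> by (auto simp: s_def)
  define K where "K = range_Gamma A B \<inter> {L. coercive_by s L}"
  define K' where "K' = {L \<in> K. dual_fun L \<le> dual_fun 0}"
  have "closed K" unfolding K_def
    by (intro closed_Int closed_subspace subspace_range_Gamma closed_coercive)
  moreover have "continuous_on K dual_fun"
    using dual_fun_continuous[OF s(1)] by (rule continuous_on_subset) (auto simp: K_def)
  ultimately have "closed K'"
    unfolding K'_def using continuous_on_closed_Collect_le[of K dual_fun "\<lambda>_. dual_fun 0"] by simp
  moreover have "bounded K'"
    using R coercive_interior s(1) by (auto simp: bounded_iff K'_def K_def intro!: exI[of _ R])
  ultimately have "compact K'" by (simp add: compact_eq_bounded_closed)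
  moreover have "0 \<in> K'" using zero zero_coercive s by (simp add: K'_def K_def)
  moreover have "continuous_on K' dual_fun"
    using \<open>continuous_on K dual_fun\<close> by (rule continuous_on_subset) (auto simp: K'_def)
  ultimately obtain L where L: "L \<in> K'" and min': "\<And>M. M \<in> K' \<Longrightarrow> dual_fun L \<le> dual_fun M"
    by (metis continuous_attains_inf empty_iff)
  have LK: "L \<in> range_Gamma A B" "coercive_by s L" using L by (auto simp: K'_def K_def)
  have min: "dual_fun L \<le> dual_fun M" if "M \<in> range_Gamma A B" "coercive_by s M" for M
  proof (cases "dual_fun M \<le> dual_fun 0")
    case True
    then show ?thesis using that min' by (simp add: K'_def K_def)
  next
    case False
    then show ?thesis using L by (simp add: K'_def)
  qed
  have var: "0 \<le> cmat (M - L) \<bullet> residual L" if M: "M \<in> range_Gamma A B" "coercive_by s M" for M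
  proof (rule minimizer_variational[OF s(1) LK(2) M(2)])
    fix t :: real assume "0 < t" "t \<le> 1"
    then show "dual_fun L \<le> dual_fun (L + t *\<^sub>R (M - L))"
      using LK M subspace_range_Gamma
      by (intro min coercive_by_convex) (auto intro: subspace_add subspace_scale subspace_diff)
  qed
  note int = coercive_interior[OF LK(2) s(1)]
  have cinv: "continuous_on circ (\<lambda>z. matrix_inv (pencil L z))"
    "continuous_on circ (\<lambda>z. matrix_inv (F z))"
    using inv_pencil_symbol[OF int] F_inv_symbol by (auto simp: symbol_def)
  have bound: "(LINT z|circle. mat 1 \<bullet> matrix_inv (pencil L z)) \<le> T"
  proof -
    have "cmat L \<bullet> residual L \<le> 0"
      using var[OF zero zero_coercive[OF s(2)]] by (simp only: cmat_diff cmat_zero inner_diff_left) simp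
    then have "trace L \<le> cmat L \<bullet> \<Gamma> (\<lambda>z. matrix_inv (pencil L z))"
      by (simp add: residual_def inner_diff trace_inner inner_commute)
    also have "\<dots> = (LINT z|circle. adjoint_op L z \<bullet> matrix_inv (pencil L z))"
      by (rule moment_pairing[OF symbol_integrable[OF inv_pencil_symbol[OF int]]])
    also have "\<dots> = (LINT z|circle. real CARD('m) - matrix_inv (F z) \<bullet> matrix_inv (pencil L z))"
    proof (rule integral_circle_cong)
      fix z assume z: "z \<in> circ"
      have "pencil L z \<bullet> matrix_inv (pencil L z) = real CARD('m)"
        using inner_inverse_self[OF pos_def_invertible pos_def_inverse_hermitian, OF pencil_pos_def[OF int z] pencil_pos_def[OF int z]]
        by (simp add: inner_commute)
      then show "adjoint_op L z \<bullet> matrix_inv (pencil L z)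
          = real CARD('m) - matrix_inv (F z) \<bullet> matrix_inv (pencil L z)"
        by (simp add: pencil_def inner_add algebra_simps)
    qed
    also have "\<dots> \<le> (LINT z|circle. real CARD('m) - \<beta> * (mat 1 \<bullet> matrix_inv (pencil L z)))"
    proof (rule integral_circle_mono)
      fix z assume z: "z \<in> circ"
      have "0 \<le> matrix_inv (pencil L z) \<bullet> (matrix_inv (F z) - \<beta> *\<^sub>R mat 1)"
        by (intro pos_semidef_inner_nonneg F\<beta> z pos_def_imp_semidef pos_def_matrix_inv pencil_pos_def int)
      then show "real CARD('m) - matrix_inv (F z) \<bullet> matrix_inv (pencil L z)
          \<le> real CARD('m) - \<beta> * (mat 1 \<bullet> matrix_inv (pencil L z))"
        by (simp add: inner_diff inner_commute)
    qed (intro integrable_circle_continuous continuous_intros cinv)+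
    also have "\<dots> = real CARD('m) - \<beta> * (LINT z|circle. mat 1 \<bullet> matrix_inv (pencil L z))"
    proof -
      have "integrable circle (\<lambda>z. mat 1 \<bullet> matrix_inv (pencil L z))"
        by (intro integrable_circle_continuous continuous_intros cinv)
      then show ?thesis by simp
    qed
    finally have up: "\<beta> * (LINT z|circle. mat 1 \<bullet> matrix_inv (pencil L z)) \<le> real CARD('m) - trace L" by simp
    have "- trace L \<le> norm (mat 1 :: complex^'n^'n) * norm L"
      using norm_cauchy_schwarz[of "- mat 1" "cmat L"] by (simp add: trace_inner)
    also have "\<dots> \<le> norm (mat 1 :: complex^'n^'n) * R"
      using R[OF LK(1) int] L by (intro mult_left_mono) (auto simp: K'_def)
    finally have "- trace L \<le> norm (mat 1 :: complex^'n^'n) * R" .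
    with up have "\<beta> * (LINT z|circle. mat 1 \<bullet> matrix_inv (pencil L z))
        \<le> real CARD('m) + norm (mat 1 :: complex^'n^'n) * R" by linarith
    then show ?thesis using \<beta> by (simp add: T_def pos_le_divide_eq mult.commute)
  qed
  have L\<delta>: "coercive_by \<delta> L"
    using L R[OF LK(1) int] by (intro un int bound) (simp add: K'_def)
  obtain \<Phi> where \<Phi>: "symbol \<Phi>" "\<Gamma> \<Phi> = mat 1" using unit_moment_density by blast
  obtain N where "cmat N = \<Gamma> (\<lambda>z. matrix_inv (pencil L z))"
    using moment_real[OF inv_pencil_symbol[OF int]] by blast
  then have N: "N \<in> range_Gamma A B" "residual L = cmat (mat 1 - N)"
    using range_Gamma_iff inv_pencil_symbol[OF int] by (auto simp: residual_def cmat_diff)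
  define D where "D = mat 1 - N"
  have "mat 1 \<in> range_Gamma A B"
    unfolding range_Gamma_iff using \<Phi> by (intro exI[of _ \<Phi>]) simp
  then have D: "D \<in> range_Gamma A B" "residual L = cmat D"
    using N subspace_diff[OF subspace_range_Gamma] by (auto simp: D_def)
  note k = gain_pos norm_adjoint_op_le
  define e where "e = (\<delta> - s) / (gain * (norm D + 1))"
  have e: "e > 0" using s k by (simp add: e_def add_nonneg_pos)
  have "coercive_by s (L + (- e) *\<^sub>R D)"
  proof (rule coercive_by_perturb[OF L\<delta>])
    show "transpose ((- e) *\<^sub>R D) = (- e) *\<^sub>R D"
      by (simp only: transpose_scalar range_Gamma_symmetric[OF D(1)])
    fix z assume z: "z \<in> circ"
    have "norm (adjoint_op ((- e) *\<^sub>R D) z) \<le> gain * (e * norm D)"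
      using k(2)[OF z, of "(- e) *\<^sub>R D"] e by simp
    also have "\<dots> \<le> e * (gain * (norm D + 1))" using e k by (simp add: algebra_simps)
    also have "\<dots> = \<delta> - s" using k by (simp add: e_def add_nonneg_eq_0_iff)
    finally show "norm (adjoint_op ((- e) *\<^sub>R D) z) \<le> \<delta> - s" .
  qed
  moreover have "L + (- e) *\<^sub>R D \<in> range_Gamma A B"
    using LK D subspace_range_Gamma by (intro subspace_add subspace_scale)
  ultimately have "0 \<le> cmat ((- e) *\<^sub>R D) \<bullet> residual L"
    using var[of "L + (- e) *\<^sub>R D"] by simp
  then have "e * (D \<bullet> D) \<le> 0" unfolding D(2) cmat_scaleR by (simp add: inner_cmat)
  then have "D \<bullet> D \<le> 0" using e by (simp add: mult_le_0_iff)
  then have "D = 0" by (meson inner_gt_zero_iff not_le)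
  then have "residual L = 0" by (simp add: D(2))
  with LK s show ?thesis using that by blast
qed

text \<open>At a stationary point \<open>L\<close> the tangent inequalities at \<open>L\<close> and at \<open>L + t D\<close> squeeze the
  increment of the dual function between \<open>0\<close> and \<open>O(t\<^sup>2)\<close>, for every symmetric direction \<open>D\<close>.\<close>

lemma dual_fun_directional:
  assumes s: "0 < s" and L: "coercive_by s L" and stat: "residual L = 0" and D: "transpose D = D"
  shows "((\<lambda>t. (dual_fun (L + t *\<^sub>R D) - dual_fun L) / t) \<longlongrightarrow> 0) (at 0)"
    and "\<forall>\<^sub>F t in at 0. interior_point (L + t *\<^sub>R D)"
proof -
  note k = gain_pos norm_adjoint_op_le
  define e where "e = (s / 2) / (gain * (norm D + 1))"
  have e: "e > 0" using s k by (simp add: e_def add_nonneg_pos)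
  have near: "coercive_by (s / 2) (L + t *\<^sub>R D)" if "\<bar>t\<bar> < e" for t
  proof (rule coercive_by_perturb[OF L])
    show "transpose (t *\<^sub>R D) = t *\<^sub>R D" using D by (simp add: transpose_scalar)
    fix z assume z: "z \<in> circ"
    have "norm (adjoint_op (t *\<^sub>R D) z) \<le> gain * (\<bar>t\<bar> * norm D)"
      using k(2)[OF z, of "t *\<^sub>R D"] by simp
    also have "\<dots> \<le> gain * (e * (norm D + 1))"
      using that k e by (intro mult_left_mono mult_mono) auto
    also have "\<dots> = s / 2" using k by (simp add: e_def add_nonneg_eq_0_iff)
    finally show "norm (adjoint_op (t *\<^sub>R D) z) \<le> s - s / 2" by simp
  qed
  have ev: "\<forall>\<^sub>F t in at 0. \<bar>t\<bar> < e"
    using e by (auto simp: eventually_at intro!: exI[of _ e])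
  show "\<forall>\<^sub>F t in at 0. interior_point (L + t *\<^sub>R D)"
    using ev by eventually_elim (use near coercive_interior s in force)
  obtain C where C: "\<And>L M. coercive_by (s / 2) L \<Longrightarrow> coercive_by (s / 2) M \<Longrightarrow>
    norm (residual L - residual M) \<le> C * norm (L - M)" "0 \<le> C"
    using residual_lipschitz[of "s / 2"] s by auto
  have L2: "coercive_by (s / 2) L" using L s by (intro coercive_by_mono[OF L]) simp
  have bd: "norm ((dual_fun (L + t *\<^sub>R D) - dual_fun L) / t) \<le> (C * norm D * norm D) * \<bar>t\<bar>"
    if t: "\<bar>t\<bar> < e" for t
  proof -
    define N where "N = L + t *\<^sub>R D"
    have N: "coercive_by (s / 2) N" unfolding N_def by (rule near[OF t])
    have iN: "interior_point N" "interior_point L" using coercive_interior N L2 s by auto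
    have lo: "dual_fun L \<le> dual_fun N" using dual_fun_tangent[OF iN(2,1)] by (simp add: stat)
    have "dual_fun N - dual_fun L \<le> cmat (N - L) \<bullet> residual N"
      using dual_fun_tangent[OF iN] by (simp add: cmat_diff inner_diff)
    also have "\<dots> \<le> norm (cmat (N - L)) * norm (residual N)" by (rule norm_cauchy_schwarz)
    also have "\<dots> \<le> norm (N - L) * (C * norm (N - L))"
      using C(1)[OF N L2] by (simp add: stat mult_left_mono)
    also have "\<dots> = (C * norm D * norm D * \<bar>t\<bar>) * \<bar>t\<bar>" by (simp add: N_def mult_ac)
    finally show ?thesis using lo
      by (cases "t = 0") (simp_all add: N_def pos_divide_le_eq)
  qed
  show "((\<lambda>t. (dual_fun (L + t *\<^sub>R D) - dual_fun L) / t) \<longlongrightarrow> 0) (at 0)"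
  proof (rule Lim_null_comparison)
    show "\<forall>\<^sub>F t in at 0. norm ((dual_fun (L + t *\<^sub>R D) - dual_fun L) / t) \<le> (C * norm D * norm D) * \<bar>t\<bar>"
      using ev by eventually_elim (rule bd)
    show "((\<lambda>t. (C * norm D * norm D) * \<bar>t\<bar>) \<longlongrightarrow> 0) (at 0)"
      by (auto intro!: tendsto_eq_intros)
  qed
qed

end

section \<open>Determinants\<close>

subsection \<open>The Cauchy--Binet formula\<close>

text \<open>The sum runs over all maps instead of the subsets of indices, which accounts for the
  factorial.\<close>

lemma cauchy_binet:
  fixes L :: "'m::finite \<Rightarrow> 'l::finite \<Rightarrow> 'a::comm_ring_1" and K :: "'l \<Rightarrow> 'm \<Rightarrow> 'a"
  shows "of_nat (fact CARD('m)) * det (\<chi> i j. \<Sum>l\<in>UNIV. L i l * K l j)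
    = (\<Sum>\<phi>\<in>UNIV. det (\<chi> i j. L i (\<phi> j)) * det (\<chi> i j. K (\<phi> i) j))"
proof -
  let ?P = "{p. p permutes (UNIV :: 'm set)}"
  define d where "d \<phi> = det (\<chi> i j. K (\<phi> i) j)" for \<phi> :: "'m \<Rightarrow> 'l"
  have "det (\<chi> i j. \<Sum>l\<in>UNIV. L i l * K l j)
      = (\<Sum>p\<in>?P. of_int (sign p) * (\<Sum>\<phi>\<in>UNIV. \<Prod>i\<in>UNIV. L i (\<phi> i) * K (\<phi> i) (p i)))"
    unfolding det_def by (simp add: prod_sum_PiE)
  also have "\<dots> = (\<Sum>\<phi>\<in>UNIV. \<Sum>p\<in>?P. of_int (sign p) * (\<Prod>i\<in>UNIV. L i (\<phi> i) * K (\<phi> i) (p i)))"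
    unfolding sum_distrib_left by (rule sum.swap)
  also have "\<dots> = (\<Sum>\<phi>\<in>UNIV. (\<Prod>i\<in>UNIV. L i (\<phi> i)) * d \<phi>)"
    by (simp add: d_def det_def prod.distrib sum_distrib_left mult_ac)
  finally have expand: "det (\<chi> i j. \<Sum>l\<in>UNIV. L i l * K l j) = (\<Sum>\<phi>\<in>UNIV. (\<Prod>i\<in>UNIV. L i (\<phi> i)) * d \<phi>)" .
  have perm: "(\<Sum>\<phi>\<in>UNIV. (\<Prod>i\<in>UNIV. L i (\<phi> i)) * d \<phi>)
      = (\<Sum>\<phi>\<in>UNIV. d \<phi> * (of_int (sign p) * (\<Prod>i\<in>UNIV. L i (\<phi> (p i)))))" if p: "p \<in> ?P" for p
  proof -
    have "(\<Sum>\<phi>\<in>UNIV. (\<Prod>i\<in>UNIV. L i (\<phi> i)) * d \<phi>)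
        = (\<Sum>\<phi>\<in>UNIV. (\<Prod>i\<in>UNIV. L i ((\<phi> \<circ> p) i)) * d (\<phi> \<circ> p))"
      using p by (intro sum.reindex_bij_witness[of _ "\<lambda>\<phi>. \<phi> \<circ> p" "\<lambda>\<phi>. \<phi> \<circ> inv p"])
        (auto simp: o_assoc[symmetric] permutes_inv_o)
    moreover have "d (\<phi> \<circ> p) = of_int (sign p) * d \<phi>" for \<phi>
      using det_permute_rows[of p "\<chi> i j. K (\<phi> i) j"] p by (simp add: d_def)
    ultimately show ?thesis by (simp add: mult_ac)
  qed
  have "of_nat (fact CARD('m)) * det (\<chi> i j. \<Sum>l\<in>UNIV. L i l * K l j)
      = (\<Sum>p\<in>?P. \<Sum>\<phi>\<in>UNIV. (\<Prod>i\<in>UNIV. L i (\<phi> i)) * d \<phi>)"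
    unfolding expand by (simp add: card_permutations[OF refl])
  also have "\<dots> = (\<Sum>p\<in>?P. \<Sum>\<phi>\<in>UNIV. d \<phi> * (of_int (sign p) * (\<Prod>i\<in>UNIV. L i (\<phi> (p i)))))"
    by (rule sum.cong[OF refl perm])
  also have "\<dots> = (\<Sum>\<phi>\<in>UNIV. \<Sum>p\<in>?P. d \<phi> * (of_int (sign p) * (\<Prod>i\<in>UNIV. L i (\<phi> (p i)))))"
    by (rule sum.swap)
  also have "\<dots> = (\<Sum>\<phi>\<in>UNIV. det (\<chi> i j. L i (\<phi> j)) * d \<phi>)"
    by (simp add: det_def sum_distrib_left mult_ac)
  finally show ?thesis by (simp add: d_def)
qed

subsection \<open>Block matrices\<close>

definition block :: "'a^'s^'s \<Rightarrow> 'a^'m^'s \<Rightarrow> 'a^'s^'m \<Rightarrow> 'a^'m^'m \<Rightarrow> 'a^('s+'m)^('s+'m)" where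
  "block P X Y Z = (\<chi> i j. case i of
      Inl i \<Rightarrow> (case j of Inl j \<Rightarrow> P $ i $ j | Inr j \<Rightarrow> X $ i $ j)
    | Inr i \<Rightarrow> (case j of Inl j \<Rightarrow> Y $ i $ j | Inr j \<Rightarrow> Z $ i $ j))"

lemma block_nth [simp]:
  "block P X Y Z $ Inl i $ Inl j = P $ i $ j" "block P X Y Z $ Inl i $ Inr k = X $ i $ k"
  "block P X Y Z $ Inr k $ Inl j = Y $ k $ j" "block P X Y Z $ Inr k $ Inr l = Z $ k $ l"
  by (simp_all add: block_def)

lemma sum_UNIV_Plus: "(\<Sum>i\<in>UNIV. f i) = (\<Sum>i\<in>UNIV. f (Inl i)) + (\<Sum>i\<in>UNIV. f (Inr i))"
  for f :: "'a::finite + 'b::finite \<Rightarrow> 'c::comm_monoid_add"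
  by (subst UNIV_Plus_UNIV[symmetric], subst sum.Plus) auto

lemma prod_UNIV_Plus: "(\<Prod>i\<in>UNIV. f i) = (\<Prod>i\<in>UNIV. f (Inl i)) * (\<Prod>i\<in>UNIV. f (Inr i))"
  for f :: "'a::finite + 'b::finite \<Rightarrow> 'c::comm_monoid_mult"
  by (subst UNIV_Plus_UNIV[symmetric], subst prod.Plus) auto

lemma vec_eq_Plus: "x = y \<longleftrightarrow> (\<forall>i. x $ Inl i = y $ Inl i) \<and> (\<forall>i. x $ Inr i = y $ Inr i)"
  by (simp add: vec_eq_iff) (metis sum.exhaust)

lemma block_mult:
  "block P X Y Z ** block P' X' Y' Z' =
    block (P ** P' + X ** Y') (P ** X' + X ** Z') (Y ** P' + Z ** Y') (Y ** X' + Z ** Z')"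
  by (simp add: vec_eq_Plus mult_nth sum_UNIV_Plus)

lemma map_sum_permutes:
  assumes "p permutes (UNIV :: 'a::finite set)" "q permutes (UNIV :: 'b::finite set)"
  shows "map_sum p q permutes UNIV" "sign (map_sum p q) = sign p * sign q"
proof -
  have 1: "map_sum p id = map_permutation UNIV (Inl :: 'a \<Rightarrow> 'a + 'b) p"
    by (auto simp: fun_eq_iff map_permutation_def restrict_id_def split: sum.split)
       (case_tac x; auto)+
  have 2: "map_sum id q = map_permutation UNIV (Inr :: 'b \<Rightarrow> 'a + 'b) q"
    by (auto simp: fun_eq_iff map_permutation_def restrict_id_def split: sum.split)
       (case_tac x; auto)+
  have p1: "map_sum p id permutes (UNIV :: ('a + 'b) set)"
    unfolding 1 using map_permutation_permutes[of Inl UNIV "range (Inl :: 'a \<Rightarrow> 'a + 'b)" p] assms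
    by (auto simp: bij_betw_def intro: permutes_subset)
  have p2: "map_sum id q permutes (UNIV :: ('a + 'b) set)"
    unfolding 2 using map_permutation_permutes[of Inr UNIV "range (Inr :: 'b \<Rightarrow> 'a + 'b)" q] assms
    by (auto simp: bij_betw_def intro: permutes_subset)
  have c: "map_sum p q = map_sum p id \<circ> map_sum id q" by (simp add: map_sum.comp)
  show "map_sum p q permutes UNIV" unfolding c by (rule permutes_compose[OF p2 p1])
  have "sign (map_sum p q) = sign (map_sum p id :: 'a + 'b \<Rightarrow> _) * sign (map_sum id q :: 'a + 'b \<Rightarrow> _)"
    unfolding c by (rule sign_compose) (use p1 p2 in \<open>auto simp: permutation_permutes\<close>)
  also have "sign (map_sum p id :: 'a + 'b \<Rightarrow> _) = sign p"
    unfolding 1 using assms by (intro sign_map_permutation) auto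
  also have "sign (map_sum id q :: 'a + 'b \<Rightarrow> _) = sign q"
    unfolding 2 using assms by (intro sign_map_permutation) auto
  finally show "sign (map_sum p q) = sign p * sign q" .
qed

text \<open>A permutation contributes only if it maps the first block of indices to itself; then it is the
  sum of two permutations.\<close>

lemma det_block_lower:
  fixes P :: "'a::comm_ring_1^'s^'s" and Z :: "'a^'m^'m"
  shows "det (block P 0 Y Z) = det P * det Z"
proof -
  let ?U = "{p. p permutes (UNIV :: ('s + 'm) set)}"
  let ?A = "{p. p permutes (UNIV :: 's set)}" and ?B = "{p. p permutes (UNIV :: 'm set)}"
  let ?t = "\<lambda>p. of_int (sign p) * (\<Prod>i\<in>UNIV. block P 0 Y Z $ i $ p i)"
  have zero: "?t p = 0" if p: "p \<in> ?U - (\<lambda>(a, b). map_sum a b) ` (?A \<times> ?B)" for p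
  proof -
    have "\<exists>i b. p (Inl i) = Inr b"
    proof (rule ccontr)
      assume none: "\<not> ?thesis"
      have bij: "bij p" using p permutes_bij by blast
      have "range (p \<circ> Inl) \<subseteq> range Inl"
        using none by (auto simp: image_iff) (metis sum.exhaust)
      moreover have "card (range (p \<circ> Inl)) = card (range (Inl :: 's \<Rightarrow> 's + 'm))"
        using bij by (subst (1 2) card_image) (auto simp: inj_compose bij_is_inj)
      ultimately have rl: "range (p \<circ> Inl) = range Inl" by (intro card_subset_eq) auto
      have inr: "\<exists>b. p (Inr k) = Inr b" for k
      proof (rule ccontr)
        assume "\<not> ?thesis"
        then obtain a where "p (Inr k) = Inl a" by (metis sum.exhaust)
        moreover have "Inl a \<in> range (p \<circ> Inl)" unfolding rl by simp
        then obtain i where "p (Inl i) = Inl a" by auto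
        ultimately have "p (Inr k) = p (Inl i)" by simp
        then show False using bij_is_inj[OF bij] by (simp add: inj_eq)
      qed
      define a where "a i = projl (p (Inl i))" for i
      define b where "b i = projr (p (Inr i))" for i
      have pa: "p (Inl i) = Inl (a i)" for i using none by (metis a_def sum.collapse(1) sum.collapse(2) sum.exhaust sum.sel(1))
      have pb: "p (Inr i) = Inr (b i)" for i using inr[of i] by (auto simp: b_def)
      have "p = map_sum a b" by (rule ext) (metis map_sum.simps pa pb sum.exhaust)
      moreover have "inj a" "inj b"
        using bij pa pb by (auto simp: inj_on_def bij_def) (metis sum.inject)+
      then have "bij a" "bij b" by (simp_all add: bij_def finite_UNIV_inj_surj)
      then have "a permutes UNIV" "b permutes UNIV" by (auto intro: bij_imp_permutes)
      ultimately show False using p by auto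
    qed
    then obtain i b where "p (Inl i) = Inr b" by blast
    then have "block P 0 Y Z $ Inl i $ p (Inl i) = 0" by simp
    then have "(\<Prod>i\<in>UNIV. block P 0 Y Z $ i $ p i) = 0"
      by (intro prod_zero) auto
    then show ?thesis by simp
  qed
  have "det (block P 0 Y Z) = sum ?t ((\<lambda>(a, b). map_sum a b) ` (?A \<times> ?B))"
    unfolding det_def
    by (rule sum.mono_neutral_right) (use zero map_sum_permutes in \<open>auto simp: finite_permutations\<close>)
  also have "\<dots> = (\<Sum>(a, b)\<in>?A \<times> ?B. ?t (map_sum a b))"
  proof (subst sum.reindex)
    show "inj_on (\<lambda>(a, b). map_sum a b) (?A \<times> ?B)"
      by (auto simp: inj_on_def fun_eq_iff) (metis map_sum.simps sum.inject)+
  qed (simp add: case_prod_unfold)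
  also have "\<dots> = (\<Sum>(a, b)\<in>?A \<times> ?B. (of_int (sign a) * (\<Prod>i\<in>UNIV. P $ i $ a i)) *
      (of_int (sign b) * (\<Prod>i\<in>UNIV. Z $ i $ b i)))"
    by (rule sum.cong) (auto simp: map_sum_permutes prod_UNIV_Plus mult_ac)
  also have "\<dots> = det P * det Z"
    unfolding det_def sum_product sum.cartesian_product by simp
  finally show ?thesis .
qed

lemma det_block_schur:
  fixes P :: "'a::comm_ring_1^'s^'s" and Z :: "'a^'m^'m"
  assumes "P ** V = X"
  shows "det (block P (- X) Y Z) = det P * det (Z + Y ** V)"
proof -
  have "block P (- X) Y Z ** block (mat 1) V 0 (mat 1) = block P 0 Y (Z + Y ** V)"
    unfolding block_mult by (simp add: assms add.commute)
  then have "det (block P (- X) Y Z) * det (block (mat 1) V 0 (mat 1)) = det P * det (Z + Y ** V)"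
    unfolding det_mul[symmetric] by (simp add: det_block_lower)
  moreover have "block (mat 1) V 0 (mat 1) = transpose (block (mat 1) 0 (transpose V) (mat 1))"
    by (simp add: vec_eq_Plus transpose_def mat_def)
  ultimately show ?thesis by (simp add: det_block_lower)
qed

subsection \<open>Polynomial matrices\<close>

definition eval_mat :: "complex poly^'n^'k \<Rightarrow> complex \<Rightarrow> complex^'n^'k" where
  "eval_mat M z = (\<chi> i j. poly (M $ i $ j) z)"

lemma eval_mat_nth [simp]: "eval_mat M z $ i $ j = poly (M $ i $ j) z"
  by (simp add: eval_mat_def)

lemma poly_det: "poly (det M) z = det (eval_mat M z)"
  by (simp add: det_def poly_sum poly_prod)

lemma eval_mat_mult: "eval_mat (M ** N) z = eval_mat M z ** eval_mat N z"
  by (simp add: vec_eq_iff mult_nth poly_sum)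

lemma eval_mat_block:
  "eval_mat (block P X Y Z) z = block (eval_mat P z) (eval_mat X z) (eval_mat Y z) (eval_mat Z z)"
  by (simp add: vec_eq_Plus)

lemma eval_mat_uminus: "eval_mat (- M) z = - eval_mat M z"
  by (simp add: vec_eq_iff)

lemma degree_det_le:
  fixes M :: "complex poly^'n^'n"
  assumes "\<And>i j. degree (M $ i $ j) \<le> d j"
  shows "degree (det M) \<le> (\<Sum>j\<in>UNIV. d j)"
  unfolding det_def
proof (rule degree_sum_le)
  fix p assume "p \<in> {p. p permutes (UNIV :: 'n set)}"
  then have p: "p permutes UNIV" by simp
  have "degree (of_int (sign p) * (\<Prod>i\<in>UNIV. M $ i $ p i)) \<le> 0 + degree (\<Prod>i\<in>UNIV. M $ i $ p i)"
    by (rule order_trans[OF degree_mult_le]) simp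
  also have "\<dots> \<le> (\<Sum>i\<in>UNIV. degree (M $ i $ p i))"
    using degree_prod_sum_le[of UNIV "\<lambda>i. M $ i $ p i"] by (simp add: o_def)
  also have "\<dots> \<le> (\<Sum>i\<in>UNIV. d (p i))" by (intro sum_mono assms)
  also have "\<dots> = (\<Sum>j\<in>UNIV. d j)" using p by (rule sum.permute[symmetric, unfolded o_def])
  finally show "degree (of_int (sign p) * (\<Prod>i\<in>UNIV. M $ i $ p i)) \<le> (\<Sum>j\<in>UNIV. d j)" .
qed simp

lemma poly_eq_cofinite:
  fixes p q r :: "complex poly"
  assumes "r \<noteq> 0" "\<And>z. poly r z \<noteq> 0 \<Longrightarrow> poly p z = poly q z"
  shows "p = q"
proof -
  have "poly (r * (p - q)) z = 0" for z using assms(2)[of z] by (cases "poly r z = 0") auto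
  then have "r * (p - q) = 0" using poly_all_0_iff_0 by blast
  then show ?thesis using assms(1) by simp
qed

section \<open>The McMillan degree\<close>

subsection \<open>Minors as maximal minors\<close>

text \<open>The square matrix formed from columns of \<open>[q I, N]\<close>; its determinants are, up to powers of
  \<open>q\<close>, the minors of \<open>N\<close> of all orders.\<close>

definition select :: "'a::comm_ring_1 \<Rightarrow> 'a^'m^'m \<Rightarrow> ('m \<Rightarrow> 'm option) \<Rightarrow> 'a^'m^'m" where
  "select q N h = (\<chi> i j. case h j of None \<Rightarrow> if i = j then q else 0 | Some a \<Rightarrow> N $ i $ a)"

lemma select_nth: "select q N h $ i $ j = (case h j of None \<Rightarrow> if i = j then q else 0 | Some a \<Rightarrow> N $ i $ a)"
  by (simp add: select_def)

lemma det_select_None: "det (select q N (\<lambda>j. None)) = q ^ CARD('m)" for N :: "'a::comm_ring_1^'m^'m"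
  by (subst det_diagonal) (simp_all add: select_nth)

lemma minor_0: "minor 0 r c N = 1"
  by (simp add: minor_def)

text \<open>A column outside the range of \<open>r\<close> is a multiple of a unit vector, so that only the permutations
  that move nothing outside this range contribute.\<close>

lemma det_select:
  fixes N :: "'a::comm_ring_1^'m^'m" and r c :: "nat \<Rightarrow> 'm"
  assumes r: "inj_on r {..<k}"
    and h: "\<And>i. i < k \<Longrightarrow> h (r i) = Some (c i)" "\<And>j. j \<notin> r ` {..<k} \<Longrightarrow> h j = None"
  shows "det (select q N h) = q ^ (CARD('m) - k) * minor k r c N"
proof -
  let ?R = "r ` {..<k}"
  let ?t = "\<lambda>p. of_int (sign p) * (\<Prod>i\<in>UNIV. select q N h $ i $ p i)"
  have bij: "bij_betw r {..<k} ?R" using r by (simp add: bij_betw_def)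
  have cR: "card (UNIV - ?R) = CARD('m) - k"
    by (subst card_Diff_subset) (simp_all add: card_image[OF r])
  have zero: "?t p = 0" if p: "p \<in> {p. p permutes UNIV} - {p. p permutes ?R}" for p
  proof -
    have "\<exists>j. j \<notin> ?R \<and> p j \<noteq> j"
      using p by (auto simp: permutes_def)
    then obtain j where j: "j \<notin> ?R" "p j \<noteq> j" by blast
    obtain i where i: "p i = j" using p permutes_surj by (metis DiffD1 mem_Collect_eq surjD)
    then have "select q N h $ i $ p i = 0" using j h(2)[OF j(1)] by (auto simp: select_nth)
    then have "(\<Prod>i\<in>UNIV. select q N h $ i $ p i) = 0" by (intro prod_zero) auto
    then show ?thesis by simp
  qed
  have summand: "?t (map_permutation {..<k} r p)
      = q ^ (CARD('m) - k) * (of_int (sign p) * (\<Prod>i<k. N $ r i $ c (p i)))"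
    if p: "p permutes {..<k}" for p
  proof -
    let ?s = "map_permutation {..<k} r p"
    have s: "?s permutes ?R" by (rule map_permutation_permutes[OF bij p])
    have "(\<Prod>i\<in>UNIV. select q N h $ i $ ?s i)
        = (\<Prod>i\<in>UNIV - ?R. select q N h $ i $ ?s i) * (\<Prod>i\<in>?R. select q N h $ i $ ?s i)"
      by (rule prod.subset_diff) auto
    also have "(\<Prod>i\<in>UNIV - ?R. select q N h $ i $ ?s i) = (\<Prod>i\<in>UNIV - ?R. q)"
      using s h(2) by (intro prod.cong) (auto simp: permutes_not_in select_nth)
    also have "\<dots> = q ^ (CARD('m) - k)" by (simp add: cR)
    also have "(\<Prod>i\<in>?R. select q N h $ i $ ?s i) = (\<Prod>i<k. select q N h $ r i $ ?s (r i))"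
      by (simp add: prod.reindex[OF r])
    also have "\<dots> = (\<Prod>i<k. N $ r i $ c (p i))"
    proof (rule prod.cong)
      fix i assume i: "i \<in> {..<k}"
      then have "p i < k" using permutes_in_image[OF p] by auto
      then show "select q N h $ r i $ ?s (r i) = N $ r i $ c (p i)"
        using i by (simp add: map_permutation_apply[OF r] select_nth h)
    qed simp
    finally show ?thesis by (simp add: sign_map_permutation[OF r p] mult_ac)
  qed
  have "det (select q N h) = (\<Sum>p | p permutes ?R. ?t p)"
    unfolding det_def
    by (rule sum.mono_neutral_right) (use zero in \<open>auto simp: finite_permutations intro: permutes_subset\<close>)
  also have "\<dots> = (\<Sum>p | p permutes {..<k}. q ^ (CARD('m) - k) * (of_int (sign p) * (\<Prod>i<k. N $ r i $ c (p i))))"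
  proof (rule sum.reindex_bij_witness[of _ "map_permutation {..<k} r" "map_permutation ?R (inv_into {..<k} r)"])
    fix p assume p: "p \<in> {p. p permutes ?R}"
    then show "map_permutation ?R (inv_into {..<k} r) p \<in> {p. p permutes {..<k}}"
      using map_permutation_permutes[OF bij_betw_inv_into[OF bij]] by simp
    show inv: "map_permutation {..<k} r (map_permutation ?R (inv_into {..<k} r) p) = p"
      using p by (intro map_permutation_compose_inv[OF bij_betw_inv_into[OF bij]]) (auto simp: f_inv_into_f)
    show "q ^ (CARD('m) - k) * (of_int (sign (map_permutation ?R (inv_into {..<k} r) p)) *
        (\<Prod>i<k. N $ r i $ c (map_permutation ?R (inv_into {..<k} r) p i))) = ?t p"
      using summand[OF map_permutation_permutes[OF bij_betw_inv_into[OF bij]], of p] p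
      unfolding inv by (metis mem_Collect_eq)
  next
    fix p assume p: "p \<in> {p. p permutes {..<k}}"
    then show "map_permutation {..<k} r p \<in> {p. p permutes ?R}"
      using map_permutation_permutes[OF bij] by simp
    show "map_permutation ?R (inv_into {..<k} r) (map_permutation {..<k} r p) = p"
      using p r by (intro map_permutation_compose_inv[OF bij]) auto
  qed
  finally show ?thesis by (simp add: minor_def sum_distrib_left)
qed

lemma minor_not_inj:
  fixes N :: "complex poly^'m^'m"
  assumes "\<not> inj_on r {..<k}"
  shows "minor k r c N = 0"
proof -
  obtain a b where ab: "a < k" "b < k" "a \<noteq> b" "r a = r b" using assms by (auto simp: inj_on_def)
  define t where "t = Transposition.transpose a b"
  have t: "t permutes {..<k}" unfolding t_def using ab by (intro permutes_swap_id) auto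
  have rt: "r (t i) = r i" for i using ab by (auto simp: t_def Transposition.transpose_def)
  let ?f = "\<lambda>p. of_int (sign p) * (\<Prod>i<k. N $ r i $ c (p i))"
  have "minor k r c N = (\<Sum>p | p permutes {..<k}. ?f (p \<circ> t))"
    unfolding minor_def by (rule sum_permutations_compose_right[OF t])
  also have "\<dots> = (\<Sum>p | p permutes {..<k}. - ?f p)"
  proof (rule sum.cong)
    fix p assume "p \<in> {p. p permutes {..<k}}"
    then have p: "permutation p" "permutation t"
      using t by (auto simp: permutation_permutes intro: finite_lessThan)
    have "sign (p \<circ> t) = - sign p"
      using sign_compose[OF p] ab by (simp add: t_def sign_swap_id)
    moreover have "(\<Prod>i<k. N $ r i $ c ((p \<circ> t) i)) = (\<Prod>i<k. N $ r i $ c (p i))"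
    proof -
      have "(\<lambda>i. N $ r i $ c ((p \<circ> t) i)) = (\<lambda>i. N $ r i $ c (p i)) \<circ> t"
        by (rule ext) (simp only: o_apply rt)
      then show ?thesis using prod.permute[OF t, of "\<lambda>i. N $ r i $ c (p i)"] by (simp only:)
    qed
    ultimately show "?f (p \<circ> t) = - ?f p" by (simp only: of_int_minus mult_minus_left)
  qed simp
  also have "\<dots> = - minor k r c N" by (simp add: minor_def sum_negf)
  finally have "2 * minor k r c N = 0" unfolding eq_neg_iff_add_eq_0 mult_2 .
  then show ?thesis by simp
qed

lemma minor_select:
  fixes N :: "complex poly^'m^'m"
  assumes "minor k r c N \<noteq> 0"
  obtains h where "det (select q N h) = q ^ (CARD('m) - k) * minor k r c N"
proof -
  have r: "inj_on r {..<k}" using assms minor_not_inj by blast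
  define h where "h j = (if j \<in> r ` {..<k} then Some (c (inv_into {..<k} r j)) else None)" for j
  have "det (select q N h) = q ^ (CARD('m) - k) * minor k r c N"
    by (rule det_select[OF r]) (use r in \<open>auto simp: h_def\<close>)
  then show ?thesis by (rule that)
qed

lemma select_minor:
  fixes N :: "complex poly^'m^'m" and h :: "'m \<Rightarrow> 'm option"
  obtains k r c where "k \<le> CARD('m)" "det (select q N h) = q ^ (CARD('m) - k) * minor k r c N"
proof -
  define R where "R = {j. h j \<noteq> None}"
  obtain r :: "nat \<Rightarrow> 'm" where "bij_betw r {0..<card R} R" using ex_bij_betw_nat_finite[of R] by auto
  then have r: "inj_on r {..<card R}" "r ` {..<card R} = R"
    by (auto simp: bij_betw_def lessThan_atLeast0)
  have "det (select q N h) = q ^ (CARD('m) - card R) * minor (card R) r (\<lambda>i. the (h (r i))) N"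
  proof (rule det_select[OF r(1)])
    fix i assume "i < card R"
    then have "r i \<in> R" using r(2) by blast
    then show "h (r i) = Some (the (h (r i)))" by (simp add: R_def)
  qed (use r(2) in \<open>auto simp: R_def\<close>)
  moreover have "card R \<le> CARD('m)" by (rule card_mono) auto
  ultimately show ?thesis using that by blast
qed

subsection \<open>The degree as the degree of a projective curve\<close>

lemma pole_degree_ge:
  fixes N :: "complex poly^'m^'m"
  assumes "k \<le> CARD('m)" "minor k r c N \<noteq> 0"
  shows "k * order a q - order a (minor k r c N) \<le> pole_degree a N q"
  unfolding pole_degree_def
proof (rule Max_ge)
  show "finite {k * order a q - order a (minor k r c N) |k r c. k \<le> CARD('m) \<and> minor k r c N \<noteq> 0}"
    by (rule finite_subset[of _ "{..CARD('m) * order a q}"])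
       (auto intro: order_trans[OF diff_le_self])
qed (use assms in blast)

lemma pole_degree_le:
  fixes N :: "complex poly^'m^'m"
  assumes "\<And>k r c. k \<le> CARD('m) \<Longrightarrow> minor k r c N \<noteq> 0 \<Longrightarrow> k * order a q - order a (minor k r c N) \<le> D"
  shows "pole_degree a N q \<le> D"
  unfolding pole_degree_def
proof (rule Max.boundedI)
  show "finite {k * order a q - order a (minor k r c N) |k r c. k \<le> CARD('m) \<and> minor k r c N \<noteq> 0}"
    by (rule finite_subset[of _ "{..CARD('m) * order a q}"])
       (auto intro: order_trans[OF diff_le_self])
  have "minor 0 undefined undefined N \<noteq> 0" by (simp add: minor_0)
  then show "{k * order a q - order a (minor k r c N) |k r c. k \<le> CARD('m) \<and> minor k r c N \<noteq> 0} \<noteq> {}"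
    by blast
qed (use assms in blast)

lemma finite_inf_degrees:
  fixes N :: "complex poly^'m^'m" and q :: "complex poly"
  assumes q: "q \<noteq> 0"
  shows "finite {degree (minor k r c N) - k * degree q | k r c. k \<le> CARD('m) \<and> minor k r c N \<noteq> 0}"
proof (rule finite_subset)
  show "{degree (minor k r c N) - k * degree q | k r c. k \<le> CARD('m) \<and> minor k r c N \<noteq> 0}
      \<subseteq> {..(\<Sum>h\<in>UNIV. degree (det (select q N h)))}"
  proof
    fix x assume "x \<in> {degree (minor k r c N) - k * degree q | k r c. k \<le> CARD('m) \<and> minor k r c N \<noteq> 0}"
    then obtain k and r c :: "nat \<Rightarrow> 'm"
      where x: "x = degree (minor k r c N) - k * degree q" and m: "minor k r c N \<noteq> 0" by blast
    obtain h where h: "det (select q N h) = q ^ (CARD('m) - k) * minor k r c N"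
      using minor_select[OF m] by blast
    have "degree (minor k r c N) - k * degree q \<le> degree (det (select q N h))"
      using m q by (simp add: h degree_mult_eq)
    also have "\<dots> \<le> (\<Sum>h\<in>UNIV. degree (det (select q N h)))"
      by (rule member_le_sum) auto
    finally show "x \<in> {..(\<Sum>h\<in>UNIV. degree (det (select q N h)))}"
      by (simp add: x)
  qed
qed simp

lemma pole_degree_inf_ge:
  fixes N :: "complex poly^'m^'m"
  assumes "q \<noteq> 0" "k \<le> CARD('m)" "minor k r c N \<noteq> 0"
  shows "degree (minor k r c N) - k * degree q \<le> pole_degree_inf N q"
  unfolding pole_degree_inf_def by (rule Max_ge[OF finite_inf_degrees]) (use assms in auto)

lemma pole_degree_inf_le:
  fixes N :: "complex poly^'m^'m"
  assumes "q \<noteq> 0"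
    "\<And>k r c. k \<le> CARD('m) \<Longrightarrow> minor k r c N \<noteq> 0 \<Longrightarrow> degree (minor k r c N) - k * degree q \<le> D"
  shows "pole_degree_inf N q \<le> D"
  unfolding pole_degree_inf_def
proof (rule Max.boundedI[OF finite_inf_degrees[OF assms(1)]])
  have "minor 0 undefined undefined N \<noteq> 0" by (simp add: minor_0)
  then show "{degree (minor k r c N) - k * degree q |k r c. k \<le> CARD('m) \<and> minor k r c N \<noteq> 0} \<noteq> {}"
    by blast
qed (use assms in blast)

lemma order_power_eq: "p \<noteq> 0 \<Longrightarrow> order a (p ^ n) = n * order a p" for p :: "complex poly"
  by (induction n) (simp_all add: order_mult)

lemma prod_linear_powers_dvd:
  fixes p :: "complex poly"
  assumes p: "p \<noteq> 0" and S: "finite S" and e: "\<And>a. a \<in> S \<Longrightarrow> e a \<le> order a p"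
  shows "(\<Prod>a\<in>S. [:-a, 1:] ^ e a) dvd p"
proof -
  define T where "T = S \<union> {z. poly p z = 0}"
  have T: "finite T" using S poly_roots_finite[OF p] by (simp add: T_def)
  have "(\<Prod>a\<in>S. [:-a, 1:] ^ e a) dvd (\<Prod>a\<in>S. [:-a, 1:] ^ order a p)"
    using e by (intro prod_dvd_prod le_imp_power_dvd)
  also have "\<dots> dvd (\<Prod>a\<in>T. [:-a, 1:] ^ order a p)"
    using T by (intro prod_dvd_prod_subset) (auto simp: T_def)
  also have "(\<Prod>a\<in>T. [:-a, 1:] ^ order a p) = (\<Prod>z|poly p z = 0. [:-z, 1:] ^ order z p)"
    using T by (intro prod.mono_neutral_right) (auto simp: T_def order_root p)
  also have "\<dots> dvd p"
    by (subst (2) complex_poly_decompose[of p, symmetric]) (rule dvd_smult, simp)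
  finally show ?thesis .
qed

lemma sum_order_superset:
  fixes p :: "complex poly"
  assumes p: "p \<noteq> 0" and S: "finite S" "{z. poly p z = 0} \<subseteq> S"
  shows "(\<Sum>a\<in>S. order a p) = degree p"
proof -
  have "(\<Sum>a\<in>S. order a p) = (\<Sum>z|poly p z = 0. order z p)"
    using S by (intro sum.mono_neutral_right) (auto simp: order_root p)
  also have "\<dots> = degree (smult (lead_coeff p) (\<Prod>z|poly p z = 0. [:-z, 1:] ^ order z p))"
    using p by (simp add: degree_prod_sum_eq degree_power_eq)
  also have "\<dots> = degree p" by (simp only: complex_poly_decompose)
  finally show ?thesis .
qed

text \<open>Let \<open>g\<close> be the greatest common divisor of the maximal minors of \<open>[q I, N]\<close>. The pole degree
  at \<open>a\<close> is the order of \<open>q ^ m / g\<close> at \<open>a\<close>, so that the degree of \<open>N / q\<close> is the maximal degree of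
  a maximal minor, minus the degree of \<open>g\<close>. In this form the degree is invariant when \<open>[q I, N]\<close> is
  multiplied from the left by a nonsingular matrix.\<close>

lemma rational_degree_common_divisor:
  fixes N :: "complex poly^'m^'m"
  assumes q: "q \<noteq> 0"
  obtains g where "g \<noteq> 0" "\<And>h. \<exists>u. det (select q N h) = g * u \<and> degree u \<le> rational_degree N q"
proof -
  let ?S = "{a. poly q a = 0}"
  define e where "e a = CARD('m) * order a q - pole_degree a N q" for a
  define g where "g = (\<Prod>a\<in>?S. [:-a, 1:] ^ e a)"
  have S: "finite ?S" by (rule poly_roots_finite[OF q])
  have g: "g \<noteq> 0" by (simp add: g_def S)
  have pd: "pole_degree a N q \<le> CARD('m) * order a q" for a
  proof (rule pole_degree_le)
    fix k :: nat and r c :: "nat \<Rightarrow> 'm" assume k: "k \<le> CARD('m)"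
    have "k * order a q - order a (minor k r c N) \<le> k * order a q" by simp
    also have "\<dots> \<le> CARD('m) * order a q" using k by (rule mult_right_mono) simp
    finally show "k * order a q - order a (minor k r c N) \<le> CARD('m) * order a q" .
  qed
  have "degree g = (\<Sum>a\<in>?S. e a)" by (simp add: g_def degree_prod_sum_eq degree_power_eq)
  also have "\<dots> + (\<Sum>a\<in>?S. pole_degree a N q) = (\<Sum>a\<in>?S. CARD('m) * order a q)"
    unfolding sum.distrib[symmetric] using pd by (simp add: e_def)
  also have "\<dots> = CARD('m) * degree q"
    by (simp add: sum_distrib_left[symmetric] sum_order_superset[OF q S])
  finally have dg: "degree g + (\<Sum>a\<in>?S. pole_degree a N q) = CARD('m) * degree q" .
  have "\<exists>u. det (select q N h) = g * u \<and> degree u \<le> rational_degree N q" for h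
  proof (cases "det (select q N h) = 0")
    case True
    then show ?thesis by (intro exI[of _ 0]) simp
  next
    case False
    obtain k r c where k: "k \<le> CARD('m)" and sel: "det (select q N h) = q ^ (CARD('m) - k) * minor k r c N"
      using select_minor by blast
    have m: "minor k r c N \<noteq> 0" using False sel by auto
    have "g dvd det (select q N h)"
      unfolding g_def
    proof (rule prod_linear_powers_dvd[OF False S])
      fix a
      have "order a (det (select q N h)) = (CARD('m) - k) * order a q + order a (minor k r c N)"
        using q m by (simp add: sel order_mult order_power_eq)
      moreover have "k * order a q \<le> pole_degree a N q + order a (minor k r c N)"
        using pole_degree_ge[OF k m, of a q] by simp
      moreover have "CARD('m) * order a q = (CARD('m) - k) * order a q + k * order a q"
        using k by (simp add: add_mult_distrib[symmetric])
      ultimately show "e a \<le> order a (det (select q N h))" by (simp add: e_def)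
    qed
    then obtain u where u: "det (select q N h) = g * u" by blast
    then have u0: "u \<noteq> 0" using False by auto
    have "degree g + degree u = degree (q ^ (CARD('m) - k) * minor k r c N)"
      using g u0 u sel by (simp add: degree_mult_eq)
    also have "\<dots> = (CARD('m) - k) * degree q + degree (minor k r c N)"
      using q m by (simp add: degree_mult_eq degree_power_eq)
    also have "\<dots> \<le> (CARD('m) - k) * degree q + (k * degree q + pole_degree_inf N q)"
      using pole_degree_inf_ge[OF q k m] by simp
    also have "\<dots> = CARD('m) * degree q + pole_degree_inf N q"
      using k by (simp add: add_mult_distrib[symmetric] add.assoc[symmetric])
    finally have "degree u \<le> rational_degree N q" using dg by (simp add: rational_degree_def)
    with u show ?thesis by blast
  qed
  with g that show ?thesis by blast
qed

lemma rational_degree_le: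
  fixes N :: "complex poly^'m^'m"
  assumes q: "q \<noteq> 0" and g: "g \<noteq> 0"
    and sel: "\<And>h. \<exists>u. det (select q N h) = g * u \<and> degree u \<le> D"
  shows "rational_degree N q \<le> D"
proof -
  let ?S = "{a. poly q a = 0}"
  have S: "finite ?S" by (rule poly_roots_finite[OF q])
  obtain u where u: "q ^ CARD('m) = g * u" "degree u \<le> D"
    using sel[of "\<lambda>j. None"] by (auto simp: det_select_None)
  have u0: "u \<noteq> 0" using u q by auto
  have og: "order a g \<le> CARD('m) * order a q" for a
    using arg_cong[OF u(1), of "order a"] q g u0 by (simp add: order_mult order_power_eq)
  have dg: "CARD('m) * degree q = degree g + degree u"
    using arg_cong[OF u(1), of degree] q g u0 by (simp add: degree_mult_eq degree_power_eq)
  have "pole_degree a N q \<le> CARD('m) * order a q - order a g" for a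
  proof (rule pole_degree_le)
    fix k :: nat and r c :: "nat \<Rightarrow> 'm" assume k: "k \<le> CARD('m)" and m: "minor k r c N \<noteq> 0"
    obtain h where h: "det (select q N h) = q ^ (CARD('m) - k) * minor k r c N"
      using minor_select[OF m] by blast
    obtain t where t: "det (select q N h) = g * t" using sel by blast
    have "t \<noteq> 0" using t h q m by auto
    then have "(CARD('m) - k) * order a q + order a (minor k r c N) = order a g + order a t"
      using arg_cong[OF h[unfolded t], of "order a"] q g m by (simp add: order_mult order_power_eq)
    moreover have "(CARD('m) - k) * order a q + k * order a q = CARD('m) * order a q"
      using k by (simp add: add_mult_distrib[symmetric])
    ultimately show "k * order a q - order a (minor k r c N) \<le> CARD('m) * order a q - order a g"
      by linarith
  qed
  then have "(\<Sum>a\<in>?S. pole_degree a N q) + (\<Sum>a\<in>?S. order a g)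
      \<le> (\<Sum>a\<in>?S. CARD('m) * order a q - order a g) + (\<Sum>a\<in>?S. order a g)"
    by (intro add_right_mono sum_mono)
  also have "\<dots> = (\<Sum>a\<in>?S. CARD('m) * order a q)"
    unfolding sum.distrib[symmetric] using og by simp
  also have "\<dots> = CARD('m) * degree q"
    by (simp add: sum_distrib_left[symmetric] sum_order_superset[OF q S])
  also have "(\<Sum>a\<in>?S. order a g) = degree g"
  proof (rule sum_order_superset[OF g S])
    show "{z. poly g z = 0} \<subseteq> ?S"
    proof safe
      fix z assume "poly g z = 0"
      then have "poly (q ^ CARD('m)) z = 0" by (simp add: u)
      then show "poly q z = 0" by simp
    qed
  qed
  finally have 1: "(\<Sum>a\<in>?S. pole_degree a N q) + degree g \<le> CARD('m) * degree q" .
  have 2: "pole_degree_inf N q \<le> degree g + D - CARD('m) * degree q"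
  proof (rule pole_degree_inf_le[OF q])
    fix k :: nat and r c :: "nat \<Rightarrow> 'm" assume k: "k \<le> CARD('m)" and m: "minor k r c N \<noteq> 0"
    obtain h where h: "det (select q N h) = q ^ (CARD('m) - k) * minor k r c N"
      using minor_select[OF m] by blast
    obtain t where t: "det (select q N h) = g * t" "degree t \<le> D" using sel by blast
    have "t \<noteq> 0" using t h q m by auto
    then have "(CARD('m) - k) * degree q + degree (minor k r c N) = degree g + degree t"
      using arg_cong[OF h[unfolded t], of degree] q g m by (simp add: degree_mult_eq degree_power_eq)
    moreover have "(CARD('m) - k) * degree q + k * degree q = CARD('m) * degree q"
      using k by (simp add: add_mult_distrib[symmetric])
    ultimately show "degree (minor k r c N) - k * degree q \<le> degree g + D - CARD('m) * degree q"
      using t(2) by linarith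
  qed
  show ?thesis unfolding rational_degree_def using 1 2 dg u(2) by linarith
qed

lemma extend_injection:
  fixes \<rho> :: "'m::finite \<Rightarrow> 'm"
  assumes "inj_on \<rho> S"
  obtains \<pi> where "\<pi> permutes UNIV" "\<And>j. j \<in> S \<Longrightarrow> \<pi> j = \<rho> j"
proof -
  have "card (- S) = card (- \<rho> ` S)"
    by (simp add: Compl_eq_Diff_UNIV card_Diff_subset card_image[OF assms])
  then obtain f where f: "bij_betw f (- S) (- \<rho> ` S)"
    using finite_same_card_bij[of "- S" "- \<rho> ` S"] by auto
  define \<pi> where "\<pi> j = (if j \<in> S then \<rho> j else f j)" for j
  have "bij_betw \<pi> S (\<rho> ` S)" using assms by (auto simp: bij_betw_def \<pi>_def inj_on_def)
  moreover have "bij_betw \<pi> (- S) (- \<rho> ` S)"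
    using f by (subst bij_betw_cong[of _ _ f]) (auto simp: \<pi>_def)
  ultimately have "bij_betw \<pi> (S \<union> - S) (\<rho> ` S \<union> - \<rho> ` S)"
    by (rule bij_betw_combine) auto
  then have "\<pi> permutes UNIV" by (intro bij_imp_permutes) (auto simp: Un_commute)
  then show ?thesis using that by (simp add: \<pi>_def)
qed

definition columns_of :: "'a::comm_ring_1 \<Rightarrow> 'a^'m^'m \<Rightarrow> 'm \<Rightarrow> 'm + 'm \<Rightarrow> 'a" where
  "columns_of q N i l = (case l of Inl a \<Rightarrow> if i = a then q else 0 | Inr a \<Rightarrow> N $ i $ a)"

text \<open>A choice of columns can be permuted such that every chosen column of \<open>q I\<close> stands at its place
  in \<open>q I\<close>; two equal columns of \<open>q I\<close> make the determinant zero.\<close>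

lemma det_columns_of:
  fixes N :: "complex poly^'m^'m" and \<phi> :: "'m \<Rightarrow> 'm + 'm"
  shows "(\<exists>h s. det (\<chi> i j. columns_of q N i (\<phi> j)) = of_int s * det (select q N h))
    \<or> det (\<chi> i j. columns_of q N i (\<phi> j)) = 0"
proof (cases "inj_on (\<lambda>j. projl (\<phi> j)) {j. isl (\<phi> j)}")
  case True
  obtain \<pi> where \<pi>1: "\<pi> permutes UNIV"
    and "\<And>j. j \<in> {j. isl (\<phi> j)} \<Longrightarrow> \<pi> j = projl (\<phi> j)"
    using extend_injection[OF True] by blast
  then have \<pi>: "\<pi> permutes UNIV" "\<And>j. isl (\<phi> j) \<Longrightarrow> \<pi> j = projl (\<phi> j)"
    by auto
  define h where "h x = (case \<phi> (inv \<pi> x) of Inl _ \<Rightarrow> None | Inr a \<Rightarrow> Some a)" for x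
  have "(\<chi> i j. columns_of q N i (\<phi> j)) = (\<chi> i j. select q N h $ i $ \<pi> j)"
    using \<pi>(2) by (auto simp: vec_eq_iff columns_of_def select_nth h_def permutes_inverses[OF \<pi>(1)] isl_def
        split: sum.split)
  then have "det (\<chi> i j. columns_of q N i (\<phi> j)) = of_int (sign \<pi>) * det (select q N h)"
    by (simp add: det_permute_columns[OF \<pi>(1)])
  then show ?thesis by blast
next
  case False
  then obtain i j where ij: "i \<noteq> j" "isl (\<phi> i)" "isl (\<phi> j)" "projl (\<phi> i) = projl (\<phi> j)"
    by (auto simp: inj_on_def)
  then have "\<phi> i = \<phi> j" by (metis sum.collapse(1))
  then have "column i (\<chi> i j. columns_of q N i (\<phi> j)) = column j (\<chi> i j. columns_of q N i (\<phi> j))"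
    by (simp add: column_def)
  then show ?thesis using det_identical_columns[OF ij(1)] by blast
qed

subsection \<open>Feedback interconnection\<close>

text \<open>Let \<open>Q = C P\<^sup>-\<^sup>1 E\<close>, with \<open>E\<close> constant and with \<open>P\<close>, \<open>C\<close> of degree at most one. The
  determinants of \<open>feedback\<close> are those of columns of \<open>[q I + N Q, N]\<close>, times \<open>det P\<close>. Since
  \<open>[q I + N Q, N] = [q I, N] K\<close> for a block triangular \<open>K\<close>, they expand by the Cauchy--Binet
  formula into maximal minors of \<open>[q I, N]\<close> and of \<open>K\<close>. The latter, times \<open>det P\<close>, are
  determinants of block matrices whose degree is at most the size of \<open>P\<close>.\<close>

definition input_part :: "complex poly^'m^'s \<Rightarrow> ('m \<Rightarrow> 'm option) \<Rightarrow> complex poly^'m^'s" where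
  "input_part E h = (\<chi> i j. if h j = None then E $ i $ j else 0)"

definition feedback :: "complex poly^'s^'s \<Rightarrow> complex poly^'s^'m \<Rightarrow> complex poly^'m^'s \<Rightarrow>
    complex poly \<Rightarrow> complex poly^'m^'m \<Rightarrow> ('m \<Rightarrow> 'm option) \<Rightarrow> complex poly" where
  "feedback P C E q N h = det (block P (- input_part E h) (N ** C) (select q N h))"

definition output_part :: "complex poly^'s^'m \<Rightarrow> ('m \<Rightarrow> 'm + 'm) \<Rightarrow> complex poly^'s^'m" where
  "output_part C \<phi> = (\<chi> i j. case \<phi> i of Inl a \<Rightarrow> 0 | Inr a \<Rightarrow> C $ a $ j)"

definition selection :: "('m \<Rightarrow> 'm option) \<Rightarrow> ('m \<Rightarrow> 'm + 'm) \<Rightarrow> complex poly^'m^'m" where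
  "selection h \<phi> = (\<chi> i j. case \<phi> i of Inl a \<Rightarrow> if h j = None \<and> a = j then 1 else 0
    | Inr a \<Rightarrow> if h j = Some a then 1 else 0)"

definition feedback_minor :: "complex poly^'s^'s \<Rightarrow> complex poly^'s^'m \<Rightarrow> complex poly^'m^'s \<Rightarrow>
    ('m \<Rightarrow> 'm option) \<Rightarrow> ('m \<Rightarrow> 'm + 'm) \<Rightarrow> complex poly" where
  "feedback_minor P C E h \<phi> = det (block P (- input_part E h) (output_part C \<phi>) (selection h \<phi>))"

lemma degree_feedback_minor:
  fixes P :: "complex poly^'s^'s" and E :: "complex poly^'m^'s"
  assumes P: "\<And>i j. degree (P $ i $ j) \<le> 1" and C: "\<And>i j. degree (C $ i $ j) \<le> 1"
    and E: "\<And>i j. degree (E $ i $ j) = 0"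
  shows "degree (feedback_minor P C E h \<phi>) \<le> CARD('s)"
proof -
  let ?d = "\<lambda>j :: 's + 'm. if isl j then 1 else (0::nat)"
  have "degree (feedback_minor P C E h \<phi>) \<le> (\<Sum>j\<in>UNIV. ?d j)"
    unfolding feedback_minor_def
  proof (rule degree_det_le)
    fix i j :: "'s + 'm"
    show "degree (block P (- input_part E h) (output_part C \<phi>) (selection h \<phi>) $ i $ j) \<le> ?d j"
      using P C E
      by (cases i; cases j) (auto simp: input_part_def output_part_def selection_def split: sum.split)
  qed
  also have "\<dots> = CARD('s)" by (simp add: sum_UNIV_Plus)
  finally show ?thesis .
qed

definition closed_columns :: "complex^'m^'m \<Rightarrow> complex^'m^'m \<Rightarrow> ('m \<Rightarrow> 'm option) \<Rightarrow> complex^'m^'m" where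
  "closed_columns X Y h = (\<chi> i j. case h j of None \<Rightarrow> X $ i $ j | Some a \<Rightarrow> Y $ i $ a)"

context
  fixes P :: "complex poly^'s^'s" and C :: "complex poly^'s^'m" and E :: "complex poly^'m^'s" and z :: complex
  assumes P: "poly (det P) z \<noteq> 0"
begin

definition loop :: "complex^'m^'m" where
  "loop = eval_mat C z ** matrix_inv (eval_mat P z) ** eval_mat E z"

lemma eval_P_inverse: "eval_mat P z ** matrix_inv (eval_mat P z) = mat 1"
  using P by (intro matrix_inv_works) (simp add: invertible_det_nz poly_det[symmetric])

lemma poly_det_block:
  "poly (det (block P (- input_part E h) Y Z)) z = poly (det P) z *
    det (eval_mat Z z + eval_mat Y z ** matrix_inv (eval_mat P z) ** eval_mat (input_part E h) z)"
proof -
  have "eval_mat P z ** (matrix_inv (eval_mat P z) ** eval_mat (input_part E h) z) = eval_mat (input_part E h) z"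
    by (simp add: matrix_mul_assoc eval_P_inverse)
  from det_block_schur[OF this, of "eval_mat Y z" "eval_mat Z z"] show ?thesis
    by (simp add: poly_det eval_mat_block eval_mat_uminus matrix_mul_assoc)
qed

lemma mult_input_part:
  "(M ** eval_mat (input_part E h) z) $ i $ j = (if h j = None then (M ** eval_mat E z) $ i $ j else 0)"
  by (cases "h j") (simp_all add: mult_nth input_part_def)

lemma poly_feedback:
  "poly (feedback P C E q N h) z = poly (det P) z *
    det (closed_columns (mat (poly q z) + eval_mat N z ** loop) (eval_mat N z) h)"
proof -
  have "eval_mat (select q N h) z + eval_mat (N ** C) z ** matrix_inv (eval_mat P z) ** eval_mat (input_part E h) z
      = closed_columns (mat (poly q z) + eval_mat N z ** loop) (eval_mat N z) h"
    unfolding vec_eq_iff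
  proof (intro allI)
    fix i j
    show "(eval_mat (select q N h) z + eval_mat (N ** C) z ** matrix_inv (eval_mat P z) ** eval_mat (input_part E h) z) $ i $ j
      = closed_columns (mat (poly q z) + eval_mat N z ** loop) (eval_mat N z) h $ i $ j"
      by (cases "h j")
         (simp_all add: mult_input_part closed_columns_def select_nth mat_nth loop_def eval_mat_mult matrix_mul_assoc)
  qed
  then show ?thesis by (simp add: feedback_def poly_det_block)
qed

lemma feedback_expansion:
  "of_nat (fact CARD('m)) * poly (feedback P C E q N h) z =
    (\<Sum>\<phi>\<in>UNIV. poly (det (\<chi> i j. columns_of q N i (\<phi> j))) z * poly (feedback_minor P C E h \<phi>) z)"
proof -
  define L where "L i l = poly (columns_of q N i l) z" for i l
  define K where "K l j = (case l of Inl a \<Rightarrow> if h j = None \<and> a = j then 1 else 0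
      | Inr a \<Rightarrow> if h j = None then loop $ a $ j else if h j = Some a then 1 else 0)" for l j
  have LK: "closed_columns (mat (poly q z) + eval_mat N z ** loop) (eval_mat N z) h = (\<chi> i j. \<Sum>l\<in>UNIV. L i l * K l j)"
    unfolding vec_eq_iff
  proof (intro allI)
    fix i j
    show "closed_columns (mat (poly q z) + eval_mat N z ** loop) (eval_mat N z) h $ i $ j
        = (\<chi> i j. \<Sum>l\<in>UNIV. L i l * K l j) $ i $ j"
    proof (cases "h j")
      case None
      have "(\<Sum>a\<in>UNIV. L i (Inl a) * K (Inl a) j) = (\<Sum>a\<in>UNIV. if a = j then (if i = j then poly q z else 0) else 0)"
        by (rule sum.cong) (auto simp: L_def K_def columns_of_def None)
      then show ?thesis
        by (simp add: None closed_columns_def sum_UNIV_Plus mat_nth mult_nth) (simp add: L_def K_def columns_of_def None)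
    next
      case (Some b)
      have "(\<Sum>a\<in>UNIV. L i (Inr a) * K (Inr a) j) = (\<Sum>a\<in>UNIV. if a = b then poly (N $ i $ b) z else 0)"
        by (rule sum.cong) (auto simp: L_def K_def columns_of_def Some)
      moreover have "(\<Sum>a\<in>UNIV. L i (Inl a) * K (Inl a) j) = 0"
        by (rule sum.neutral) (simp add: K_def Some)
      ultimately show ?thesis by (simp add: Some closed_columns_def sum_UNIV_Plus)
    qed
  qed
  have row: "(eval_mat (output_part C \<phi>) z ** M) $ i $ j
      = (case \<phi> i of Inl a \<Rightarrow> 0 | Inr a \<Rightarrow> (eval_mat C z ** M) $ a $ j)" for \<phi> i j and M :: "complex^'m^'s"
    by (simp add: mult_nth output_part_def split: sum.split)
  have K: "poly (det P) z * det (\<chi> i j. K (\<phi> i) j) = poly (feedback_minor P C E h \<phi>) z" for \<phi>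
  proof -
    have "eval_mat (selection h \<phi>) z + eval_mat (output_part C \<phi>) z ** matrix_inv (eval_mat P z) ** eval_mat (input_part E h) z
        = (\<chi> i j. K (\<phi> i) j)"
      unfolding vec_eq_iff
    proof (intro allI)
      fix i j
      show "(eval_mat (selection h \<phi>) z + eval_mat (output_part C \<phi>) z ** matrix_inv (eval_mat P z)
          ** eval_mat (input_part E h) z) $ i $ j = (\<chi> i j. K (\<phi> i) j) $ i $ j"
        by (cases "\<phi> i"; cases "h j"; simp add: mult_input_part K_def selection_def loop_def;
            simp add: row matrix_mul_assoc[symmetric])
    qed
    then show ?thesis by (simp add: feedback_minor_def poly_det_block)
  qed
  have L: "det (\<chi> i j. L i (\<phi> j)) = poly (det (\<chi> i j. columns_of q N i (\<phi> j))) z" for \<phi>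
    by (simp add: poly_det L_def eval_mat_def)
  have "of_nat (fact CARD('m)) * poly (feedback P C E q N h) z
      = poly (det P) z * (of_nat (fact CARD('m)) * det (\<chi> i j. \<Sum>l\<in>UNIV. L i l * K l j))"
    by (simp add: poly_feedback LK)
  also have "\<dots> = (\<Sum>\<phi>\<in>UNIV. det (\<chi> i j. L i (\<phi> j)) * (poly (det P) z * det (\<chi> i j. K (\<phi> i) j)))"
    unfolding cauchy_binet by (simp add: sum_distrib_left mult_ac)
  finally show ?thesis by (simp only: K L)
qed

end

lemma feedback_common_divisor:
  fixes P :: "complex poly^'s^'s" and C :: "complex poly^'s^'m" and E :: "complex poly^'m^'s"
    and N :: "complex poly^'m^'m"
  assumes P0: "det P \<noteq> 0"
    and deg: "\<And>i j. degree (P $ i $ j) \<le> 1" "\<And>i j. degree (C $ i $ j) \<le> 1" "\<And>i j. degree (E $ i $ j) = 0"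
    and sel: "\<And>h. \<exists>u. det (select q N h) = g * u \<and> degree u \<le> D"
  shows "\<exists>u. feedback P C E q N h = g * u \<and> degree u \<le> D + CARD('s)"
proof -
  have "\<exists>u. det (\<chi> i j. columns_of q N i (\<phi> j)) = g * u \<and> degree u \<le> D" for \<phi> :: "'m \<Rightarrow> 'm + 'm"
    using det_columns_of[of q N \<phi>]
  proof (elim disjE exE)
    fix h s assume e: "det (\<chi> i j. columns_of q N i (\<phi> j)) = of_int s * det (select q N h)"
    obtain u where u: "det (select q N h) = g * u" "degree u \<le> D" using sel by blast
    have "degree (of_int s * u) \<le> D"
      using u(2) degree_mult_le[of "of_int s" u] by simp
    with u(1) e show ?thesis by (intro exI[of _ "of_int s * u"]) simp
  next
    assume "det (\<chi> i j. columns_of q N i (\<phi> j)) = 0"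
    then show ?thesis by (intro exI[of _ 0]) simp
  qed
  then obtain u where u: "\<And>\<phi> :: 'm \<Rightarrow> 'm + 'm. det (\<chi> i j. columns_of q N i (\<phi> j)) = g * u \<phi>"
    "\<And>\<phi>. degree (u \<phi>) \<le> D"
    by metis
  define w where "w = (\<Sum>\<phi>\<in>UNIV. u \<phi> * feedback_minor P C E h \<phi>)"
  define c :: complex where "c = 1 / of_nat (fact CARD('m))"
  have "degree w \<le> D + CARD('s)"
    unfolding w_def
  proof (rule degree_sum_le)
    fix \<phi> :: "'m \<Rightarrow> 'm + 'm"
    have "degree (u \<phi> * feedback_minor P C E h \<phi>) \<le> degree (u \<phi>) + degree (feedback_minor P C E h \<phi>)"
      by (rule degree_mult_le)
    also have "\<dots> \<le> D + CARD('s)" by (intro add_mono u degree_feedback_minor deg)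
    finally show "degree (u \<phi> * feedback_minor P C E h \<phi>) \<le> D + CARD('s)" .
  qed simp
  then have "degree (smult c w) \<le> D + CARD('s)"
    using degree_smult_le order_trans by blast
  moreover have "feedback P C E q N h = g * smult c w"
  proof (rule poly_eq_cofinite[OF P0])
    fix z assume "poly (det P) z \<noteq> 0"
    from feedback_expansion[OF this, of C E q N h]
    have "of_nat (fact CARD('m)) * poly (feedback P C E q N h) z = poly (g * w) z"
      by (simp add: u(1) w_def poly_sum sum_distrib_left mult_ac)
    then show "poly (feedback P C E q N h) z = poly (g * smult c w) z"
      by (simp add: c_def field_simps)
  qed
  ultimately show ?thesis by blast
qed

definition feedback_numerator :: "complex poly^'s^'s \<Rightarrow> complex poly^'s^'m \<Rightarrow> complex poly^'m^'s \<Rightarrow>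
    complex poly \<Rightarrow> complex poly^'m^'m \<Rightarrow> complex poly^'m^'m" where
  "feedback_numerator P C E q N = (\<chi> i j. feedback P C E q N (\<lambda>l. if l = i then Some j else None))"

abbreviation feedback_denominator where
  "feedback_denominator P C E q N \<equiv> feedback P C E q N (\<lambda>l. None)"

context
  fixes P :: "complex poly^'s^'s" and C :: "complex poly^'s^'m" and E :: "complex poly^'m^'s"
    and N :: "complex poly^'m^'m" and q :: "complex poly" and z :: complex
    and X Y \<Phi> :: "complex^'m^'m"
  assumes P: "poly (det P) z \<noteq> 0"
    and X: "X = mat (poly q z) + eval_mat N z ** loop P C E z" and \<Phi>: "X ** \<Phi> = eval_mat N z"
begin

lemma closed_columns_mult: "closed_columns X (eval_mat N z) h = X ** closed_columns (mat 1) \<Phi> h"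
  unfolding vec_eq_iff
proof (intro allI)
  fix i j
  show "closed_columns X (eval_mat N z) h $ i $ j = (X ** closed_columns (mat 1) \<Phi> h) $ i $ j"
  proof (cases "h j")
    case None
    have "(X ** closed_columns (mat 1) \<Phi> h) $ i $ j = (X ** mat 1) $ i $ j"
      unfolding mult_nth by (simp add: closed_columns_def None)
    then show ?thesis by (simp add: closed_columns_def None)
  next
    case (Some a)
    have "(X ** closed_columns (mat 1) \<Phi> h) $ i $ j = (X ** \<Phi>) $ i $ a"
      unfolding mult_nth by (simp add: closed_columns_def Some)
    then show ?thesis by (simp add: closed_columns_def Some \<Phi>)
  qed
qed

lemma poly_feedback_denominator: "poly (feedback_denominator P C E q N) z = poly (det P) z * det X"
proof -
  have "closed_columns X (eval_mat N z) (\<lambda>l. None) = X" by (simp add: closed_columns_def vec_eq_iff)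
  then show ?thesis by (simp add: poly_feedback[OF P] X[symmetric])
qed

lemma poly_feedback_eq:
  "poly (feedback P C E q N h) z
    = poly (feedback_denominator P C E q N) z * det (closed_columns (mat 1) \<Phi> h)"
  unfolding poly_feedback_denominator by (simp add: poly_feedback[OF P] X[symmetric] closed_columns_mult det_mul)

text \<open>Cramer's rule.\<close>

lemma eval_feedback_numerator:
  "poly (feedback_numerator P C E q N $ i $ j) z = poly (feedback_denominator P C E q N) z * \<Phi> $ i $ j"
proof -
  have "closed_columns (mat 1) \<Phi> (\<lambda>l. if l = i then Some j else None)
      = (\<chi> k l. if l = i then (mat 1 *v column j \<Phi>) $ k else mat 1 $ k $ l)"
    by (simp add: closed_columns_def vec_eq_iff column_def)
  then have "det (closed_columns (mat 1) \<Phi> (\<lambda>l. if l = i then Some j else None)) = \<Phi> $ i $ j"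
    using cramer_lemma[of i "mat 1 :: complex^'m^'m" "column j \<Phi>"] by (simp add: column_def)
  then show ?thesis
    using poly_feedback_eq[of "\<lambda>l. if l = i then Some j else None"] by (simp add: feedback_numerator_def)
qed

lemma poly_select_feedback:
  "poly (det (select (feedback_denominator P C E q N) (feedback_numerator P C E q N) h)) z
    = poly (feedback_denominator P C E q N ^ (CARD('m) - 1) * feedback P C E q N h) z"
proof -
  let ?d = "poly (feedback_denominator P C E q N) z"
  have "eval_mat (select (feedback_denominator P C E q N) (feedback_numerator P C E q N) h) z
      = (\<chi> i. ?d *s closed_columns (mat 1) \<Phi> h $ i)"
    by (auto simp: vec_eq_iff select_nth closed_columns_def mat_nth eval_feedback_numerator split: option.split)
  then have "poly (det (select (feedback_denominator P C E q N) (feedback_numerator P C E q N) h)) z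
      = ?d ^ CARD('m) * det (closed_columns (mat 1) \<Phi> h)"
    using det_rows_mul[of "\<lambda>i. ?d" "\<lambda>i. closed_columns (mat 1) \<Phi> h $ i"] by (simp add: poly_det)
  also have "?d ^ CARD('m) = ?d ^ (CARD('m) - 1) * ?d"
    by (metis One_nat_def Suc_pred power_Suc2 zero_less_card_finite)
  finally show ?thesis using poly_feedback_eq[of h] by (simp add: mult.assoc)
qed

end

lemma rational_degree_feedback:
  fixes P :: "complex poly^'s^'s" and C :: "complex poly^'s^'m" and E :: "complex poly^'m^'s"
    and N :: "complex poly^'m^'m"
  assumes q: "q \<noteq> 0"
    and deg: "\<And>i j. degree (P $ i $ j) \<le> 1" "\<And>i j. degree (C $ i $ j) \<le> 1" "\<And>i j. degree (E $ i $ j) = 0"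
    and P0: "det P \<noteq> 0" and d: "feedback_denominator P C E q N \<noteq> 0"
  shows "rational_degree (feedback_numerator P C E q N) (feedback_denominator P C E q N)
    \<le> rational_degree N q + CARD('s)"
proof -
  obtain g where g: "g \<noteq> 0" "\<And>h. \<exists>u. det (select q N h) = g * u \<and> degree u \<le> rational_degree N q"
    using rational_degree_common_divisor[OF q, of N] by metis
  let ?d = "feedback_denominator P C E q N" and ?n = "feedback_numerator P C E q N"
  have "\<exists>u. det (select ?d ?n h) = (?d ^ (CARD('m) - 1) * g) * u \<and> degree u \<le> rational_degree N q + CARD('s)" for h
  proof -
    obtain u where u: "feedback P C E q N h = g * u" "degree u \<le> rational_degree N q + CARD('s)"
      using feedback_common_divisor[OF P0 deg g(2)] by blast
    have "det (select ?d ?n h) = ?d ^ (CARD('m) - 1) * feedback P C E q N h"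
    proof (rule poly_eq_cofinite)
      show "det P * ?d \<noteq> 0" using P0 d by simp
      fix z assume "poly (det P * ?d) z \<noteq> 0"
      then have z: "poly (det P) z \<noteq> 0" "poly ?d z \<noteq> 0" by auto
      define X where "X = mat (poly q z) + eval_mat N z ** loop P C E z"
      have "closed_columns X (eval_mat N z) (\<lambda>l. None) = X" by (simp add: closed_columns_def vec_eq_iff)
      then have "poly ?d z = poly (det P) z * det X" by (simp add: poly_feedback[OF z(1)] X_def[symmetric])
      then have "invertible X" using z by (auto simp: invertible_det_nz)
      then have "X ** (matrix_inv X ** eval_mat N z) = eval_mat N z"
        by (simp add: matrix_mul_assoc matrix_inv_works)
      from poly_select_feedback[OF z(1) X_def this]
      show "poly (det (select ?d ?n h)) z = poly (?d ^ (CARD('m) - 1) * feedback P C E q N h) z" .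
    qed
    with u show ?thesis by (intro exI[of _ u]) (simp add: mult.assoc)
  qed
  then show ?thesis
    using d g(1) by (intro rational_degree_le[of _ "?d ^ (CARD('m) - 1) * g"]) auto
qed

theorem McMillan_degree_feedback:
  fixes P :: "complex poly^'s^'s" and C :: "complex poly^'s^'m" and E :: "complex poly^'m^'s"
    and \<Psi> Q :: "complex \<Rightarrow> complex^'m^'m"
  assumes deg: "\<And>i j. degree (P $ i $ j) \<le> 1" "\<And>i j. degree (C $ i $ j) \<le> 1" "\<And>i j. degree (E $ i $ j) = 0"
    and ae: "AE z in circle. invertible (\<Psi> z) \<and> invertible (matrix_inv (\<Psi> z) + Q z) \<and>
      poly (det P) z \<noteq> 0 \<and> Q z = loop P C E z"
  shows "McMillan_degree (\<lambda>z. matrix_inv (matrix_inv (\<Psi> z) + Q z)) \<le> McMillan_degree \<Psi> + enat CARD('s)"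
proof -
  let ?S = "{enat (rational_degree N q) | N q. represents N q \<Psi>}"
  have rep: "McMillan_degree (\<lambda>z. matrix_inv (matrix_inv (\<Psi> z) + Q z)) \<le> enat (rational_degree N q + CARD('s))"
    if "represents N q \<Psi>" for N q
  proof -
    let ?d = "feedback_denominator P C E q N" and ?n = "feedback_numerator P C E q N"
    have q: "q \<noteq> 0" and N: "AE z in circle. \<forall>i j. \<Psi> z $ i $ j = poly (N $ i $ j) z / poly q z"
      using that by (auto simp: represents_def)
    have key: "poly (det P) z \<noteq> 0 \<and> poly ?d z \<noteq> 0 \<and>
        (\<forall>i j. matrix_inv (matrix_inv (\<Psi> z) + Q z) $ i $ j = poly (?n $ i $ j) z / poly ?d z)"
      if z: "invertible (\<Psi> z)" "invertible (matrix_inv (\<Psi> z) + Q z)" "poly (det P) z \<noteq> 0" "Q z = loop P C E z"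
        and \<Psi>: "\<forall>i j. \<Psi> z $ i $ j = poly (N $ i $ j) z / poly q z" for z
    proof -
      \<comment> \<open>at a zero of \<open>q\<close> the quotients are zero by convention, but \<open>\<Psi>\<close> is not\<close>
      have qz: "poly q z \<noteq> 0"
      proof
        assume "poly q z = 0"
        then have "\<Psi> z = 0" using \<Psi> by (simp add: vec_eq_iff)
        then have "mat 1 = (0 :: complex^'m^'m)" using matrix_inv_works(1)[OF z(1)] by simp
        then have "(mat 1 :: complex^'m^'m) $ undefined $ undefined = 0" by simp
        then show False by (simp add: mat_nth)
      qed
      define X where "X = mat (poly q z) + eval_mat N z ** loop P C E z"
      define \<Phi> where "\<Phi> = matrix_inv (matrix_inv (\<Psi> z) + Q z)"
      have N': "eval_mat N z = mat (poly q z) ** \<Psi> z"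
        using \<Psi> qz by (simp add: vec_eq_iff mat_mult)
      have Xf: "X = mat (poly q z) ** \<Psi> z ** (matrix_inv (\<Psi> z) + Q z)"
        by (simp add: X_def N' z(4) matrix_add_ldistrib matrix_mul_assoc[symmetric] matrix_inv_works[OF z(1)])
      then have X\<Phi>: "X ** \<Phi> = eval_mat N z"
        by (simp add: \<Phi>_def N' matrix_mul_assoc[symmetric] matrix_inv_works[OF z(2)])
      have "det (mat (poly q z) :: complex^'m^'m) \<noteq> 0"
        using qz by (subst det_diagonal) (simp_all add: mat_nth)
      then have "det X \<noteq> 0" using z(1,2) by (simp add: Xf det_mul invertible_det_nz)
      then have dz: "poly ?d z \<noteq> 0"
        using z(3) by (simp add: poly_feedback_denominator[OF z(3) X_def X\<Phi>])
      then show ?thesis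
        using z(3) by (simp add: eval_feedback_numerator[OF z(3) X_def X\<Phi>] \<Phi>_def)
    qed
    have ae': "AE z in circle. poly (det P) z \<noteq> 0 \<and> poly ?d z \<noteq> 0 \<and>
        (\<forall>i j. matrix_inv (matrix_inv (\<Psi> z) + Q z) $ i $ j = poly (?n $ i $ j) z / poly ?d z)"
      using ae N by eventually_elim (use key in blast)
    then obtain z where "poly (det P) z \<noteq> 0" "poly ?d z \<noteq> 0" using AE_circle_ex by blast
    then have nz: "det P \<noteq> 0" "?d \<noteq> 0" by auto
    have "represents ?n ?d (\<lambda>z. matrix_inv (matrix_inv (\<Psi> z) + Q z))"
      unfolding represents_def using nz ae' by (auto elim: AE_mp)
    then have "McMillan_degree (\<lambda>z. matrix_inv (matrix_inv (\<Psi> z) + Q z)) \<le> enat (rational_degree ?n ?d)"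
      unfolding McMillan_degree_def by (intro Inf_lower) blast
    also have "\<dots> \<le> enat (rational_degree N q + CARD('s))"
      using rational_degree_feedback[OF q deg nz] by simp
    finally show ?thesis .
  qed
  show ?thesis
  proof (cases "?S = {}")
    case True
    then have "McMillan_degree \<Psi> = \<infinity>" by (simp only: McMillan_degree_def Inf_enat_def simp_thms if_True)
    then show ?thesis by simp
  next
    case False
    then have "McMillan_degree \<Psi> \<in> ?S"
      unfolding McMillan_degree_def Inf_enat_def using LeastI_ex[of "\<lambda>x. x \<in> ?S"] by auto
    then obtain N q where "represents N q \<Psi>" "McMillan_degree \<Psi> = enat (rational_degree N q)" by blast
    with rep[of N q] show ?thesis by simp
  qed
qed

subsection \<open>A realization of \<open>G\<^sup>* L G\<close>\<close>

text \<open>On the circle \<open>G\<^sup>*\<close> is \<open>z B\<^sup>T (I - z A\<^sup>T)\<^sup>-\<^sup>1\<close>, so that \<open>G\<^sup>* L G\<close> is the cascade of two systems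
  with \<open>n\<close> states each.\<close>

definition cascade_states :: "real^'n^'n \<Rightarrow> real^'n^'n \<Rightarrow> complex poly^('n+'n)^('n+'n)" where
  "cascade_states A L = block (\<chi> i j. [:if i = j then 1 else 0, - complex_of_real (A $ j $ i):])
     (\<chi> i j. [:- complex_of_real (L $ i $ j):]) 0
     (\<chi> i j. [:- complex_of_real (A $ i $ j), if i = j then 1 else 0:])"

definition cascade_output :: "real^'m^'n \<Rightarrow> complex poly^('n+'n)^'m" where
  "cascade_output B = (\<chi> i j. case j of Inl k \<Rightarrow> [:0, complex_of_real (B $ k $ i):] | Inr k \<Rightarrow> 0)"

definition cascade_input :: "real^'m^'n \<Rightarrow> complex poly^'m^('n+'n)" where
  "cascade_input B = (\<chi> i j. case i of Inl k \<Rightarrow> 0 | Inr k \<Rightarrow> [:complex_of_real (B $ k $ j):])"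

lemma cascade_degrees:
  "degree (cascade_states A L $ i $ j) \<le> 1" "degree (cascade_output B $ k $ j) \<le> 1"
  "degree (cascade_input B $ i $ k) = 0"
  by (cases i; cases j; simp add: cascade_states_def)
     (simp_all add: cascade_output_def cascade_input_def split: sum.split)

context stable_filter
begin

lemma cascade_realization:
  assumes z: "z \<in> circ"
  shows "poly (det (cascade_states A L)) z \<noteq> 0"
    and "adjoint_op L z = loop (cascade_states A L) (cascade_output B) (cascade_input B) z"
proof -
  define N where "N = mat z - cmat A"
  have N: "invertible N" unfolding N_def by (rule resolvent_works(1)[OF z])
  have zz: "(mat z :: complex^'n^'n) ** mat (cnj z) = mat 1"
    using circ_mult_cnj[OF z] by (simp add: vec_eq_iff mat_mult mat_nth)
  define M where "M = mat z ** adj N"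
  have Mi: "M ** (adj (matrix_inv N) ** mat (cnj z)) = mat 1"
  proof -
    have "M ** (adj (matrix_inv N) ** mat (cnj z)) = mat z ** adj (matrix_inv N ** N) ** mat (cnj z)"
      by (simp add: M_def adj_mult matrix_mul_assoc)
    then show ?thesis by (simp add: matrix_inv_works[OF N] zz)
  qed
  note M = matrix_inv_eqI[OF Mi]
  let ?P = "eval_mat (cascade_states A L) z"
  have P: "?P = block M (- cmat L) 0 N"
    using circ_mult_cnj[OF z]
    by (simp add: cascade_states_def eval_mat_block)
       (simp add: vec_eq_Plus M_def N_def mat_mult mat_nth vec_eq_iff algebra_simps)
  have "M ** (matrix_inv M ** cmat L) = cmat L" by (simp add: matrix_mul_assoc matrix_inv_works[OF M(1)])
  from det_block_schur[OF this, of 0 N] have "det ?P = det M * det N" by (simp add: P)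
  then have dP: "det ?P \<noteq> 0" using M(1) N by (simp add: invertible_det_nz)
  then show "poly (det (cascade_states A L)) z \<noteq> 0" by (simp add: poly_det)
  define U where "U = matrix_inv M ** cmat L ** G z"
  define V :: "complex^'m^('n+'n)" where "V = (\<chi> i j. case i of Inl k \<Rightarrow> U $ k $ j | Inr k \<Rightarrow> G z $ k $ j)"
  have NG: "N ** G z = cmat B" unfolding N_def by (rule resolvent_works(2)[OF z])
  have MU: "M ** U = cmat L ** G z" by (simp add: U_def matrix_mul_assoc matrix_inv_works[OF M(1)])
  have PV: "?P ** V = eval_mat (cascade_input B) z"
    unfolding vec_eq_Plus
  proof (intro conjI allI)
    fix i
    have "(?P ** V) $ Inl i = (M ** U - cmat L ** G z) $ i"
      unfolding P by (simp add: vec_eq_iff mult_nth sum_UNIV_Plus V_def sum_negf)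
    then show "(?P ** V) $ Inl i = eval_mat (cascade_input B) z $ Inl i"
      by (simp add: MU vec_eq_iff cascade_input_def)
    have "(?P ** V) $ Inr i = (N ** G z) $ i"
      unfolding P by (simp add: vec_eq_iff mult_nth sum_UNIV_Plus V_def)
    then show "(?P ** V) $ Inr i = eval_mat (cascade_input B) z $ Inr i"
      by (simp add: NG vec_eq_iff cascade_input_def)
  qed
  have "matrix_inv ?P ** eval_mat (cascade_input B) z = matrix_inv ?P ** ?P ** V"
    unfolding PV[symmetric] by (simp add: matrix_mul_assoc)
  also have "\<dots> = V" using dP by (simp add: matrix_inv_works invertible_det_nz)
  finally have "loop (cascade_states A L) (cascade_output B) (cascade_input B) z = eval_mat (cascade_output B) z ** V"
    using dP by (simp add: loop_def poly_det matrix_mul_assoc[symmetric])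
  also have "\<dots> = mat z ** (cmat (transpose B) ** U)"
    by (simp add: vec_eq_iff mat_mult mult_nth sum_UNIV_Plus cascade_output_def V_def transpose_def
        sum_distrib_left mult_ac)
  also have "\<dots> = cmat (transpose B) ** adj (matrix_inv N) ** (mat z ** mat (cnj z)) ** cmat L ** G z"
  proof -
    have "mat z ** (cmat (transpose B) ** U) = cmat (transpose B) ** (mat z ** U)"
      by (simp add: vec_eq_iff mat_mult mult_nth sum_distrib_left mult_ac)
    moreover have "mat z ** adj (matrix_inv N) = adj (matrix_inv N) ** mat z"
      by (simp add: mat_mult mult_mat)
    ultimately show ?thesis unfolding U_def M(2) by (simp only: matrix_mul_assoc)
  qed
  also have "\<dots> = adjoint_op L z"
    by (simp add: zz transfer_fun_def N_def adj_mult adj_cmat)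
  finally show "adjoint_op L z = loop (cascade_states A L) (cascade_output B) (cascade_input B) z" by simp
qed

lemma McMillan_degree_Phi_opt:
  assumes "AE z in circle. invertible (\<Psi> z) \<and> invertible (matrix_inv (\<Psi> z) + adjoint_op L z)"
  shows "McMillan_degree (Phi_opt A B \<Psi> L) \<le> McMillan_degree \<Psi> + enat (2 * CARD('n))"
proof -
  have "AE z in circle. z \<in> circ" using AE_space[of circle] by simp
  with assms have "AE z in circle. invertible (\<Psi> z) \<and> invertible (matrix_inv (\<Psi> z) + adjoint_op L z) \<and>
      poly (det (cascade_states A L)) z \<noteq> 0 \<and>
      adjoint_op L z = loop (cascade_states A L) (cascade_output B) (cascade_input B) z"
    by eventually_elim (use cascade_realization in blast)
  from McMillan_degree_feedback[OF cascade_degrees this]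
  have "McMillan_degree (\<lambda>z. matrix_inv (matrix_inv (\<Psi> z) + adjoint_op L z)) \<le> McMillan_degree \<Psi> + enat CARD('n + 'n)" .
  moreover have "CARD('n + 'n) = 2 * CARD('n)"
    unfolding UNIV_Plus_UNIV[symmetric] by (subst card_Plus) auto
  ultimately show ?thesis by (simp only: Phi_opt_def[abs_def])
qed

end

section \<open>The normalized problem\<close>

lemma S_plus_bounds:
  assumes "\<Phi> \<in> S_plus"
  obtains K a where "0 < a" "AE z in circle. norm (\<Phi> z) \<le> K \<and> pos_semidef (\<Phi> z - a *\<^sub>R mat 1)"
    "integrable circle \<Phi>"
  using assms unfolding S_plus_def spectral_density_def by (auto simp: eventually_conj_iff)

text \<open>The tangent of \<open>ln det\<close> at \<open>I\<close>, applied to the density and to its inverse, bounds \<open>ln det\<close> from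
  both sides.\<close>

lemma ln_det_bounds:
  fixes X :: "complex^'m^'m"
  assumes "pos_semidef (X - a *\<^sub>R mat 1)" "0 < a"
  shows "\<bar>ln (Re (det X))\<bar> \<le> norm (mat 1 :: complex^'m^'m) * (norm X + real CARD('m) / a)"
proof -
  have X: "pos_def X" by (rule pos_def_if_coercive[OF assms])
  let ?c = "norm (mat 1 :: complex^'m^'m)"
  have I1: "matrix_inv (mat 1 :: complex^'m^'m) = mat 1" by (rule matrix_inv_eqI) simp
  have I2: "(mat 1 :: complex^'m^'m) \<bullet> mat 1 = real CARD('m)" by (simp add: inner_mat_1 trace_I)
  have up: "ln (Re (det Y)) \<le> ?c * norm Y" if "pos_def Y" for Y :: "complex^'m^'m"
  proof -
    have "ln (Re (det Y)) \<le> mat 1 \<bullet> Y - real CARD('m)"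
      using ln_det_tangent(1)[OF pos_def_mat_1 that] by (simp add: I1 I2 inner_diff)
    also have "\<dots> \<le> ?c * norm Y" using norm_cauchy_schwarz[of "mat 1" Y] by simp
    finally show ?thesis .
  qed
  have "ln (Re (det X)) \<le> ?c * norm X" by (rule up[OF X])
  moreover have "- ln (Re (det X)) \<le> ?c * (real CARD('m) / a)"
  proof -
    have "det (matrix_inv X) = complex_of_real (inverse (Re (det X)))"
      using pos_def_det(1)[OF X] by (simp add: det_matrix_inv pos_def_invertible[OF X])
    then have "Re (det (matrix_inv X)) = inverse (Re (det X))" by (simp only: Re_complex_of_real)
    then have "- ln (Re (det X)) = ln (Re (det (matrix_inv X)))"
      using pos_def_det(2)[OF X] by (simp add: ln_inverse)
    also have "\<dots> \<le> ?c * norm (matrix_inv X)" by (rule up[OF pos_def_matrix_inv[OF X]])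
    also have "\<dots> \<le> ?c * (real CARD('m) / a)"
      by (intro mult_left_mono norm_inverse_le assms) simp
    finally show ?thesis .
  qed
  moreover have "0 \<le> ?c * norm X" "0 \<le> ?c * (real CARD('m) / a)" using assms by auto
  ultimately show ?thesis unfolding distrib_left by linarith
qed

locale normalized_problem = dual_problem A B H F \<alpha> LF
  for A :: "real^'n^'n" and B :: "real^'m^'n" and H :: "real^'n^'m" and F \<alpha> LF +
  fixes \<Psi> W :: "complex \<Rightarrow> complex^'m^'m"
  assumes \<Psi>_measurable [measurable]: "\<Psi> \<in> borel_measurable circle"
    and W_measurable [measurable]: "W \<in> borel_measurable circle"
    and \<Psi>_F: "AE z in circle. \<Psi> z = F z"
    and \<Psi>_W: "AE z in circle. \<Psi> z = W z ** adj (W z)"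
begin

lemma AE_regular: "AE z in circle. z \<in> circ \<and> \<Psi> z = F z \<and> F z = W z ** adj (W z)"
proof -
  have "AE z in circle. z \<in> circ" using AE_space[of circle] by simp
  with \<Psi>_F \<Psi>_W show ?thesis by eventually_elim simp
qed

lemma AE_F: "AE z in circle. z \<in> circ \<and> \<Psi> z = F z"
  using AE_regular by eventually_elim simp

lemma W_invertible:
  assumes "z \<in> circ" "F z = W z ** adj (W z)"
  shows "invertible (W z)"
  using pos_def_invertible[OF F_pos_def[OF assms(1)]] unfolding assms(2)
  by (simp add: invertible_det_nz det_mul)

lemma dual_density_eq:
  assumes z: "z \<in> circ" "F z = W z ** adj (W z)"
  shows "dual_density A B W L z = adj (W z) ** pencil L z ** W z"
proof -
  note W = W_invertible[OF z]
  have "adj (W z) ** matrix_inv (F z) ** W z = (adj (W z) ** adj (matrix_inv (W z))) ** (matrix_inv (W z) ** W z)"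
    unfolding z(2) by (simp only: matrix_inv_mult[OF W adj_matrix_inv(1)[OF W]] adj_matrix_inv(2)[OF W] matrix_mul_assoc)
  also have "\<dots> = mat 1" by (simp add: adj_mult[symmetric] matrix_inv_works[OF W])
  finally show ?thesis
    by (simp add: dual_density_def pencil_def G1_def adj_mult matrix_add_ldistrib matrix_add_rdistrib matrix_mul_assoc)
qed

lemma ln_det_dual_density:
  assumes z: "z \<in> circ" "F z = W z ** adj (W z)" and pd: "pos_def (pencil L z)"
  shows "ln (Re (det (dual_density A B W L z))) = ln (Re (det (F z))) + ln (Re (det (pencil L z)))"
proof -
  have "det (dual_density A B W L z) = det (F z) * det (pencil L z)"
    by (simp add: dual_density_eq[OF z] z(2) det_mul mult_ac)
  also have "\<dots> = complex_of_real (Re (det (F z)) * Re (det (pencil L z)))"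
    using pos_def_det(1)[OF F_pos_def[OF z(1)]] pos_def_det(1)[OF pd] by (metis of_real_mult)
  finally show ?thesis
    using pos_def_det(2)[OF F_pos_def[OF z(1)]] pos_def_det(2)[OF pd] by (simp add: ln_mult)
qed

lemma eventually_cong_AE:
  "AE z in circle. P z \<longleftrightarrow> Q z \<Longrightarrow> (AE z in circle. P z) \<longleftrightarrow> (AE z in circle. Q z)"
  by (auto elim: eventually_elim2)

lemma L_plus_iff: "L \<in> L_plus A B W \<longleftrightarrow> L \<in> range_Gamma A B \<and> (AE z in circle. pos_def (pencil L z))"
proof -
  have "AE z in circle. pos_def (dual_density A B W L z) \<longleftrightarrow> pos_def (pencil L z)"
    using AE_regular
    by eventually_elim (simp only: dual_density_eq pos_def_congruence_iff W_invertible)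
  then have "(AE z in circle. pos_def (dual_density A B W L z)) \<longleftrightarrow> (AE z in circle. pos_def (pencil L z))"
    by (rule eventually_cong_AE)
  then show ?thesis by (simp add: L_plus_def)
qed

lemma G1_measurable [measurable]: "G1 A B W \<in> borel_measurable circle"
  unfolding G1_def[abs_def] by measurable

lemma dual_density_measurable [measurable]: "dual_density A B W L \<in> borel_measurable circle"
  unfolding dual_density_def[abs_def] by measurable

lemma pencil_measurable [measurable]: "pencil L \<in> borel_measurable circle"
  by (rule continuous_measurable_circle[OF pencil_continuous])

lemma ln_det_F_integrable: "integrable circle (\<lambda>z. ln (Re (det (F z))))"
proof (intro integrable_circle_continuous continuous_intros ballI)
  show "continuous_on circ F" using F_symbol by (simp add: symbol_def)
  show "Re (det (F z)) \<noteq> 0" if "z \<in> circ" for z using pos_def_det(2)[OF F_pos_def[OF that]] by simp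
qed

lemma J_fun_interior:
  assumes "interior_point L"
  shows "J_fun A B W L = ereal (dual_fun L - (LINT z|circle. ln (Re (det (F z)))))"
proof -
  let ?g = "\<lambda>z. trace L - (ln (Re (det (F z))) + ln (Re (det (pencil L z))))"
  have i: "integrable circle (\<lambda>z. ln (Re (det (pencil L z))))"
    by (intro integrable_circle_continuous ln_det_continuous assms)
  have ae: "AE z in circle. trace L - ln (Re (det (dual_density A B W L z))) = ?g z"
    using AE_regular by eventually_elim (simp add: ln_det_dual_density pencil_pos_def[OF assms])
  have g: "integrable circle ?g" using i ln_det_F_integrable by simp
  have m: "(\<lambda>z. trace L - ln (Re (det (dual_density A B W L z)))) \<in> borel_measurable circle" by measurable
  have "integrable circle (\<lambda>z. trace L - ln (Re (det (dual_density A B W L z))))"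
    using integrable_cong_AE[OF m borel_measurable_integrable[OF g] ae] g by simp
  moreover have "(LINT z|circle. trace L - ln (Re (det (dual_density A B W L z)))) = (LINT z|circle. ?g z)"
    by (rule integral_cong_AE[OF m borel_measurable_integrable[OF g] ae])
  moreover have "(LINT z|circle. ?g z) = dual_fun L - (LINT z|circle. ln (Re (det (F z))))"
    using i ln_det_F_integrable by (simp add: dual_fun_def)
  ultimately show ?thesis by (simp add: J_fun_def)
qed

end

locale stationary_problem = normalized_problem A B H F \<alpha> LF \<Psi> W
  for A :: "real^'n^'n" and B :: "real^'m^'n" and H :: "real^'n^'m" and F \<alpha> LF \<Psi> W +
  fixes L0 :: "real^'n^'n" and s :: real
  assumes L0_range: "L0 \<in> range_Gamma A B" and s: "0 < s" and L0_coercive: "coercive_by s L0"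
    and stationary: "residual L0 = 0"
begin

lemma L0_interior: "interior_point L0"
  by (rule coercive_interior[OF L0_coercive s])

abbreviation \<Phi>0 :: "complex \<Rightarrow> complex^'m^'m" where "\<Phi>0 z \<equiv> matrix_inv (pencil L0 z)"

lemma \<Phi>0_symbol: "symbol \<Phi>0"
  by (rule inv_pencil_symbol[OF L0_interior])

lemma \<Phi>0_moment: "\<Gamma> \<Phi>0 = mat 1"
  using stationary by (simp add: residual_def)

lemma L0_L_plus: "L0 \<in> L_plus A B W"
proof -
  have "AE z in circle. pos_def (pencil L0 z)"
    using pencil_pos_def[OF L0_interior] by (intro AE_I2) simp
  then show ?thesis by (simp add: L_plus_iff L0_range)
qed

text \<open>The integrated tangent inequality at \<open>L0\<close>; its linear term vanishes because \<open>L0\<close> is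
  stationary. It also covers the boundary points \<open>L\<close>, at which the pencil is only almost
  everywhere positive definite.\<close>

lemma dual_optimality:
  assumes L: "L \<in> L_plus A B W"
  shows "J_fun A B W L0 \<le> J_fun A B W L"
    and "J_fun A B W L \<le> J_fun A B W L0 \<Longrightarrow> L = L0"
proof -
  let ?f = "\<lambda>z. trace L - ln (Re (det (dual_density A B W L z)))"
  let ?g = "\<lambda>z. trace L - (ln (Re (det (F z))) + (ln (Re (det (pencil L0 z))) + adjoint_op (L - L0) z \<bullet> \<Phi>0 z))"
  have pd: "AE z in circle. pos_def (pencil L z)" and LR: "L \<in> range_Gamma A B"
    using L by (auto simp: L_plus_iff)
  have i: "integrable circle (\<lambda>z. ln (Re (det (pencil L0 z))))"
    by (intro integrable_circle_continuous ln_det_continuous L0_interior)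
  have ic: "integrable circle (\<lambda>z. adjoint_op (L - L0) z \<bullet> \<Phi>0 z)"
    using \<Phi>0_symbol
    by (intro integrable_circle_continuous continuous_intros continuous_G) (auto simp: symbol_def)
  have ig: "integrable circle ?g" using i ic ln_det_F_integrable by simp
  have "(LINT z|circle. ?g z) = trace L - ((LINT z|circle. ln (Re (det (F z))))
      + ((LINT z|circle. ln (Re (det (pencil L0 z)))) + cmat (L - L0) \<bullet> \<Gamma> \<Phi>0))"
    using i ic ln_det_F_integrable by (simp add: moment_pairing[OF symbol_integrable[OF \<Phi>0_symbol]])
  then have int_g: "(LINT z|circle. ?g z) = dual_fun L0 - (LINT z|circle. ln (Re (det (F z))))"
    by (simp add: \<Phi>0_moment dual_fun_def inner_commute[of _ "mat 1"] trace_inner[symmetric] trace_sub)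
  have le: "AE z in circle. ?g z \<le> ?f z"
    using AE_regular pd
  proof eventually_elim
    case (elim z)
    then show ?case
      using ln_det_tangent(1)[OF pencil_pos_def[OF L0_interior] elim(2), of z]
      by (simp add: ln_det_dual_density pencil_diff inner_commute)
  qed
  have finite: "integrable circle ?f \<and> (LINT z|circle. ?f z) \<le> c" if "J_fun A B W L \<le> ereal c" for c
    using that by (auto simp: J_fun_def Let_def split: if_splits)
  show "J_fun A B W L0 \<le> J_fun A B W L"
  proof (cases "integrable circle ?f")
    case True
    have "(LINT z|circle. ?g z) \<le> (LINT z|circle. ?f z)" by (rule integral_mono_AE[OF ig True le])
    moreover have "J_fun A B W L = ereal (LINT z|circle. ?f z)" using True by (simp add: J_fun_def)
    ultimately show ?thesis by (simp only: J_fun_interior[OF L0_interior] int_g ereal_less_eq)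
  next
    case False
    then show ?thesis by (simp add: J_fun_def[of A B W L])
  qed
  assume "J_fun A B W L \<le> J_fun A B W L0"
  then have f: "integrable circle ?f" "(LINT z|circle. ?f z) \<le> (LINT z|circle. ?g z)"
    using finite by (auto simp: J_fun_interior[OF L0_interior] int_g)
  have "(LINT z|circle. ?f z - ?g z) = 0"
    unfolding Bochner_Integration.integral_diff[OF f(1) ig]
    using f(2) integral_mono_AE[OF ig f(1) le] by linarith
  moreover have "AE z in circle. 0 \<le> ?f z - ?g z" using le by eventually_elim simp
  ultimately have "AE z in circle. ?f z - ?g z = 0"
    using integral_nonneg_eq_0_iff_AE[OF Bochner_Integration.integrable_diff[OF f(1) ig]] by simp
  with AE_regular pd have "AE z in circle. adjoint_op (L - L0) z = 0"
  proof eventually_elim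
    case (elim z)
    then have "pencil L z = pencil L0 z"
      by (intro ln_det_tangent(2) pencil_pos_def[OF L0_interior])
         (simp_all add: ln_det_dual_density pencil_diff inner_commute)
    then show ?case by (simp add: pencil_diff[symmetric])
  qed
  then have "L - L0 = 0"
    using subspace_diff[OF subspace_range_Gamma LR L0_range] by (rule adjoint_op_injective_AE[rotated])
  then show "L = L0" by simp
qed

lemma J_fun_directional:
  assumes "transpose D = D"
  shows "((\<lambda>t. (J_fun A B W (L0 + t *\<^sub>R D) - J_fun A B W L0) / ereal t) \<longlongrightarrow> 0) (at 0)"
proof -
  note d = dual_fun_directional[OF s L0_coercive stationary assms]
  have "((\<lambda>t. ereal ((dual_fun (L0 + t *\<^sub>R D) - dual_fun L0) / t)) \<longlongrightarrow> ereal 0) (at 0)"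
    using d(1) by (rule tendsto_ereal)
  moreover have "\<forall>\<^sub>F t in at 0. ereal ((dual_fun (L0 + t *\<^sub>R D) - dual_fun L0) / t)
      = (J_fun A B W (L0 + t *\<^sub>R D) - J_fun A B W L0) / ereal t"
    using d(2) eventually_neq_at_within[of 0 0 UNIV]
    by eventually_elim (simp add: J_fun_interior L0_interior)
  ultimately show ?thesis
    unfolding zero_ereal_def by (rule Lim_transform_eventually)
qed

lemma Phi_opt_AE: "AE z in circle. Phi_opt A B \<Psi> L0 z = \<Phi>0 z"
  using AE_regular by eventually_elim (simp add: Phi_opt_def pencil_def)

lemma Phi_opt_measurable [measurable]: "Phi_opt A B \<Psi> L0 \<in> borel_measurable circle"
  unfolding Phi_opt_def[abs_def] by measurable

lemma \<Phi>0_measurable [measurable]: "\<Phi>0 \<in> borel_measurable circle"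
  by measurable

lemma Phi_opt_moment: "\<Gamma> (Phi_opt A B \<Psi> L0) = mat 1"
  using moment_cong_AE[OF Phi_opt_measurable \<Phi>0_measurable Phi_opt_AE] \<Phi>0_moment by simp

lemma dual_density_moment:
  "(LINT z|circle. G1 A B W z ** matrix_inv (dual_density A B W L0 z) ** adj (G1 A B W z)) = mat 1"
proof -
  have "AE z in circle. G1 A B W z ** matrix_inv (dual_density A B W L0 z) ** adj (G1 A B W z)
      = G z ** \<Phi>0 z ** adj (G z)"
    using AE_regular
  proof eventually_elim
    case (elim z)
    then have z: "z \<in> circ" "F z = W z ** adj (W z)" by auto
    note W = W_invertible[OF z] and p = pos_def_invertible[OF pencil_pos_def[OF L0_interior z(1)]]
    have "matrix_inv (dual_density A B W L0 z) = matrix_inv (W z) ** (\<Phi>0 z ** adj (matrix_inv (W z)))"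
      unfolding dual_density_eq[OF z]
      by (simp add: matrix_inv_mult invertible_mult W p adj_matrix_inv)
    then have "G1 A B W z ** matrix_inv (dual_density A B W L0 z) ** adj (G1 A B W z)
        = G z ** (W z ** matrix_inv (W z)) ** \<Phi>0 z ** adj (W z ** matrix_inv (W z)) ** adj (G z)"
      by (simp add: G1_def adj_mult matrix_mul_assoc)
    then show ?case by (simp add: matrix_inv_works[OF W])
  qed
  then have "(LINT z|circle. G1 A B W z ** matrix_inv (dual_density A B W L0 z) ** adj (G1 A B W z)) = \<Gamma> \<Phi>0"
    unfolding Gamma_op_def by (intro integral_cong_AE) measurable
  then show ?thesis by (simp add: \<Phi>0_moment)
qed

lemma Phi_opt_feasible: "Phi_opt A B \<Psi> L0 \<in> feasible A B (mat 1)"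
proof -
  have c0: "continuous_on circ \<Phi>0" and sym: "\<And>z. z \<in> circ \<Longrightarrow> \<Phi>0 (cnj z) = conj_mat (\<Phi>0 z)"
    using \<Phi>0_symbol by (auto simp: symbol_def)
  obtain K where K: "\<And>z. z \<in> circ \<Longrightarrow> norm (\<Phi>0 z) \<le> K" using continuous_bounded_circle[OF c0] by blast
  obtain T where T: "T > 0" "\<And>z. z \<in> circ \<Longrightarrow> norm (pencil L0 z) \<le> T"
    using continuous_bounded_circle[OF pencil_continuous, of L0] by blast
  define T' where "T' = norm (mat 1 :: complex^'m^'m) * T + 1"
  have T': "T' > 0" using T(1) by (simp add: T'_def add_nonneg_pos)
  have pd: "pos_def (pencil L0 z)" if "z \<in> circ" for z by (rule pencil_pos_def[OF L0_interior that])
  have co: "pos_semidef (\<Phi>0 z - (1 / T') *\<^sub>R mat 1)" if z: "z \<in> circ" for z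
  proof (rule coercive_if_trace_inverse_le)
    show "pos_def (\<Phi>0 z)" by (rule pos_def_matrix_inv[OF pd[OF z]])
    have "mat 1 \<bullet> pencil L0 z \<le> norm (mat 1 :: complex^'m^'m) * T"
      using T(2)[OF z] by (intro order_trans[OF norm_cauchy_schwarz] mult_left_mono) auto
    then show "mat 1 \<bullet> matrix_inv (\<Phi>0 z) \<le> T'"
      by (simp add: T'_def invertible_matrix_inv[OF pos_def_invertible[OF pd[OF z]]])
  qed
  have reg: "AE z in circle. z \<in> circ \<and> Phi_opt A B \<Psi> L0 z = \<Phi>0 z"
    using AE_regular Phi_opt_AE by eventually_elim simp
  have b: "AE z in circle. norm (Phi_opt A B \<Psi> L0 z) \<le> K"
    using reg by eventually_elim (simp add: K)
  have "integrable circle (Phi_opt A B \<Psi> L0)"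
    by (rule integrable_circle_bounded[OF Phi_opt_measurable b])
  moreover have "AE z in circle. pos_semidef (Phi_opt A B \<Psi> L0 z)"
    using reg by eventually_elim (simp add: pos_def_imp_semidef pos_def_matrix_inv pd)
  moreover have "AE z in circle. Phi_opt A B \<Psi> L0 (cnj z) = conj_mat (Phi_opt A B \<Psi> L0 z)"
    using reg AE_circle_cnj[OF Phi_opt_AE] by eventually_elim (simp add: sym)
  moreover have "AE z in circle. pos_semidef (Phi_opt A B \<Psi> L0 z - (1 / T') *\<^sub>R mat 1)"
    using reg by eventually_elim (simp add: co)
  moreover have "1 / T' > 0" using T' by simp
  ultimately have "Phi_opt A B \<Psi> L0 \<in> S_plus"
    using b unfolding S_plus_def spectral_density_def by blast
  then show ?thesis using Phi_opt_moment by (simp add: feasible_def)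
qed

text \<open>On the feasible set, \<open>\<Psi>\<^sup>-\<^sup>1\<close> may be replaced by \<open>\<Phi>0\<^sup>-\<^sup>1 = \<Psi>\<^sup>-\<^sup>1 + G\<^sup>* L0 G\<close> in the linear term of the
  objective, since the moment \<open>\<integral> (G\<^sup>* L0 G) \<bullet> \<Phi>\<close> is the trace of \<open>L0\<close> there.\<close>

lemma d_RER_feasible:
  assumes \<Phi>: "\<Phi> \<in> feasible A B (mat 1)"
  shows "integrable circle (\<lambda>z. pencil L0 z \<bullet> \<Phi> z - ln (Re (det (\<Phi> z))))"
    and "d_RER \<Phi> \<Psi> = ((LINT z|circle. pencil L0 z \<bullet> \<Phi> z - ln (Re (det (\<Phi> z))))
      + (LINT z|circle. ln (Re (det (F z)))) - real CARD('m) - trace L0) / 2"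
proof -
  have S: "\<Phi> \<in> S_plus" and mom: "\<Gamma> \<Phi> = mat 1" using \<Phi> by (auto simp: feasible_def)
  obtain K a where a: "0 < a" and ae: "AE z in circle. norm (\<Phi> z) \<le> K \<and> pos_semidef (\<Phi> z - a *\<^sub>R mat 1)"
    and int: "integrable circle \<Phi>"
    using S_plus_bounds[OF S] .
  have [measurable]: "\<Phi> \<in> borel_measurable circle" using int by simp
  have i1: "integrable circle (\<lambda>z. ln (Re (det (\<Phi> z))))"
  proof (rule integrable_circle_bounded)
    show "AE z in circle. norm (ln (Re (det (\<Phi> z)))) \<le> norm (mat 1 :: complex^'m^'m) * (K + real CARD('m) / a)"
      using ae
    proof eventually_elim
      case (elim z)
      have "\<bar>ln (Re (det (\<Phi> z)))\<bar> \<le> norm (mat 1 :: complex^'m^'m) * (norm (\<Phi> z) + real CARD('m) / a)"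
        using elim a by (intro ln_det_bounds) auto
      also have "\<dots> \<le> norm (mat 1 :: complex^'m^'m) * (K + real CARD('m) / a)"
        using elim by (intro mult_left_mono add_right_mono) auto
      finally show ?case by simp
    qed
  qed measurable
  have pair: "integrable circle (\<lambda>z. X z \<bullet> \<Phi> z)" if X: "continuous_on circ X" for X :: "complex \<Rightarrow> complex^'m^'m"
  proof -
    obtain k where k: "k > 0" "\<And>z. z \<in> circ \<Longrightarrow> norm (X z) \<le> k" using continuous_bounded_circle[OF X] by blast
    have [measurable]: "X \<in> borel_measurable circle" by (rule continuous_measurable_circle[OF X])
    show ?thesis
    proof (rule integrable_circle_bounded)
      show "AE z in circle. norm (X z \<bullet> \<Phi> z) \<le> k * K"
        using ae AE_F
      proof eventually_elim
        case (elim z)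
        have "norm (X z \<bullet> \<Phi> z) \<le> norm (X z) * norm (\<Phi> z)" using Cauchy_Schwarz_ineq2 by simp
        also have "\<dots> \<le> k * K" using elim k by (intro mult_mono) auto
        finally show ?case .
      qed
    qed measurable
  qed
  have i2: "integrable circle (\<lambda>z. pencil L0 z \<bullet> \<Phi> z)" "integrable circle (\<lambda>z. adjoint_op L0 z \<bullet> \<Phi> z)"
    by (intro pair pencil_continuous continuous_intros continuous_G)+
  show "integrable circle (\<lambda>z. pencil L0 z \<bullet> \<Phi> z - ln (Re (det (\<Phi> z))))" using i1 i2 by simp
  let ?f = "\<lambda>z. ln (Re (det (matrix_inv (\<Phi> z) ** \<Psi> z))) + Re (trace (matrix_inv (\<Psi> z) ** (\<Phi> z - \<Psi> z)))"
  let ?g = "\<lambda>z. (pencil L0 z \<bullet> \<Phi> z - ln (Re (det (\<Phi> z)))) + ln (Re (det (F z))) - real CARD('m) - adjoint_op L0 z \<bullet> \<Phi> z"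
  have fg: "AE z in circle. ?f z = ?g z"
    using ae AE_F
  proof eventually_elim
    case (elim z)
    have \<Phi>z: "pos_def (\<Phi> z)" using elim a by (intro pos_def_if_coercive) auto
    have Fz: "pos_def (F z)" using elim F_pos_def by simp
    have "det (matrix_inv (\<Phi> z) ** \<Psi> z) = det (F z) / det (\<Phi> z)"
      using elim by (simp add: det_mul det_matrix_inv pos_def_invertible[OF \<Phi>z] field_simps)
    also have "\<dots> = complex_of_real (Re (det (F z)) / Re (det (\<Phi> z)))"
      using pos_def_det(1)[OF \<Phi>z] pos_def_det(1)[OF Fz] by (metis of_real_divide)
    finally have 1: "ln (Re (det (matrix_inv (\<Phi> z) ** \<Psi> z))) = ln (Re (det (F z))) - ln (Re (det (\<Phi> z)))"
      using pos_def_det(2)[OF \<Phi>z] pos_def_det(2)[OF Fz] by (simp add: ln_div)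
    have "Re (trace (matrix_inv (F z) ** X)) = matrix_inv (F z) \<bullet> X" for X
      by (simp add: inner_eq_trace pos_def_inverse_hermitian[OF Fz])
    then have "Re (trace (matrix_inv (\<Psi> z) ** (\<Phi> z - \<Psi> z))) = matrix_inv (F z) \<bullet> \<Phi> z - real CARD('m)"
      using elim inner_inverse_self[OF pos_def_invertible[OF Fz] pos_def_inverse_hermitian[OF Fz]]
      by (simp add: inner_diff)
    then show ?case using 1 by (simp add: pencil_def inner_add)
  qed
  have mf: "?f \<in> borel_measurable circle" by measurable
  have ig: "integrable circle ?g" using i1 i2 ln_det_F_integrable by simp
  have "d_RER \<Phi> \<Psi> = (LINT z|circle. ?f z) / 2"
    using integral_circle(1)[OF mf] by (simp add: d_RER_def)
  also have "(LINT z|circle. ?f z) = (LINT z|circle. ?g z)"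
    by (rule integral_cong_AE[OF mf borel_measurable_integrable[OF ig] fg])
  also have "\<dots> = (LINT z|circle. pencil L0 z \<bullet> \<Phi> z - ln (Re (det (\<Phi> z))))
      + (LINT z|circle. ln (Re (det (F z)))) - real CARD('m) - (LINT z|circle. adjoint_op L0 z \<bullet> \<Phi> z)"
    using i1 i2 ln_det_F_integrable by simp
  also have "(LINT z|circle. adjoint_op L0 z \<bullet> \<Phi> z) = trace L0"
    unfolding moment_pairing[OF int, symmetric] mom trace_inner by (rule inner_commute)
  finally show "d_RER \<Phi> \<Psi> = ((LINT z|circle. pencil L0 z \<bullet> \<Phi> z - ln (Re (det (\<Phi> z))))
      + (LINT z|circle. ln (Re (det (F z)))) - real CARD('m) - trace L0) / 2" .
qed

lemma primal_optimality:
  assumes \<Phi>: "\<Phi> \<in> feasible A B (mat 1)"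
  shows "d_RER (Phi_opt A B \<Psi> L0) \<Psi> \<le> d_RER \<Phi> \<Psi>"
    and "d_RER \<Phi> \<Psi> \<le> d_RER (Phi_opt A B \<Psi> L0) \<Psi> \<Longrightarrow> AE z in circle. \<Phi> z = Phi_opt A B \<Psi> L0 z"
proof -
  let ?O = "Phi_opt A B \<Psi> L0"
  let ?k = "\<lambda>\<Phi> z. pencil L0 z \<bullet> \<Phi> z - ln (Re (det (\<Phi> z)))"
  note r = d_RER_feasible[OF \<Phi>] and ro = d_RER_feasible[OF Phi_opt_feasible]
  have "\<Phi> \<in> S_plus" using \<Phi> by (simp add: feasible_def)
  then obtain K a where a: "0 < a" and ae: "AE z in circle. norm (\<Phi> z) \<le> K \<and> pos_semidef (\<Phi> z - a *\<^sub>R mat 1)"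
    using S_plus_bounds by blast
  have pw: "?k \<Phi>0 z \<le> ?k \<Phi> z \<and> (?k \<Phi>0 z = ?k \<Phi> z \<longrightarrow> \<Phi> z = \<Phi>0 z)"
    if z: "z \<in> circ" and pd: "pos_def (\<Phi> z)" for z
  proof -
    note p = pencil_pos_def[OF L0_interior z]
    have inv: "matrix_inv (\<Phi>0 z) = pencil L0 z" by (rule invertible_matrix_inv(2)[OF pos_def_invertible[OF p]])
    show ?thesis
      using ln_det_tangent[OF pos_def_matrix_inv[OF p] pd] unfolding inv inner_diff by argo
  qed
  have key: "AE z in circle. ?k ?O z \<le> ?k \<Phi> z \<and> (?k \<Phi> z - ?k ?O z = 0 \<longrightarrow> \<Phi> z = ?O z)"
    using ae AE_F Phi_opt_AE
  proof eventually_elim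
    case (elim z)
    then have "pos_def (\<Phi> z)" using a by (intro pos_def_if_coercive) auto
    with pw[of z] elim show ?case by auto
  qed
  then have le: "AE z in circle. ?k ?O z \<le> ?k \<Phi> z" by eventually_elim simp
  have mono: "(LINT z|circle. ?k ?O z) \<le> (LINT z|circle. ?k \<Phi> z)"
    by (rule integral_mono_AE[OF ro(1) r(1) le])
  then show "d_RER ?O \<Psi> \<le> d_RER \<Phi> \<Psi>" unfolding r(2) ro(2) by simp
  assume "d_RER \<Phi> \<Psi> \<le> d_RER ?O \<Psi>"
  then have "(LINT z|circle. ?k \<Phi> z - ?k ?O z) = 0"
    using mono unfolding r(2) ro(2) Bochner_Integration.integral_diff[OF r(1) ro(1)] by simp
  moreover have "AE z in circle. 0 \<le> ?k \<Phi> z - ?k ?O z" using le by eventually_elim simp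
  ultimately have "AE z in circle. ?k \<Phi> z - ?k ?O z = 0"
    using integral_nonneg_eq_0_iff_AE[OF Bochner_Integration.integrable_diff[OF r(1) ro(1)]] by simp
  with key show "AE z in circle. \<Phi> z = ?O z" by eventually_elim blast
qed

lemma degree_bound: "McMillan_degree (Phi_opt A B \<Psi> L0) \<le> McMillan_degree \<Psi> + enat (2 * CARD('n))"
proof (rule McMillan_degree_Phi_opt)
  show "AE z in circle. invertible (\<Psi> z) \<and> invertible (matrix_inv (\<Psi> z) + adjoint_op L0 z)"
    using AE_F
  proof eventually_elim
    case (elim z)
    then show ?case
      using pos_def_invertible[OF F_pos_def] pos_def_invertible[OF pencil_pos_def[OF L0_interior]]
      by (simp add: pencil_def)
  qed
qed

end

section \<open>Reduction to unit moment\<close>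

lemma closed_coercive_matrices: "closed {M :: complex^'m^'m. pos_semidef (M - a *\<^sub>R mat 1)}"
proof -
  have eq: "{M :: complex^'m^'m. pos_semidef (M - a *\<^sub>R mat 1)}
      = {M. adj M = M} \<inter> (\<Inter>x. {M. a * (x \<bullet> x) \<le> x \<bullet> (M *v x)})"
    by (auto simp: pos_semidef_minus_mat_iff)
  have cv: "continuous_on UNIV (\<lambda>M :: complex^'m^'m. M *v x)" for x
    unfolding matrix_vector_mult_def by (intro continuous_intros)
  show ?thesis unfolding eq
    by (intro closed_Int closed_INT ballI closed_Collect_eq closed_Collect_le continuous_intros cv)
qed

lemma lipschitz_representative:
  assumes prior: "\<Psi> \<in> S_plus" and reg: "lipschitz_density \<Psi>"
  obtains F \<alpha> LF where "symbol F" "0 < \<alpha>" "\<And>z. z \<in> circ \<Longrightarrow> pos_semidef (F z - \<alpha> *\<^sub>R mat 1)" "0 \<le> LF"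
    "\<And>z w. z \<in> circ \<Longrightarrow> w \<in> circ \<Longrightarrow> norm (F z - F w) \<le> LF * norm (z - w)" "AE z in circle. \<Psi> z = F z"
proof -
  obtain F C where F: "C-lipschitz_on circ F" and ae: "AE z in circle. \<Psi> z = F z"
    using reg unfolding lipschitz_density_def by blast
  have cont: "continuous_on circ F" using F by (rule lipschitz_on_continuous_on)
  obtain \<alpha> where \<alpha>: "\<alpha> > 0" and co: "AE z in circle. pos_semidef (\<Psi> z - \<alpha> *\<^sub>R mat 1)"
    using prior by (auto simp: S_plus_def)
  have sd: "AE z in circle. pos_semidef (\<Psi> z)" "AE z in circle. \<Psi> (cnj z) = conj_mat (\<Psi> z)"
    using prior by (auto simp: S_plus_def spectral_density_def)
  have "symbol F"
  proof (rule symbol_AE_I[OF cont])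
    show "AE z in circle. adj (F z) = F z"
      using ae sd(1) by eventually_elim (simp add: pos_semidef_hermitian)
    show "AE z in circle. F (cnj z) = conj_mat (F z)"
      using ae sd(2) AE_circle_cnj[OF ae] by eventually_elim simp
  qed
  moreover have "AE z in circle. F z \<in> {M. pos_semidef (M - \<alpha> *\<^sub>R mat 1)}"
    using ae co by eventually_elim simp
  then have "pos_semidef (F z - \<alpha> *\<^sub>R mat 1)" if "z \<in> circ" for z
    using AE_circle_imp_all[OF cont closed_coercive_matrices _ that] by blast
  moreover have "0 \<le> C" using F by (rule lipschitz_on_nonneg)
  moreover have "norm (F z - F w) \<le> C * norm (z - w)" if "z \<in> circ" "w \<in> circ" for z w
    using lipschitz_onD[OF F that] by (simp add: dist_norm)
  ultimately show ?thesis using that \<alpha> ae by blast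
qed

locale moment_normalization =
  fixes A \<Sigma> A' :: "real^'n^'n" and B B' :: "real^'m^'n" and H :: "real^'n^'m"
  assumes stable: "stable_matrix A" and full_rank: "rank B = CARD('m)"
    and Sigma: "sym_pos_def \<Sigma>"
    and H: "\<Sigma> - A ** \<Sigma> ** transpose A = B ** H + transpose H ** transpose B"
    and A': "A' = matrix_inv (matrix_sqrt \<Sigma>) ** A ** matrix_sqrt \<Sigma>"
    and B': "B' = matrix_inv (matrix_sqrt \<Sigma>) ** B"
begin

abbreviation S :: "real^'n^'n" where "S \<equiv> matrix_sqrt \<Sigma>"

abbreviation R :: "real^'n^'n" where "R \<equiv> matrix_inv (matrix_sqrt \<Sigma>)"

lemma S_symmetric: "transpose S = S" and SS: "S ** S = \<Sigma>"
  using matrix_sqrt[OF Sigma] by (auto simp: sym_pos_def_def)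

lemma S_inverse: "S ** R = mat 1" "R ** S = mat 1"
proof -
  have "invertible S"
    unfolding invertible_iff_ker using matrix_sqrt(1)[OF Sigma]
    by (metis inner_zero_right less_irrefl sym_pos_def_def)
  then show "S ** R = mat 1" "R ** S = mat 1" by (simp_all add: matrix_inv_works)
qed

lemma R_symmetric: "transpose R = R"
proof -
  have "S ** transpose R = transpose (R ** S)" by (simp add: matrix_transpose_mul S_symmetric)
  also have "\<dots> = mat 1" by (simp add: S_inverse)
  finally show ?thesis using matrix_inv_eqI(2) by metis
qed

lemma stable': "stable_matrix A'"
  unfolding stable_matrix_def
proof (intro allI impI)
  fix c v assume v: "v \<noteq> 0 \<and> cmat A' *v v = c *s v"
  have "cmat S *v (cmat A' *v v) = cmat (S ** R) ** cmat A ** cmat S *v v"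
    by (simp add: A' cmat_mult matrix_vector_mul_assoc matrix_mul_assoc)
  then have "cmat A *v (cmat S *v v) = c *s (cmat S *v v)"
    using v by (simp add: S_inverse matrix_vector_mul_assoc[symmetric] vector_scalar_commute)
  moreover have "cmat S *v v \<noteq> 0"
  proof
    assume "cmat S *v v = 0"
    then have "cmat R *v (cmat S *v v) = 0" by simp
    then show False using v by (simp add: matrix_vector_mul_assoc cmat_mult[symmetric] S_inverse)
  qed
  ultimately show "norm c < 1" using stable unfolding stable_matrix_def by blast
qed

lemma injective':
  assumes "B' *v x = 0" shows "x = 0"
proof -
  have "S *v (B' *v x) = B *v x"
    by (simp add: B' matrix_vector_mul_assoc matrix_mul_assoc S_inverse)
  then have "B *v x = B *v 0" using assms by simp
  then show ?thesis using full_rank full_rank_injective[of B] by (simp only: inj_eq)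
qed

lemma lyapunov': "mat 1 - A' ** transpose A' = B' ** (H ** R) + transpose (H ** R) ** transpose B'"
proof -
  have "A' ** transpose A' = R ** A ** (S ** S) ** transpose A ** R"
    by (simp add: A' matrix_transpose_mul S_symmetric R_symmetric matrix_mul_assoc)
  moreover have "mat 1 = R ** \<Sigma> ** R"
  proof -
    have "(R ** S) ** (S ** R) = R ** (S ** S) ** R" by (simp only: matrix_mul_assoc)
    then show ?thesis by (simp add: S_inverse SS)
  qed
  ultimately have "mat 1 - A' ** transpose A' = R ** (\<Sigma> - A ** \<Sigma> ** transpose A) ** R"
    by (simp add: SS mult_diff_left mult_diff_right matrix_mul_assoc)
  also have "\<dots> = B' ** (H ** R) + transpose (H ** R) ** transpose B'"
    by (simp add: H B' matrix_transpose_mul R_symmetric matrix_add_ldistrib matrix_add_rdistrib matrix_mul_assoc)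
  finally show ?thesis .
qed

lemma transfer_fun':
  assumes z: "z \<in> circ"
  shows "transfer_fun A' B' z = cmat R ** transfer_fun A B z"
proof -
  let ?N = "mat z - cmat A" and ?N' = "mat z - cmat A'"
  have inv: "invertible ?N" "invertible ?N'" using z by (auto intro: resolvent_invertible stable stable')
  have "mat z = cmat R ** mat z ** cmat S"
  proof -
    have "cmat R ** mat z = mat z ** cmat R" by (simp add: mult_mat mat_mult)
    then have "cmat R ** mat z ** cmat S = mat z ** cmat (R ** S)"
      by (simp only: cmat_mult matrix_mul_assoc)
    then show ?thesis by (simp add: S_inverse)
  qed
  then have N': "?N' = cmat R ** ?N ** cmat S"
    by (simp add: A' cmat_mult mult_diff_left mult_diff_right)
  have "?N' ** (cmat R ** transfer_fun A B z) = cmat R ** ?N ** cmat (S ** R) ** transfer_fun A B z"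
    by (simp add: N' cmat_mult matrix_mul_assoc)
  also have "\<dots> = cmat R ** (?N ** matrix_inv ?N) ** cmat B"
    by (simp add: S_inverse transfer_fun_def matrix_mul_assoc)
  also have "\<dots> = cmat B'" by (simp add: matrix_inv_works[OF inv(1)] B' cmat_mult)
  finally have "matrix_inv ?N' ** (?N' ** (cmat R ** transfer_fun A B z)) = transfer_fun A' B' z"
    by (simp add: transfer_fun_def)
  then show ?thesis by (simp add: matrix_mul_assoc matrix_inv_works[OF inv(2)])
qed

lemma feasible': "feasible A' B' (mat 1) = feasible A B \<Sigma>"
proof -
  interpret f: stable_filter A B by (rule stable_filter.intro[OF stable])
  have "Gamma_op A' B' \<Phi> = cmat (mat 1) \<longleftrightarrow> Gamma_op A B \<Phi> = cmat \<Sigma>" if "\<Phi> \<in> S_plus" for \<Phi>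
  proof -
    have int: "integrable circle \<Phi>" using that by (simp add: S_plus_def spectral_density_def)
    have lin: "bounded_linear (\<lambda>X :: complex^'n^'n. cmat R ** X ** cmat R)"
      by (intro bounded_linear_compose[OF bounded_bilinear.bounded_linear_left[OF bounded_bilinear_matrix_mult]]
          bounded_bilinear.bounded_linear_right[OF bounded_bilinear_matrix_mult])
    have "Gamma_op A' B' \<Phi>
        = (LINT z|circle. cmat R ** (transfer_fun A B z ** \<Phi> z ** adj (transfer_fun A B z)) ** cmat R)"
      unfolding Gamma_op_def
      by (intro integral_circle_cong) (simp add: transfer_fun' adj_mult adj_cmat R_symmetric matrix_mul_assoc)
    also have "\<dots> = cmat R ** Gamma_op A B \<Phi> ** cmat R"
      unfolding Gamma_op_def by (rule integral_bounded_linear[OF lin f.integrable_moment[OF int]])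
    finally have eq: "Gamma_op A' B' \<Phi> = cmat R ** Gamma_op A B \<Phi> ** cmat R" .
    have undo: "cmat S ** (cmat R ** X ** cmat R) ** cmat S = X" for X
    proof -
      have "cmat S ** (cmat R ** X ** cmat R) ** cmat S = cmat (S ** R) ** X ** cmat (R ** S)"
        by (simp only: cmat_mult matrix_mul_assoc)
      then show ?thesis by (simp add: S_inverse)
    qed
    show ?thesis
    proof
      assume "Gamma_op A' B' \<Phi> = cmat (mat 1)"
      then have "cmat R ** Gamma_op A B \<Phi> ** cmat R = mat 1" using eq by simp
      then have "Gamma_op A B \<Phi> = cmat S ** mat 1 ** cmat S" using undo[of "Gamma_op A B \<Phi>"] by simp
      then show "Gamma_op A B \<Phi> = cmat \<Sigma>" by (simp add: cmat_mult[symmetric] SS)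
    next
      assume "Gamma_op A B \<Phi> = cmat \<Sigma>"
      then have "Gamma_op A' B' \<Phi> = cmat (R ** (S ** S) ** R)"
        by (simp add: eq SS cmat_mult)
      also have "R ** (S ** S) ** R = (R ** S) ** (S ** R)" by (simp only: matrix_mul_assoc)
      finally show "Gamma_op A' B' \<Phi> = cmat (mat 1)" by (simp add: S_inverse)
    qed
  qed
  then show ?thesis by (auto simp: feasible_def)
qed

end

theorem mainTheorem3:
  fixes A \<Sigma> A' :: "real^'n^'n" and B B' :: "real^'m^'n" and H :: "real^'n^'m"
    and \<Psi> W :: "complex \<Rightarrow> complex^'m^'m"
  assumes dim: "CARD('m) \<le> CARD('n)"
    and stable: "stable_matrix A"
    and full_rank: "rank B = CARD('m)"
    and reach: "reachable A B"
    and prior: "\<Psi> \<in> S_plus"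
    and regular: "lipschitz_density \<Psi>"
    and factor: "stable_min_phase_factor W \<Psi>"
    and Sigma: "sym_pos_def \<Sigma>"
    and H: "\<Sigma> - A ** \<Sigma> ** transpose A = B ** H + transpose H ** transpose B"
    and A': "A' = matrix_inv (matrix_sqrt \<Sigma>) ** A ** matrix_sqrt \<Sigma>"
    and B': "B' = matrix_inv (matrix_sqrt \<Sigma>) ** B"
  shows
    \<comment> \<open>the normalized problem is equivalent to the original one\<close>
    "(\<forall>z\<in>sphere 0 1. transfer_fun A' B' z = cmat (matrix_inv (matrix_sqrt \<Sigma>)) ** transfer_fun A B z) \<and>
     feasible A' B' (mat 1) = feasible A B \<Sigma> \<and>
     (\<exists>L0.
        \<comment> \<open>part 1\<close>
        L0 \<in> L_plus A' B' W \<and>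
        (\<forall>L\<in>L_plus A' B' W. J_fun A' B' W L0 \<le> J_fun A' B' W L) \<and>
        (\<forall>L1\<in>L_plus A' B' W. (\<forall>L\<in>L_plus A' B' W. J_fun A' B' W L1 \<le> J_fun A' B' W L) \<longrightarrow> L1 = L0) \<and>
        (\<forall>dL. transpose dL = dL \<longrightarrow>
           ((\<lambda>t. (J_fun A' B' W (L0 + t *\<^sub>R dL) - J_fun A' B' W L0) / ereal t) \<longlongrightarrow> 0) (at (0::real))) \<and>
        mat 1 = (LINT z|circle. G1 A' B' W z ** matrix_inv (dual_density A' B' W L0 z) ** adj (G1 A' B' W z)) \<and>
        mat 1 = (LINT z|circle. transfer_fun A' B' z ** Phi_opt A' B' \<Psi> L0 z ** adj (transfer_fun A' B' z)) \<and>
        \<comment> \<open>part 2\<close>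
        Phi_opt A' B' \<Psi> L0 \<in> feasible A B \<Sigma> \<and>
        (\<forall>\<Phi>\<in>feasible A B \<Sigma>. d_RER (Phi_opt A' B' \<Psi> L0) \<Psi> \<le> d_RER \<Phi> \<Psi>) \<and>
        (\<forall>\<Phi>\<in>feasible A B \<Sigma>. (\<forall>\<Phi>'\<in>feasible A B \<Sigma>. d_RER \<Phi> \<Psi> \<le> d_RER \<Phi>' \<Psi>) \<longrightarrow>
           (AE z in circle. \<Phi> z = Phi_opt A' B' \<Psi> L0 z)) \<and>
        \<comment> \<open>part 3\<close>
        McMillan_degree (Phi_opt A' B' \<Psi> L0) \<le> McMillan_degree \<Psi> + enat (2 * CARD('n)))"
proof -
  interpret n: moment_normalization A \<Sigma> A' B B' H
    by (rule moment_normalization.intro[OF stable full_rank Sigma H A' B'])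
  obtain F \<alpha> LF where F: "symbol F" "0 < \<alpha>" "\<And>z. z \<in> circ \<Longrightarrow> pos_semidef (F z - \<alpha> *\<^sub>R mat 1)" "0 \<le> LF"
    "\<And>z w. z \<in> circ \<Longrightarrow> w \<in> circ \<Longrightarrow> norm (F z - F w) \<le> LF * norm (z - w)" "AE z in circle. \<Psi> z = F z"
    using lipschitz_representative[OF prior regular] by blast
  have \<Psi>: "\<Psi> \<in> borel_measurable circle"
    using prior by (auto simp: S_plus_def spectral_density_def)
  have W: "W \<in> borel_measurable circle" "AE z in circle. \<Psi> z = W z ** adj (W z)"
    using factor by (auto simp: stable_min_phase_factor_def)
  interpret p: normalized_problem A' B' "H ** matrix_inv (matrix_sqrt \<Sigma>)" F \<alpha> LF \<Psi> W
    by unfold_locales (fact n.stable' n.injective' n.lyapunov' F \<Psi> W)+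
  obtain L0 s where L0: "L0 \<in> range_Gamma A' B'" "0 < s" "p.coercive_by s L0" "p.residual L0 = 0"
    using p.stationary_point_exists by blast
  interpret q: stationary_problem A' B' "H ** matrix_inv (matrix_sqrt \<Sigma>)" F \<alpha> LF \<Psi> W L0 s
    by unfold_locales (fact L0)+
  have feas: "feasible A B \<Sigma> = feasible A' B' (mat 1)" by (simp only: n.feasible')
  show ?thesis
  proof (intro conjI ballI allI impI exI[of _ L0])
    show "transfer_fun A' B' z = cmat (matrix_inv (matrix_sqrt \<Sigma>)) ** transfer_fun A B z"
      if "z \<in> sphere 0 1" for z by (rule n.transfer_fun'[OF that])
    show "feasible A' B' (mat 1) = feasible A B \<Sigma>" by (simp only: feas)
    show "L0 \<in> L_plus A' B' W" by (rule q.L0_L_plus)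
    show "J_fun A' B' W L0 \<le> J_fun A' B' W L" if "L \<in> L_plus A' B' W" for L
      by (rule q.dual_optimality(1)[OF that])
    show "L1 = L0" if "L1 \<in> L_plus A' B' W" "\<forall>L\<in>L_plus A' B' W. J_fun A' B' W L1 \<le> J_fun A' B' W L" for L1
      using q.dual_optimality(2)[OF that(1)] that(2) q.L0_L_plus by blast
    show "((\<lambda>t. (J_fun A' B' W (L0 + t *\<^sub>R dL) - J_fun A' B' W L0) / ereal t) \<longlongrightarrow> 0) (at (0::real))"
      if "transpose dL = dL" for dL by (rule q.J_fun_directional[OF that])
    show "mat 1 = (LINT z|circle. G1 A' B' W z ** matrix_inv (dual_density A' B' W L0 z) ** adj (G1 A' B' W z))"
      by (rule q.dual_density_moment[symmetric])
    show "mat 1 = (LINT z|circle. transfer_fun A' B' z ** Phi_opt A' B' \<Psi> L0 z ** adj (transfer_fun A' B' z))"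
      using q.Phi_opt_moment by (simp only: Gamma_op_def)
    show "Phi_opt A' B' \<Psi> L0 \<in> feasible A B \<Sigma>" unfolding feas by (rule q.Phi_opt_feasible)
    show "d_RER (Phi_opt A' B' \<Psi> L0) \<Psi> \<le> d_RER \<Phi> \<Psi>" if "\<Phi> \<in> feasible A B \<Sigma>" for \<Phi>
      using that unfolding feas by (rule q.primal_optimality(1))
    show "AE z in circle. \<Phi> z = Phi_opt A' B' \<Psi> L0 z"
      if "\<Phi> \<in> feasible A B \<Sigma>" "\<forall>\<Phi>'\<in>feasible A B \<Sigma>. d_RER \<Phi> \<Psi> \<le> d_RER \<Phi>' \<Psi>" for \<Phi>
      using that q.Phi_opt_feasible unfolding feas by (intro q.primal_optimality(2)) auto
    show "McMillan_degree (Phi_opt A' B' \<Psi> L0) \<le> McMillan_degree \<Psi> + enat (2 * CARD('n))"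
      by (rule q.degree_bound)
  qed
qed

end
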